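(* Assume the MDS conjecture. Let $\mathcal{R}$ be a finite chain ring with maximal ideal $\langle\gamma\rangle$, nilpotency index $s$ and residue field of size $q$. Let $\mathcal{C}\subseteq\mathcal{R}^n$ be a linear code of rank $K$. Then the following hold. (1) If $K\in\{0,n\}$, then $\mathcal{C}$ is MHD. (2) If $n>q+1$ and $K=1$, then $\mathcal{C}$ is MHD if and only if $\mathcal{C}\subseteq\langle\gamma^{s-1}\rangle^n$ and $\mathcal{C}$ is an MDS code. (3) If $n>q+1$, $q>2$ and $K=n-1$, then $\mathcal{C}$ is MHD if and only if $\mathcal{C}\cap\langle\gamma^{s-1}\rangle^n$ is an MDS code. (4) If $n=q+1$ and $K\in\{1,2\}$, then $\mathcal{C}$ is MHD if and only if $\mathcal{C}\subseteq\langle\gamma^{s-1}\rangle^n$ and $\mathcal{C}$ is an MDS code. (5) If $n=q$ and $K=1$, then $\mathcal{C}$ is MHD if and only if $\mathcal{C}\subseteq\langle\gamma^{s-1}\rangle^n$ and $\mathcal{C}$ is an MDS code. (6) If $n\le q+1$ and $K>n-q+1$, then $\mathcal{C}$ is MHD if and only if $\mathcal{C}\cap\langle\gamma^{s-1}\rangle^n$ is an MDS code. Moreover, MHD codes also exist in each of the following two cases, and there it is a necessary condition for $\mathcal{C}$ to be MHD that $\mathcal{C}\cap\langle\gamma^{s-1}\rangle^n$ is an MDS code: (7) $n>q+1$, $q=2$ and $K=n-1$; (8) $q$ even, $n=q+2$ and $K\in\{3,n-3\}$. If $(q,n,K)$ does not satisfy the parameter conditions of any of (1)-(8), then $\mathcal{C}$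 is not MHD.
   Context: $\mathcal{R}$ is a finite chain ring (not necessarily commutative) with maximal ideal $\langle\gamma\rangle=\gamma\mathcal{R}=\mathcal{R}\gamma$; $s$ is the nilpotency index of $\gamma$ (least positive integer with $\gamma^s=0$); $q$ is the size of the residue field. The socle of $\mathcal{R}$ is $\langle\gamma^{s-1}\rangle$ (with $\gamma^0=1$). A linear code of length $n$ ($n\ge1$) is a left $\mathcal{R}$-submodule $\mathcal{C}\subseteq\mathcal{R}^n$. Its rank $K$ is the minimal number of generators of $\mathcal{C}$. Homogeneous weight: put $M=\frac{q}{q-1}$. For $x\in\mathcal{R}$, $\mathrm{wt}_{\mathrm{Hom}}(x)=0$ if $x=0$, $=M$ if $x\in\langle\gamma^{s-1}\rangle\setminus\{0\}$, and $=1$ if $x\notin\langle\gamma^{s-1}\rangle$. For $x\in\mathcal{R}^n$, $\mathrm{wt}_{\mathrm{Hom}}(x)=\sum_{i=1}^n\mathrm{wt}_{\mathrm{Hom}}(x_i)$. For a linear code $\mathcal{C}\ne\{0\}$, $d_{\mathrm{Hom}}(\mathcal{C})=\min\{\mathrm{wt}_{\mathrm{Hom}}(c): c\in\mathcal{C}\setminus\{0\}\}$; by convention $d_{\mathrm{Hom}}(\{0\})=M(n+1)$. A linear code $\mathcal{C}\subseteq\mathcal{R}^n$ of rank $K$ is a Maximum Homogeneous Distance (MHD) code if $d_{\mathrm{Hom}}(\mathcal{C})>M(n-K)$. Via the isomorphism $\mathcal{R}/\langle\gamma\rangle\to\langle\gamma^{s-1}\rangle$, $r+\langle\gamma\rangle\mapsto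 r\gamma^{s-1}$, applied coordinatewise, a linear code contained in $\langle\gamma^{s-1}\rangle^n$ is identified with a linear code in $\mathbb{F}_q^n$; it is called MDS if that code over $\mathbb{F}_q$ is MDS. The code $\mathcal{C}\cap\langle\gamma^{s-1}\rangle^n$ has $\mathbb{F}_q$-dimension $K$. A linear code over $\mathbb{F}_q$ of length $n$ and dimension $k$ is MDS if its minimum Hamming distance equals $n-k+1$, where the zero code is given minimum Hamming distance $n+1$ by convention. A linear code in $\mathbb{F}_q^n$ of dimension $k$ is trivial if $k\in\{0,1,n-1,n\}$. MDS conjecture: for every prime power $q$, if there is a non-trivial MDS code in $\mathbb{F}_q^n$ of dimension $k$, then $n\le q+1$, except when $q$ is even and $k=3$ or $k=q-1$, in which case $n\le q+2$. *)

theory Defs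
  imports "HOL-Algebra.Algebra" Complex_Main
begin

section \<open>Finite chain rings\<close>

definition left_ideal :: "('a, 'b) ring_scheme \<Rightarrow> 'a set \<Rightarrow> bool" where
  "left_ideal R I \<longleftrightarrow> additive_subgroup I R \<and> (\<forall>r \<in> carrier R. \<forall>x \<in> I. r \<otimes>\<^bsub>R\<^esub> x \<in> I)"

definition right_ideal :: "('a, 'b) ring_scheme \<Rightarrow> 'a set \<Rightarrow> bool" where
  "right_ideal R I \<longleftrightarrow> additive_subgroup I R \<and> (\<forall>r \<in> carrier R. \<forall>x \<in> I. x \<otimes>\<^bsub>R\<^esub> r \<in> I)"

locale finite_chain_ring = ring R for R (structure) +
  assumes finite_carrier: "finite (carrier R)"
    and one_noteq_zero: "\<one> \<noteq> \<zero>"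
    and left_chain: "\<lbrakk>left_ideal R I; left_ideal R J\<rbrakk> \<Longrightarrow> I \<subseteq> J \<or> J \<subseteq> I"
    and right_chain: "\<lbrakk>right_ideal R I; right_ideal R J\<rbrakk> \<Longrightarrow> I \<subseteq> J \<or> J \<subseteq> I"

text \<open>
  The library's \<open>PIdl\<^bsub>R\<^esub> g\<close> is by definition the set \<open>R g\<close> of left multiples of \<open>g\<close>,
  also when \<open>R\<close> is not commutative.
\<close>
definition generates_maximal_ideal :: "('a, 'b) ring_scheme \<Rightarrow> 'a \<Rightarrow> bool" where
  "generates_maximal_ideal R g \<longleftrightarrow>
     g \<in> carrier R \<and> maximalideal (PIdl\<^bsub>R\<^esub> g) R \<and> PIdl\<^bsub>R\<^esub> g = {g \<otimes>\<^bsub>R\<^esub> x | x. x \<in> carrier R}"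

definition nilpotency_index :: "('a, 'b) ring_scheme \<Rightarrow> 'a \<Rightarrow> nat" where
  "nilpotency_index R g = (LEAST s. 0 < s \<and> g [^]\<^bsub>R\<^esub> s = \<zero>\<^bsub>R\<^esub>)"

definition residue_field :: "('a, 'b) ring_scheme \<Rightarrow> 'a \<Rightarrow> 'a set ring" where
  "residue_field R g = R Quot (PIdl\<^bsub>R\<^esub> g)"

definition residue_size :: "('a, 'b) ring_scheme \<Rightarrow> 'a \<Rightarrow> nat" where
  "residue_size R g = card (carrier (residue_field R g))"

definition socle :: "('a, 'b) ring_scheme \<Rightarrow> 'a \<Rightarrow> 'a set" where
  "socle R g = PIdl\<^bsub>R\<^esub> (g [^]\<^bsub>R\<^esub> (nilpotency_index R g - 1))"

section \<open>Linear codes\<close>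

text \<open>
  Words of length \<open>n\<close> over a set \<open>A\<close> are the extensional functions in \<open>{..<n} \<rightarrow>\<^sub>E A\<close>.
  A linear code is a left submodule; additive inverses come from multiplication by \<open>-1\<close>.
\<close>
definition linear_code :: "('a, 'b) ring_scheme \<Rightarrow> nat \<Rightarrow> (nat \<Rightarrow> 'a) set \<Rightarrow> bool" where
  "linear_code R n C \<longleftrightarrow>
     C \<subseteq> {..<n} \<rightarrow>\<^sub>E carrier R \<and>
     (\<lambda>i\<in>{..<n}. \<zero>\<^bsub>R\<^esub>) \<in> C \<and>
     (\<forall>x \<in> C. \<forall>y \<in> C. (\<lambda>i\<in>{..<n}. x i \<oplus>\<^bsub>R\<^esub> y i) \<in> C) \<and>
     (\<forall>r \<in> carrier R. \<forall>x \<in> C. (\<lambda>i\<in>{..<n}. r \<otimes>\<^bsub>R\<^esub> x i) \<in> C)"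

definition zero_code :: "('a, 'b) ring_scheme \<Rightarrow> nat \<Rightarrow> (nat \<Rightarrow> 'a) set" where
  "zero_code R n = {\<lambda>i\<in>{..<n}. \<zero>\<^bsub>R\<^esub>}"

text \<open>For \<open>S \<subseteq> C\<close>, \<open>linear_code R n hull S\<close> is the submodule generated by \<open>S\<close>.\<close>
definition code_rank :: "('a, 'b) ring_scheme \<Rightarrow> nat \<Rightarrow> (nat \<Rightarrow> 'a) set \<Rightarrow> nat" where
  "code_rank R n C = (LEAST k. \<exists>S \<subseteq> C. finite S \<and> card S = k \<and> linear_code R n hull S = C)"

section \<open>Homogeneous distance and MHD codes\<close>

definition hom_max :: "('a, 'b) ring_scheme \<Rightarrow> 'a \<Rightarrow> real" where
  "hom_max R g = real (residue_size R g) / (real (residue_size R g) - 1)"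

definition hom_wt :: "('a, 'b) ring_scheme \<Rightarrow> 'a \<Rightarrow> 'a \<Rightarrow> real" where
  "hom_wt R g x = (if x = \<zero>\<^bsub>R\<^esub> then 0 else if x \<in> socle R g then hom_max R g else 1)"

definition hom_weight :: "('a, 'b) ring_scheme \<Rightarrow> 'a \<Rightarrow> nat \<Rightarrow> (nat \<Rightarrow> 'a) \<Rightarrow> real" where
  "hom_weight R g n x = (\<Sum>i<n. hom_wt R g (x i))"

definition hom_dist :: "('a, 'b) ring_scheme \<Rightarrow> 'a \<Rightarrow> nat \<Rightarrow> (nat \<Rightarrow> 'a) set \<Rightarrow> real" where
  "hom_dist R g n C =
     (if C = zero_code R n then hom_max R g * (real n + 1)
      else Min (hom_weight R g n ` (C - zero_code R n)))"

definition mhd_code :: "('a, 'b) ring_scheme \<Rightarrow> 'a \<Rightarrow> nat \<Rightarrow> (nat \<Rightarrow> 'a) set \<Rightarrow> bool" where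
  "mhd_code R g n C \<longleftrightarrow>
     linear_code R n C \<and>
     hom_dist R g n C > hom_max R g * (real n - real (code_rank R n C))"

section \<open>MDS codes over fields\<close>

definition lin_indep :: "('a, 'b) ring_scheme \<Rightarrow> nat \<Rightarrow> (nat \<Rightarrow> 'a) set \<Rightarrow> bool" where
  "lin_indep F n B \<longleftrightarrow>
     finite B \<and>
     (\<forall>a \<in> B \<rightarrow> carrier F.
        (\<forall>i<n. (\<Oplus>\<^bsub>F\<^esub>b\<in>B. a b \<otimes>\<^bsub>F\<^esub> b i) = \<zero>\<^bsub>F\<^esub>) \<longrightarrow> (\<forall>b\<in>B. a b = \<zero>\<^bsub>F\<^esub>))"

definition code_basis :: "('a, 'b) ring_scheme \<Rightarrow> nat \<Rightarrow> (nat \<Rightarrow> 'a) set \<Rightarrow> (nat \<Rightarrow> 'a) set \<Rightarrow> bool" where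
  "code_basis F n C B \<longleftrightarrow> B \<subseteq> C \<and> lin_indep F n B \<and> linear_code F n hull B = C"

definition code_dim :: "('a, 'b) ring_scheme \<Rightarrow> nat \<Rightarrow> (nat \<Rightarrow> 'a) set \<Rightarrow> nat" where
  "code_dim F n C = (THE k. \<exists>B. code_basis F n C B \<and> card B = k)"

definition hamming_weight :: "('a, 'b) ring_scheme \<Rightarrow> nat \<Rightarrow> (nat \<Rightarrow> 'a) \<Rightarrow> nat" where
  "hamming_weight F n x = card {i. i < n \<and> x i \<noteq> \<zero>\<^bsub>F\<^esub>}"

definition hamming_dist :: "('a, 'b) ring_scheme \<Rightarrow> nat \<Rightarrow> (nat \<Rightarrow> 'a) set \<Rightarrow> nat" where
  "hamming_dist F n C =
     (if C = zero_code F n then n + 1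
      else Min (hamming_weight F n ` (C - zero_code F n)))"

definition mds_code :: "('a, 'b) ring_scheme \<Rightarrow> nat \<Rightarrow> (nat \<Rightarrow> 'a) set \<Rightarrow> bool" where
  "mds_code F n C \<longleftrightarrow>
     linear_code F n C \<and> int (hamming_dist F n C) = int n - int (code_dim F n C) + 1"

text \<open>
  Every finite field has an isomorphic copy whose carrier is a set of natural numbers, so
  quantifying over records on \<open>nat\<close> covers \<open>\<bbbF>\<^sub>q\<close> for every prime power \<open>q\<close>.
\<close>
definition mds_conjecture :: bool where
  "mds_conjecture \<longleftrightarrow>
     (\<forall>(F :: nat ring) n C.
        let q = card (carrier F); k = code_dim F n C in
        field F \<and> finite (carrier F) \<and> n \<ge> 1 \<and> mds_code F n C \<and> k \<notin> {0, 1, n - 1, n} \<longrightarrow>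
        (if even q \<and> (k = 3 \<or> k = q - 1) then n \<le> q + 2 else n \<le> q + 1))"

section \<open>Codes in the socle as codes over the residue field\<close>

text \<open>The map \<open>r + R g \<mapsto> r g\<^sup>s\<^sup>-\<^sup>1\<close>, where \<open>s\<close> is the nilpotency index of \<open>g\<close>.\<close>
definition socle_iso :: "('a, 'b) ring_scheme \<Rightarrow> 'a \<Rightarrow> 'a set \<Rightarrow> 'a" where
  "socle_iso R g A = the_elem ((\<lambda>r. r \<otimes>\<^bsub>R\<^esub> (g [^]\<^bsub>R\<^esub> (nilpotency_index R g - 1))) ` A)"

definition socle_words :: "('a, 'b) ring_scheme \<Rightarrow> 'a \<Rightarrow> nat \<Rightarrow> (nat \<Rightarrow> 'a) set" where
  "socle_words R g n = ({..<n} \<rightarrow>\<^sub>E socle R g)"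

definition residue_code :: "('a, 'b) ring_scheme \<Rightarrow> 'a \<Rightarrow> nat \<Rightarrow> (nat \<Rightarrow> 'a) set \<Rightarrow> (nat \<Rightarrow> 'a set) set" where
  "residue_code R g n D =
     {v \<in> {..<n} \<rightarrow>\<^sub>E carrier (residue_field R g). (\<lambda>i\<in>{..<n}. socle_iso R g (v i)) \<in> D}"

definition socle_mds_code :: "('a, 'b) ring_scheme \<Rightarrow> 'a \<Rightarrow> nat \<Rightarrow> (nat \<Rightarrow> 'a) set \<Rightarrow> bool" where
  "socle_mds_code R g n D \<longleftrightarrow>
     linear_code R n D \<and> D \<subseteq> socle_words R g n \<and>
     mds_code (residue_field R g) n (residue_code R g n D)"

end

theory Submission
  imports Defs "HOL-Computational_Algebra.Polynomial"
begin

text \<open>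
  Let \<open>D\<close> be the intersection of \<open>C\<close> with the socle words. It is the kernel of
  \<open>c \<mapsto> \<gamma> c\<close> on \<open>C\<close>, so it has as many elements as \<open>C / \<gamma> C\<close>. This number is \<open>q ^ K\<close>,
  since relations between minimal generators have no unit coefficients.
  On \<open>D\<close> the homogeneous weight is \<open>M\<close> times the Hamming weight, hence an MHD code has an
  MDS socle code \<open>D\<close>. Conversely, let \<open>D\<close> be MDS. A power of \<open>\<gamma>\<close> moves any word into \<open>D\<close> without enlarging its
  support, so all words of \<open>C\<close> have Hamming weight at least \<open>n - K + 1\<close>, which exceeds
  \<open>M (n - K)\<close> as soon as \<open>n - K < q - 1\<close>. For \<open>K = 1\<close>, \<open>n \<ge> q\<close> and for \<open>K = 2\<close>, \<open>n = q + 1\<close>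
  a word outside the socle could be corrected by a word of \<open>D\<close> to one of homogeneous weight
  at most \<open>M (n - K)\<close>. The residue ring is a field by Wedderburn's theorem, so the MDS
  conjecture restricts the remaining parameters. The codes in the two exceptional cases are the
  parity check code, the hyperoval code and its dual.
\<close>

section \<open>Values of cyclotomic polynomials at integers\<close>

text \<open>Rank over \<open>R\<close> and dimension over the residue field rest on different kinds
  of generating sets, so they are compared only through cardinalities: the size of the socle part of
  a code determines both. The case distinction comes from one computation:
  \<open>M (n - K) = (n - K) q / (q - 1)\<close> is below, equal to or above
  \<open>n - K + 1\<close> according as \<open>n - K\<close> is below, equal to or above
  \<open>q - 1\<close>. A word outside the socle may have weight as small as its Hamming weight, so
  from \<open>n - K = q - 1\<close> on such words are a danger; the pairs \<open>n = q\<close>,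
  \<open>K = 1\<close> and \<open>n = q + 1\<close>, \<open>K = 2\<close> are cases of equality. The
  dangerous words are those just above the socle, where multiplication by \<open>g\<close> already
  gives a socle word. The second obstacle is noncommutativity: \<open>g\<close> passes a coefficient
  only through \<open>g R = R g\<close>, which changes the coefficient, and the residue ring is at
  first only a finite division ring. Its commutativity is proved by Witt's class equation argument,
  which needs an integer larger than \<open>q - 1\<close> dividing certain quotients of
  \<open>q ^ n - 1\<close>. The value of a cyclotomic polynomial at \<open>q\<close> is such an
  integer.\<close>

definition int_poly :: "complex poly \<Rightarrow> bool" where
  "int_poly p \<longleftrightarrow> (\<forall>i. coeff p i \<in> \<int>)"

lemma int_poly_mult: "int_poly p \<Longrightarrow> int_poly q \<Longrightarrow> int_poly (p * q)"
  by (auto simp: int_poly_def coeff_mult intro!: Ints_sum Ints_mult)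

lemma int_poly_prod: "(\<And>x. x \<in> A \<Longrightarrow> int_poly (f x)) \<Longrightarrow> int_poly (prod f A)"
  by (induction A rule: infinite_finite_induct) (auto simp: int_poly_mult, auto simp: int_poly_def)

lemma int_poly_eval: "int_poly p \<Longrightarrow> x \<in> \<int> \<Longrightarrow> poly p x \<in> \<int>"
  by (auto simp: int_poly_def poly_altdef intro!: Ints_sum Ints_mult Ints_power)

text \<open>Coefficient \<open>k + degree A\<close> of the product is coefficient \<open>k\<close>
  of \<open>B\<close> plus integer multiples of higher coefficients of \<open>B\<close>. As
  \<open>A\<close> is monic, no division occurs, and descending induction on \<open>k\<close> gives
  integrality.\<close>

lemma int_poly_monic_quotient:
  assumes P: "int_poly (A * B)" and A: "int_poly A" "lead_coeff A = 1"
  shows "int_poly B"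
proof -
  have "coeff B k \<in> \<int>" for k
  proof (induction "degree B - k" arbitrary: k rule: less_induct)
    case less
    show ?case
    proof (cases "k \<le> degree B")
      case False
      then show ?thesis by (simp add: coeff_eq_0)
    next
      case True
      let ?d = "degree A"
      have "coeff (A * B) (k + ?d) = (\<Sum>i\<le>k + ?d. coeff A i * coeff B (k + ?d - i))"
        by (simp add: coeff_mult)
      also have "\<dots> = (\<Sum>i\<le>?d. coeff A i * coeff B (k + ?d - i))"
        by (rule sum.mono_neutral_right) (auto simp: coeff_eq_0)
      also have "\<dots> = coeff B k + (\<Sum>i<?d. coeff A i * coeff B (k + ?d - i))"
        using A by (simp add: lessThan_Suc_atMost[symmetric])
      finally have eq: "coeff B k = coeff (A * B) (k + ?d) - (\<Sum>i<?d. coeff A i * coeff B (k + ?d - i))"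
        by simp
      have *: "coeff B (k + ?d - i) \<in> \<int>" if "i < ?d" for i
      proof (cases "k < degree B")
        case True
        then show ?thesis using less[of "k + ?d - i"] that by simp
      next
        case False
        then show ?thesis using that by (simp add: coeff_eq_0)
      qed
      show ?thesis
        unfolding eq using P A * by (auto simp: int_poly_def intro!: Ints_diff Ints_sum Ints_mult)
    qed
  qed
  then show ?thesis by (simp add: int_poly_def)
qed

section \<open>Cyclotomic polynomials over the complex numbers\<close>

definition primitive_roots :: "nat \<Rightarrow> complex set" where
  "primitive_roots n = {z. z ^ n = 1 \<and> (\<forall>m. 0 < m \<and> m < n \<longrightarrow> z ^ m \<noteq> 1)}"

text \<open>Given by its complex roots, so that its values can be bounded factor by factor;
  integrality of the coefficients is then a lemma.\<close>

definition cyclotomic :: "nat \<Rightarrow> complex poly" where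
  "cyclotomic n = (\<Prod>z\<in>primitive_roots n. [:- z, 1:])"

text \<open>The least positive exponent \<open>d\<close> with \<open>z ^ d = 1\<close> divides
  \<open>n\<close>, since a nonzero remainder of \<open>n\<close> modulo \<open>d\<close> would be a
  smaller such exponent.\<close>

lemma roots_unity_partition:
  assumes "0 < n"
  shows "{z::complex. z ^ n = 1} = (\<Union>d\<in>{d. d dvd n}. primitive_roots d)"
proof (intro equalityI subsetI)
  fix z :: complex assume z: "z \<in> {z. z ^ n = 1}"
  define d where "d = (LEAST d. 0 < d \<and> z ^ d = 1)"
  have d: "0 < d" "z ^ d = 1"
    using LeastI[of "\<lambda>d. 0 < d \<and> z ^ d = 1" n] z assms by (auto simp: d_def)
  have least: "z ^ m \<noteq> 1" if "0 < m" "m < d" for m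
    using not_less_Least[of m "\<lambda>d. 0 < d \<and> z ^ d = 1"] that by (auto simp: d_def)
  have "z ^ n = z ^ (n mod d) * (z ^ d) ^ (n div d)"
    by (metis power_mult power_add mod_mult_div_eq)
  then have "z ^ (n mod d) = 1" using z d by simp
  then have "n mod d = 0" using least[of "n mod d"] d(1) by auto
  then show "z \<in> (\<Union>d\<in>{d. d dvd n}. primitive_roots d)"
    using d least by (auto simp: primitive_roots_def)
next
  fix z assume "z \<in> (\<Union>d\<in>{d. d dvd n}. primitive_roots d)"
  then show "z \<in> {z. z ^ n = 1}"
    by (auto simp: primitive_roots_def power_mult elim!: dvdE)
qed

lemma primitive_roots_disjoint: "0 < d \<Longrightarrow> 0 < e \<Longrightarrow> d \<noteq> e \<Longrightarrow> primitive_roots d \<inter> primitive_roots e = {}"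
  by (auto simp: primitive_roots_def) (metis linorder_neqE_nat)

lemma finite_primitive_roots: "0 < d \<Longrightarrow> finite (primitive_roots d)"
  by (rule finite_subset[OF _ finite_roots_unity[of d]]) (auto simp: primitive_roots_def)

lemma prod_linear_root: "finite A \<Longrightarrow> poly (\<Prod>z\<in>A. [:- z, 1:]) x = (\<Prod>z\<in>A. x - z)" for x :: complex
  by (simp add: poly_prod)

lemma monic_linear_prod: 
  fixes A :: "complex set"
  shows "lead_coeff (\<Prod>z\<in>A. [:- z, 1:]) = 1"
  unfolding lead_coeff_prod by simp

lemma degree_linear_prod: 
  fixes A :: "complex set"
  shows "degree (\<Prod>z\<in>A. [:- z, 1:]) = card A"
  by (subst degree_prod_eq_sum_degree) auto

text \<open>The product of the linear factors of all \<open>n\<close>-th roots of unity and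
  \<open>X ^ n - 1\<close> are both monic of degree \<open>n\<close>, so their difference has degree
  below \<open>n\<close> but \<open>n\<close> roots.\<close>

lemma prod_cyclotomic:
  assumes "0 < n"
  shows "(\<Prod>d | d dvd n. cyclotomic d) = monom 1 n - 1"
proof -
  let ?A = "{z::complex. z ^ n = 1}"
  let ?P = "\<Prod>z\<in>?A. [:- z, 1:]"
  let ?Q = "monom 1 n - 1 :: complex poly"
  have card: "card ?A = n" using assms by (simp add: card_roots_unity_eq)
  have fin: "finite ?A" using assms by (intro finite_roots_unity) simp
  have "?P - ?Q = 0"
  proof (rule ccontr)
    assume neq: "?P - ?Q \<noteq> 0"
    have degQ: "degree ?Q = n" using assms
      by (subst diff_conv_add_uminus, subst degree_add_eq_left) (auto simp: degree_monom_eq)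
    have "coeff (?P - ?Q) n = 0"
      using assms degree_linear_prod[of ?A] monic_linear_prod[of ?A] card by simp
    moreover have le: "degree (?P - ?Q) \<le> n" 
      using degree_linear_prod[of ?A] card degQ by (intro degree_diff_le) (auto simp: degree_monom_le)
    ultimately have "degree (?P - ?Q) < n"
      using neq by (metis leading_coeff_0_iff le_neq_implies_less)
    moreover have "?A \<subseteq> {x. poly (?P - ?Q) x = 0}"
      using fin by (auto simp: prod_linear_root poly_monom prod_zero_iff)
    then have "n \<le> card {x. poly (?P - ?Q) x = 0}"
      using card poly_roots_finite[OF neq] card_mono by metis
    ultimately show False
      using card_poly_roots_bound[OF neq] by linarith
  qed
  moreover have "?P = (\<Prod>d | d dvd n. cyclotomic d)"
  proof -
    have "?P = (\<Prod>d\<in>{d. d dvd n}. \<Prod>z\<in>primitive_roots d. [:- z, 1:])"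
      unfolding roots_unity_partition[OF assms]
    proof (rule prod.UNION_disjoint)
      show "finite {d. d dvd n}" using assms by simp
      show "\<forall>i\<in>{d. d dvd n}. finite (primitive_roots i)"
        using assms dvd_pos_nat[of n] by (intro ballI finite_primitive_roots) simp_all
      show "\<forall>i\<in>{d. d dvd n}. \<forall>j\<in>{d. d dvd n}. i \<noteq> j \<longrightarrow> primitive_roots i \<inter> primitive_roots j = {}"
        using assms dvd_pos_nat[of n] by (intro ballI impI primitive_roots_disjoint) simp_all
    qed
    then show ?thesis by (simp add: cyclotomic_def)
  qed
  ultimately show ?thesis by simp
qed

text \<open>Strong induction: \<open>cyclotomic n\<close> is the quotient of
  \<open>X ^ n - 1\<close> by the monic product of the cyclotomic polynomials of the proper divisors
  of \<open>n\<close>.\<close>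

lemma int_poly_cyclotomic: "0 < n \<Longrightarrow> int_poly (cyclotomic n)"
proof (induction n rule: less_induct)
  case (less n)
  let ?D = "{d. d dvd n \<and> d \<noteq> n}"
  have fin: "finite ?D" using less.prems by simp
  have D: "{d. d dvd n} = insert n ?D" by auto
  have eq: "(\<Prod>d\<in>?D. cyclotomic d) * cyclotomic n = monom 1 n - 1"
    using prod_cyclotomic[OF less.prems] fin by (simp add: D mult.commute)
  have "int_poly ((\<Prod>d\<in>?D. cyclotomic d) * cyclotomic n)"
    unfolding eq by (auto simp: int_poly_def)
  moreover have "int_poly (\<Prod>d\<in>?D. cyclotomic d)"
  proof (rule int_poly_prod)
    fix d assume "d \<in> ?D"
    then have "d < n" "0 < d"
      using less.prems dvd_imp_le[of d n] dvd_pos_nat[of n d] by simp_all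
    then show "int_poly (cyclotomic d)" by (rule less.IH)
  qed
  moreover have "lead_coeff (\<Prod>d\<in>?D. cyclotomic d) = 1"
    unfolding lead_coeff_prod by (intro prod.neutral ballI) (simp only: cyclotomic_def monic_linear_prod)
  ultimately show ?case
    by (rule int_poly_monic_quotient)
qed

text \<open>The roots lie on the unit circle, so every factor has norm at least
  \<open>q - 1\<close>, which is at least 1. Strictness in a single factor is therefore enough, and
  the root \<open>cis (2 * pi / n)\<close> provides it, being different from 1.\<close>

lemma cyclotomic_value_gt:
  assumes "2 \<le> q" "2 \<le> n"
  shows "real q - 1 < norm (poly (cyclotomic n) (of_nat q))"
proof -
  let ?z = "cis (2 * pi / n)"
  have fin: "finite (primitive_roots n)" using assms by (intro finite_primitive_roots) simp
  have z: "?z \<in> primitive_roots n"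
  proof -
    have "?z ^ m \<noteq> 1" if "0 < m" "m < n" for m
    proof
      assume "?z ^ m = 1"
      then have "Re (cis (real m * (2 * pi / real n))) = 1" by (simp only: DeMoivre one_complex.sel)
      then have "cos (real m * (2 * pi / real n)) = 1" by (simp only: cis.sel)
      then obtain k :: int where "real m * (2 * pi / real n) = of_int k * 2 * pi"
        using cos_one_2pi_int by blast
      then have "real m * (2 * pi) = (of_int k * real n) * (2 * pi)" using assms by (simp add: field_simps)
      then have "real m = of_int k * real n" by simp
      then have "int m = k * int n" by (metis of_int_eq_iff of_int_mult of_int_of_nat_eq)
      then have "n dvd m" by (metis dvd_triv_right int_dvd_int_iff)
      then show False using that by (simp add: nat_dvd_not_less)
    qed
    moreover have "?z ^ n = 1" using assms by (simp add: DeMoivre)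
    ultimately show ?thesis by (auto simp: primitive_roots_def)
  qed
  have norm1: "norm w = 1" if "w \<in> primitive_roots n" for w
    using that assms power_eq_1_iff[of w n] by (auto simp: primitive_roots_def)
  have ge: "real q - 1 \<le> norm (of_nat q - w)" if "w \<in> primitive_roots n" for w
    using norm_triangle_ineq2[of "of_nat q" w] norm1[OF that] by simp
  \<comment> \<open>By the expansion of the squared norm, equality would force the real part of
    \<open>?z\<close> to be 1.\<close>
  have gt: "real q - 1 < norm (of_nat q - ?z)"
  proof (rule ccontr)
    assume "\<not> ?thesis"
    then have "norm (of_nat q - ?z) ^ 2 \<le> (real q - 1) ^ 2"
      by (intro power_mono) auto
    moreover have "norm (of_nat q - w) ^ 2 = real q ^ 2 - 2 * real q * Re w + norm w ^ 2" for w
      unfolding cmod_power2 by (simp add: power2_eq_square algebra_simps)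
    then have "norm (of_nat q - ?z) ^ 2 = real q ^ 2 - 2 * real q * Re ?z + 1" by simp
    ultimately have "2 * real q \<le> 2 * real q * Re ?z"
      by (simp add: power2_eq_square algebra_simps)
    then have "1 \<le> Re ?z" using assms by simp
    then have "cos (2 * pi / n) = 1" by (intro antisym cos_le_one) (simp only: cis.sel)
    then have "?z = 1" by (simp add: complex_eq_iff cos_one_sin_zero)
    moreover have "?z ^ 1 \<noteq> 1"
    proof -
      have "\<forall>m. 0 < m \<and> m < n \<longrightarrow> ?z ^ m \<noteq> 1" using z unfolding primitive_roots_def by blast
      moreover have "0 < (1::nat) \<and> 1 < n" using assms(2) by simp
      ultimately show ?thesis by blast
    qed
    ultimately show False by simp
  qed
  have "poly (cyclotomic n) (of_nat q) = (\<Prod>w\<in>primitive_roots n. of_nat q - w)"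
    using fin by (simp add: cyclotomic_def prod_linear_root)
  also have "norm \<dots> = norm (of_nat q - ?z) * (\<Prod>w\<in>primitive_roots n - {?z}. norm (of_nat q - w))"
    using fin z by (simp add: norm_mult prod_norm prod.remove)
  also have "\<dots> \<ge> norm (of_nat q - ?z) * 1"
  proof (intro mult_left_mono prod_ge_1)
    fix w assume "w \<in> primitive_roots n - {?z}"
    then show "1 \<le> norm (of_nat q - w)" using ge[of w] assms by simp
  qed simp
  finally show ?thesis using gt by simp
qed

text \<open>\<open>N\<close> is the absolute value of the \<open>n\<close>-th cyclotomic polynomial
  at \<open>q\<close>. The last property is what the class equation needs: \<open>N\<close> divides
  \<open>(q ^ n - 1) / (q ^ m - 1)\<close>, the size of a noncentral conjugacy class.\<close>

lemma cyclotomic_divisor: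
  fixes q n :: nat
  assumes "2 \<le> q" "2 \<le> n"
  obtains N :: int where "int q - 1 < N" "N dvd int q ^ n - 1"
    "\<And>m. 0 < m \<Longrightarrow> m < n \<Longrightarrow> m dvd n \<Longrightarrow> N * (int q ^ m - 1) dvd int q ^ n - 1"
proof -
  have div: "\<exists>k. complex_of_int (int q ^ n - 1) = poly (cyclotomic n) (of_nat q) * of_int k * of_int (int q ^ m - 1)"
    if m: "0 < m" "m < n" "m dvd n" for m
  proof -
    \<comment> \<open>The cyclotomic factors of \<open>X ^ n - 1\<close> that remain after
      \<open>cyclotomic n\<close> and \<open>X ^ m - 1\<close> are removed.\<close>
    let ?E = "{d. d dvd n \<and> d \<noteq> n \<and> \<not> d dvd m}"
    have "{d. d dvd n} = insert n (?E \<union> {d. d dvd m})" 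
      using m by (auto intro: dvd_trans)
    moreover have "finite ?E" using assms by simp
    moreover have "n \<notin> ?E \<union> {d. d dvd m}" using m by (auto dest: dvd_imp_le)
    moreover have "?E \<inter> {d. d dvd m} = {}" by auto
    moreover have "finite {d. d dvd m}" using m by simp
    ultimately have "(\<Prod>d | d dvd n. cyclotomic d) = cyclotomic n * ((\<Prod>d\<in>?E. cyclotomic d) * (\<Prod>d | d dvd m. cyclotomic d))"
      by (simp only: prod.insert prod.union_disjoint finite_Un simp_thms)
    then have eq: "monom 1 n - 1 = cyclotomic n * ((\<Prod>d\<in>?E. cyclotomic d) * (monom 1 m - 1))"
      using prod_cyclotomic[of n] prod_cyclotomic[of m] assms m by simp
    have "int_poly (\<Prod>d\<in>?E. cyclotomic d)"
      using assms by (intro int_poly_prod int_poly_cyclotomic) (auto intro: dvd_pos_nat)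
    then have "poly (\<Prod>d\<in>?E. cyclotomic d) (of_nat q) \<in> \<int>" by (intro int_poly_eval) auto
    then obtain k where k: "poly (\<Prod>d\<in>?E. cyclotomic d) (of_nat q) = of_int k" by (auto elim: Ints_cases)
    have "poly (monom 1 n - 1) (complex_of_nat q) = poly (cyclotomic n) (of_nat q) * (of_int k * poly (monom 1 m - 1) (of_nat q))"
      by (subst eq) (simp add: k)
    then show ?thesis by (intro exI[of _ k]) (simp add: poly_monom mult_ac)
  qed
  have "poly (cyclotomic n) (of_nat q) \<in> \<int>"
    using assms by (intro int_poly_eval int_poly_cyclotomic) auto
  then obtain M where M: "poly (cyclotomic n) (of_nat q) = of_int M" by (auto elim: Ints_cases)
  have dvd: "M * (int q ^ m - 1) dvd int q ^ n - 1" if m: "0 < m" "m < n" "m dvd n" for m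
  proof -
    obtain k where "complex_of_int (int q ^ n - 1) = of_int M * of_int k * of_int (int q ^ m - 1)"
      using div[OF m] unfolding M by blast
    then have "complex_of_int (int q ^ n - 1) = of_int (M * (int q ^ m - 1) * k)"
      by (simp only: of_int_mult mult_ac)
    then have "int q ^ n - 1 = M * (int q ^ m - 1) * k" by (simp only: of_int_eq_iff)
    then show ?thesis by (rule dvdI)
  qed
  \<comment> \<open>The estimate concerns the norm and leaves the sign of \<open>M\<close> open, so
    the witness is \<open>\<bar>M\<bar>\<close>.\<close>
  have gt: "int q - 1 < \<bar>M\<bar>"
  proof -
    have "real q - 1 < real_of_int \<bar>M\<bar>"
      using cyclotomic_value_gt[OF assms] by (simp add: M)
    then show ?thesis by linarith
  qed
  have 1: "\<bar>M\<bar> dvd int q ^ n - 1"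
    proof -
    have "M * (int q ^ 1 - 1) dvd int q ^ n - 1" using assms by (intro dvd) simp_all
    then show ?thesis unfolding abs_dvd_iff by (rule dvd_mult_left)
  qed
  have "\<bar>M\<bar> * (int q ^ m - 1) dvd int q ^ n - 1" if m: "0 < m" "m < n" "m dvd n" for m
    using dvd[OF m] by (cases "0 \<le> M") (simp_all only: abs_of_nonneg abs_of_neg not_le mult_minus_left minus_dvd_iff)
  with gt 1 show thesis by (rule that)
qed

section \<open>Finite division rings are commutative\<close>

context ring begin

text \<open>Right multiplication by \<open>b\<close> is an injective self-map of the finite set
  \<open>K\<close>, hence onto; the inverse is thus found inside \<open>K\<close> and not only in
  \<open>R\<close>.\<close>

lemma finite_subring_inverse:
  assumes fin: "finite K" and K: "subring K R" and units: "\<And>x. x \<in> K \<Longrightarrow> x \<noteq> \<zero> \<Longrightarrow> x \<in> Units R"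
    and b: "b \<in> K" "b \<noteq> \<zero>"
  obtains c where "c \<in> K" "c \<otimes> b = \<one>"
proof -
  interpret K: subring K R by fact
  have sub: "K \<subseteq> carrier R" by (rule K.subset)
  have "inj_on (\<lambda>x. x \<otimes> b) K"
  proof (rule inj_onI)
    fix x y assume xy: "x \<in> K" "y \<in> K" "x \<otimes> b = y \<otimes> b"
    have bU: "b \<in> Units R" using b units by blast
    have c: "x \<in> carrier R" "y \<in> carrier R" and bc: "b \<in> carrier R" using xy b sub by auto
    have "x \<otimes> b \<otimes> inv b = y \<otimes> b \<otimes> inv b" by (simp only: xy(3))
    then show "x = y" using c bc bU by (simp add: m_assoc)
  qed
  moreover have "(\<lambda>x. x \<otimes> b) ` K \<subseteq> K" using b by auto
  ultimately have "(\<lambda>x. x \<otimes> b) ` K = K" using fin by (simp add: endo_inj_surj)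
  then have "\<one> \<in> (\<lambda>x. x \<otimes> b) ` K" using K.one_closed by (simp only:)
  then obtain c where "c \<in> K" "\<one> = c \<otimes> b" by blast
  then show thesis using that by metis
qed

text \<open>This replaces a dimension over the possibly noncommutative \<open>K\<close>. Among the
  submodules of \<open>V\<close> whose size is a power of \<open>card K\<close>, a largest one
  \<open>W\<close> must be \<open>V\<close>: a vector \<open>v\<close> outside \<open>W\<close>
  would give the submodule \<open>K v + W\<close> with \<open>card K * card W\<close>
  elements.\<close>

lemma card_subring_space:
  assumes fin: "finite (carrier R)" and K: "subring K R" and one: "\<one> \<noteq> \<zero>"
    and units: "\<And>x. x \<in> K \<Longrightarrow> x \<noteq> \<zero> \<Longrightarrow> x \<in> Units R"
    and V: "subgroup V (add_monoid R)" "\<And>a v. a \<in> K \<Longrightarrow> v \<in> V \<Longrightarrow> a \<otimes> v \<in> V"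
  obtains k where "card V = card K ^ k"
proof -
  interpret K: subring K R by fact
  define S where "S = {W. W \<subseteq> V \<and> subgroup W (add_monoid R) \<and> (\<forall>a\<in>K. \<forall>v\<in>W. a \<otimes> v \<in> W) \<and> (\<exists>k. card W = card K ^ k)}"
  have subK: "K \<subseteq> carrier R" by (rule K.subset)
  have finK: "finite K" using finite_subset[OF subK fin] .
  have subV: "V \<subseteq> carrier R" using subgroup.subset[OF V(1)] by simp
  have finV: "finite V" using finite_subset[OF subV fin] .
  have cardK: "2 \<le> card K"
  proof -
    have "{\<zero>, \<one>} \<subseteq> K" using subringE(2,3)[OF K] by blast
    then have "card {\<zero>, \<one>} \<le> card K" using finK card_mono by blast
    then show ?thesis using one by simp
  qed
  have finS: "finite S" using finV by (auto simp: S_def intro: finite_subset[of _ "Pow V"])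
  have "subgroup {\<zero>} (add_monoid R)" by (rule subgroup.intro) (auto simp: a_inv_def[symmetric])
  then have "{\<zero>} \<in> S"
    using subgroup.one_closed[OF V(1)] subK by (auto simp: S_def intro!: exI[of _ 0])
  then obtain W where W: "W \<in> S" and max: "\<And>W'. W' \<in> S \<Longrightarrow> card W' \<le> card W"
  proof -
    have "Max (card ` S) \<in> card ` S" using finS \<open>{\<zero>} \<in> S\<close> by (intro Max_in) auto
    then obtain W where "W \<in> S" "card W = Max (card ` S)" by auto
    then show ?thesis using that[of W] finS by simp
  qed
  have WV: "W \<subseteq> V" and sgW: "subgroup W (add_monoid R)" and smW: "\<And>a v. a \<in> K \<Longrightarrow> v \<in> W \<Longrightarrow> a \<otimes> v \<in> W"
    using W by (auto simp: S_def)
  obtain k where k: "card W = card K ^ k" using W by (auto simp: S_def)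
  have W0: "\<zero> \<in> W" and Wadd: "\<And>x y. x \<in> W \<Longrightarrow> y \<in> W \<Longrightarrow> x \<oplus> y \<in> W" and Wneg: "\<And>x. x \<in> W \<Longrightarrow> \<ominus> x \<in> W"
    using subgroup.one_closed[OF sgW] subgroup.m_closed[OF sgW] subgroup.m_inv_closed[OF sgW] by (auto simp: a_inv_def)
  have Vadd: "\<And>x y. x \<in> V \<Longrightarrow> y \<in> V \<Longrightarrow> x \<oplus> y \<in> V"
    using subgroup.m_closed[OF V(1)] by simp
  have "W = V"
  proof (rule ccontr)
    assume "W \<noteq> V"
    then obtain v where v: "v \<in> V" "v \<notin> W" using WV by blast
    let ?f = "\<lambda>(a, w). a \<otimes> v \<oplus> w"
    let ?W = "?f ` (K \<times> W)"
    have vc: "v \<in> carrier R" using v subV by blast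
    have subW: "W \<subseteq> carrier R" using WV subV by blast
    \<comment> \<open>Equal images put \<open>(a \<ominus> a') \<otimes> v\<close> into
      \<open>W\<close>; if \<open>a\<close> and \<open>a'\<close> differed, dividing within
      \<open>K\<close> would put \<open>v\<close> itself into \<open>W\<close>.\<close>
    have inj: "inj_on ?f (K \<times> W)"
    proof (rule inj_onI, clarify)
      fix a w a' w' assume in': "a \<in> K" "w \<in> W" "a' \<in> K" "w' \<in> W" and eq: "a \<otimes> v \<oplus> w = a' \<otimes> v \<oplus> w'"
      have c: "a \<in> carrier R" "a' \<in> carrier R" "w \<in> carrier R" "w' \<in> carrier R"
        using in' subK subW by auto
      have "(a \<ominus> a') \<otimes> v = w' \<ominus> w"
      proof -
        have "(a \<ominus> a') \<otimes> v = (a \<otimes> v \<oplus> w) \<ominus> w \<ominus> a' \<otimes> v"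
          using c vc by (simp add: minus_eq l_distr l_minus a_assoc r_neg)
        also have "\<dots> = (a' \<otimes> v \<oplus> w') \<ominus> w \<ominus> a' \<otimes> v" by (simp only: eq)
        also have "\<dots> = w' \<ominus> w"
          using c vc by (simp add: minus_eq a_ac r_neg r_neg1 r_neg2)
        finally show ?thesis .
      qed
      then have inW: "(a \<ominus> a') \<otimes> v \<in> W" using in' Wadd Wneg by (simp add: minus_eq)
      have "a = a'"
      proof (rule ccontr)
        assume "a \<noteq> a'"
        then have "a \<ominus> a' \<noteq> \<zero>" using c by (simp add: r_right_minus_eq)
        moreover have "a \<ominus> a' \<in> K" using in' subringE(5,7)[OF K] by (simp add: minus_eq)
        ultimately obtain b where b: "b \<in> K" "b \<otimes> (a \<ominus> a') = \<one>"
          using finite_subring_inverse[OF finK K units] by metis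
        then have "b \<otimes> ((a \<ominus> a') \<otimes> v) = v"
          using c vc subK by (subst m_assoc[symmetric]) auto
        then show False using smW[OF b(1) inW] v by simp
      qed
      moreover have "w = w'" using eq c vc add.l_cancel[of "a \<otimes> v" w w'] unfolding \<open>a = a'\<close> by simp
      ultimately show "a = a' \<and> w = w'" by blast
    qed
    have "?W \<in> S"
    proof -
      have "?W \<subseteq> V" using V v WV Vadd by auto
      moreover have "subgroup ?W (add_monoid R)"
      proof (rule add.subgroupI)
        show "?W \<subseteq> carrier R" using \<open>?W \<subseteq> V\<close> subV by blast
        show "?W \<noteq> {}" using W0 subringE(3)[OF K] by blast
        fix x assume "x \<in> ?W"
        then obtain a w where x: "a \<in> K" "w \<in> W" "x = a \<otimes> v \<oplus> w" by auto
        then have "\<ominus> x = (\<ominus> a) \<otimes> v \<oplus> (\<ominus> w)"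
          using vc subK subW by (simp add: subset_iff l_minus minus_add)
        then show "\<ominus> x \<in> ?W" using x Wneg subringE(5)[OF K] by (auto intro!: rev_image_eqI[of "(\<ominus> a, \<ominus> w)"])
        fix y assume "y \<in> ?W"
        then obtain a' w' where y: "a' \<in> K" "w' \<in> W" "y = a' \<otimes> v \<oplus> w'" by auto
        have c: "a \<in> carrier R" "a' \<in> carrier R" "w \<in> carrier R" "w' \<in> carrier R"
          using x y subK subW by auto
        then have "x \<oplus> y = (a \<oplus> a') \<otimes> v \<oplus> (w \<oplus> w')"
          using x y vc by (simp add: l_distr a_ac)
        then show "x \<oplus> y \<in> ?W" using x y Wadd subringE(7)[OF K] by (auto intro!: rev_image_eqI[of "(a \<oplus> a', w \<oplus> w')"])
      qed
      moreover have "\<forall>b\<in>K. \<forall>x\<in>?W. b \<otimes> x \<in> ?W"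
      proof (intro ballI)
        fix b x assume b: "b \<in> K" and "x \<in> ?W"
        then obtain a w where x: "a \<in> K" "w \<in> W" "x = a \<otimes> v \<oplus> w" by auto
        have "b \<otimes> x = (b \<otimes> a) \<otimes> v \<oplus> b \<otimes> w"
          using x b vc subK subW by (simp add: subset_iff r_distr m_assoc)
        then show "b \<otimes> x \<in> ?W" using x b smW subringE(6)[OF K] by (auto intro!: rev_image_eqI[of "(b \<otimes> a, b \<otimes> w)"])
      qed
      moreover have "card ?W = card K ^ Suc k"
        using inj k by (simp add: card_image card_cartesian_product)
      ultimately show ?thesis unfolding S_def by blast
    qed
    then have "card K * card W \<le> card W"
      using max[of ?W] inj by (simp add: card_image card_cartesian_product)
    moreover have "0 < card W" using k cardK by simp
    ultimately show False using cardK by (metis leD mult_le_cancel2 mult_1 not_less_eq_eq numeral_2_eq_2 One_nat_def)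
  qed
  then show thesis using k that by blast
qed

section \<open>Centralizers, conjugacy classes and the class equation\<close>

definition centralizer :: "'a \<Rightarrow> 'a set" where
  "centralizer a = {x \<in> carrier R. x \<otimes> a = a \<otimes> x}"

lemma centralizer_subring:
  assumes "a \<in> carrier R" shows "subring (centralizer a) R"
proof (rule subringI)
  show "centralizer a \<subseteq> carrier R" by (auto simp: centralizer_def)
  show "\<one> \<in> centralizer a" using assms by (simp add: centralizer_def)
  fix x assume x: "x \<in> centralizer a"
  then show "\<ominus> x \<in> centralizer a" using assms by (simp add: centralizer_def l_minus r_minus)
  fix y assume y: "y \<in> centralizer a"
  have c: "x \<in> carrier R" "y \<in> carrier R" using x y by (auto simp: centralizer_def)
  have "x \<otimes> y \<otimes> a = a \<otimes> (x \<otimes> y)"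
  proof -
    have "x \<otimes> y \<otimes> a = x \<otimes> (a \<otimes> y)" using y assms c by (simp add: centralizer_def m_assoc)
    also have "\<dots> = a \<otimes> x \<otimes> y" using x assms c by (simp add: centralizer_def m_assoc[symmetric])
    finally show ?thesis using assms c by (simp add: m_assoc)
  qed
  then show "x \<otimes> y \<in> centralizer a" using c by (simp add: centralizer_def)
  show "x \<oplus> y \<in> centralizer a" using x y assms by (simp add: centralizer_def l_distr r_distr)
qed

lemma subring_Inter_carrier:
  assumes "\<And>a. a \<in> carrier R \<Longrightarrow> subring (f a) R"
  shows "subring (\<Inter>a\<in>carrier R. f a) R"
proof (rule subringI)
  show "(\<Inter>a\<in>carrier R. f a) \<subseteq> carrier R"
    using subringE(1)[OF assms] by blast
qed (use subringE(3,5,6,7)[OF assms] in auto)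

definition conj_class :: "'a \<Rightarrow> 'a set" where
  "conj_class a = (\<lambda>x. x \<otimes> a \<otimes> inv x) ` (carrier R - {\<zero>})"

text \<open>Witt's proof by the class equation. With a centre \<open>Z\<close> of size
  \<open>q\<close> and a ring of size \<open>q ^ n\<close>, a noncentral class has
  \<open>(q ^ n - 1) / (q ^ m - 1)\<close> elements for a proper divisor \<open>m\<close> of
  \<open>n\<close>, so the integer \<open>N\<close> of \<open>cyclotomic_divisor\<close> divides it.
  Then \<open>N\<close> divides \<open>q - 1\<close>, although it is larger.\<close>

lemma finite_division_ring_commute:
  assumes fin: "finite (carrier R)" and one: "\<one> \<noteq> \<zero>"
    and units: "\<And>x. x \<in> carrier R \<Longrightarrow> x \<noteq> \<zero> \<Longrightarrow> x \<in> Units R"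
    and xy: "x \<in> carrier R" "y \<in> carrier R"
  shows "x \<otimes> y = y \<otimes> x"
proof (rule ccontr)
  assume noncomm: "x \<otimes> y \<noteq> y \<otimes> x"
  define Z where "Z = (\<Inter>a\<in>carrier R. centralizer a)"
  let ?G = "carrier R - {\<zero>}"
  let ?C = centralizer
  have subZ: "subring Z R" unfolding Z_def by (rule subring_Inter_carrier) (rule centralizer_subring)
  have Zc: "Z \<subseteq> carrier R" by (rule subringE(1)[OF subZ])
  have unitsS: "x \<in> Units R" if "subring K R" "x \<in> K" "x \<noteq> \<zero>" for x K
    using that subringE(1)[OF that(1)] units by blast
  have GU: "z \<in> ?G \<longleftrightarrow> z \<in> Units R" for z
    using units Units_closed one by (metis Diff_iff Units_l_inv r_null Units_inv_closed singletonD singletonI)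
  have sub2: "2 \<le> card K" if "subring K R" for K
  proof -
    have "{\<zero>, \<one>} \<subseteq> K" using subringE(2,3)[OF that] by blast
    then have "card {\<zero>, \<one>} \<le> card K" using finite_subset[OF subringE(1)[OF that] fin] card_mono by blast
    then show ?thesis using one by simp
  qed
  define q where "q = card Z"
  have q2: "2 \<le> q" using sub2[OF subZ] by (simp add: q_def)
  obtain n where n: "card (carrier R) = q ^ n"
    using card_subring_space[OF fin subZ one unitsS[OF subZ] add.subgroup_self] Zc q_def by blast
  \<comment> \<open>Counting \<open>centralizer a\<close> over \<open>Z\<close> gives
    \<open>q ^ m\<close>, and counting the ring over \<open>centralizer a\<close> gives
    \<open>q ^ n = (q ^ m) ^ l\<close>; hence \<open>m\<close> divides \<open>n\<close>.\<close>
  have dim: "\<exists>m. card (?C a) = q ^ m \<and> m dvd n \<and> 0 < m \<and> m < n" if a: "a \<in> carrier R" "a \<notin> Z" for a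
  proof -
    note C = centralizer_subring[OF a(1)]
    have sg: "subgroup (?C a) (add_monoid R)" using subring.axioms(1)[OF C] .
    have "z \<otimes> v \<in> ?C a" if "z \<in> Z" "v \<in> ?C a" for z v
      using that subringE(6)[OF C] a unfolding Z_def by blast
    then obtain m where m: "card (?C a) = q ^ m"
      using card_subring_space[OF fin subZ one unitsS[OF subZ] sg] q_def by blast
    obtain l where l: "card (carrier R) = card (?C a) ^ l"
      using card_subring_space[OF fin C one unitsS[OF C] add.subgroup_self] subringE(1)[OF C] by blast
    have "q ^ n = q ^ (m * l)" using n l m by (simp add: power_mult)
    then have nm: "n = m * l" using q2 by (simp add: power_inject_exp)
    moreover have "m \<noteq> 0" using sub2[OF C] m by (cases m) auto
    moreover have "m \<noteq> n"
    proof
      assume "m = n"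
      then have "?C a = carrier R"
        using m n subringE(1)[OF C] fin by (metis card_subset_eq)
      then have "b \<otimes> a = a \<otimes> b" if "b \<in> carrier R" for b
        using that unfolding centralizer_def by blast
      then have "a \<in> Z" using a by (auto simp: Z_def centralizer_def)
      then show False using a by simp
    qed
    moreover have "l \<noteq> 0" using n nm sub2[OF carrier_is_subring] by (cases l) auto
    ultimately show ?thesis using m by (intro exI[of _ m]) auto
  qed
  have x: "x \<notin> Z" using noncomm xy by (auto simp: Z_def centralizer_def)
  then have n2: "2 \<le> n" using dim[OF xy(1)] by auto
  obtain N where N: "int q - 1 < N" "N dvd int q ^ n - 1"
    "\<And>m. 0 < m \<Longrightarrow> m < n \<Longrightarrow> m dvd n \<Longrightarrow> N * (int q ^ m - 1) dvd int q ^ n - 1"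
    using cyclotomic_divisor[OF q2 n2] by blast
  obtain N' where N': "N = int N'" using N(1) q2 nonneg_int_cases[of N] by auto
  have conj_eq: "z \<otimes> a \<otimes> inv z = w \<longleftrightarrow> z \<otimes> a = w \<otimes> z"
    if "z \<in> Units R" "a \<in> carrier R" "w \<in> carrier R" for a z w
  proof
    have zc: "z \<in> carrier R" using that by blast
    assume "z \<otimes> a \<otimes> inv z = w"
    then have "w \<otimes> z = z \<otimes> a \<otimes> (inv z \<otimes> z)" using that zc by (auto simp: m_assoc)
    then show "z \<otimes> a = w \<otimes> z" using that zc by simp
  next
    have zc: "z \<in> carrier R" using that by blast
    assume "z \<otimes> a = w \<otimes> z"
    then have "z \<otimes> a \<otimes> inv z = w \<otimes> (z \<otimes> inv z)" using that zc by (simp add: m_assoc)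
    then show "z \<otimes> a \<otimes> inv z = w" using that by simp
  qed
  have class_iff: "w \<in> conj_class a \<longleftrightarrow> w \<in> carrier R \<and> (\<exists>z\<in>Units R. z \<otimes> a = w \<otimes> z)" if "a \<in> carrier R" for a w
    using that conj_eq GU unfolding conj_class_def image_iff by (metis m_closed Units_closed Units_inv_closed)
  have card_class: "card ?G = card (?C a - {\<zero>}) * card (conj_class a)" if a: "a \<in> carrier R" for a
  proof -
    \<comment> \<open>Orbit-stabilizer count: the elements conjugating \<open>a\<close> to
      \<open>w\<close> form the coset of the centralizer through any one of them.\<close>
    have fiber: "card {z \<in> ?G. z \<otimes> a \<otimes> inv z = w} = card (?C a - {\<zero>})" if w: "w \<in> conj_class a" for w
    proof -
      obtain z where z: "z \<in> Units R" "z \<otimes> a = w \<otimes> z" and wc: "w \<in> carrier R"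
        using w class_iff[OF a] by blast
      have zc: "z \<in> carrier R" "inv z \<in> carrier R" using z by auto
      have ziw: "inv z \<otimes> w = a \<otimes> inv z"
      proof -
        have "a \<otimes> inv z = inv z \<otimes> (z \<otimes> a) \<otimes> inv z" using z(1) zc a by (simp add: m_assoc[symmetric])
        also have "\<dots> = inv z \<otimes> w \<otimes> (z \<otimes> inv z)" using z zc wc by (simp only: m_assoc m_closed z(2))
        finally show ?thesis using z zc wc by simp
      qed
      have "bij_betw (\<lambda>c. z \<otimes> c) (?C a - {\<zero>}) {u \<in> ?G. u \<otimes> a \<otimes> inv u = w}"
      proof (rule bij_betw_byWitness[where f' = "\<lambda>u. inv z \<otimes> u"])
        show "\<forall>c\<in>?C a - {\<zero>}. inv z \<otimes> (z \<otimes> c) = c"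
          using z zc by (auto simp: centralizer_def m_assoc[symmetric])
        show "\<forall>u\<in>{u \<in> ?G. u \<otimes> a \<otimes> inv u = w}. z \<otimes> (inv z \<otimes> u) = u"
          using z zc by (auto simp: m_assoc[symmetric])
        show "(\<lambda>c. z \<otimes> c) ` (?C a - {\<zero>}) \<subseteq> {u \<in> ?G. u \<otimes> a \<otimes> inv u = w}"
        proof (rule image_subsetI)
          fix c assume c: "c \<in> ?C a - {\<zero>}"
          then have cc: "c \<in> carrier R" "c \<otimes> a = a \<otimes> c" "c \<in> Units R"
            using GU by (auto simp: centralizer_def)
          have zcU: "z \<otimes> c \<in> Units R" using z cc by simp
          have "(z \<otimes> c) \<otimes> a = (z \<otimes> a) \<otimes> c"
            using cc zc a by (simp add: m_assoc)
          then have "(z \<otimes> c) \<otimes> a = w \<otimes> (z \<otimes> c)"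
            using z cc zc wc by (simp add: m_assoc)
          then show "z \<otimes> c \<in> {u \<in> ?G. u \<otimes> a \<otimes> inv u = w}"
            using zcU GU conj_eq[OF zcU a wc] by blast
        qed
        show "(\<lambda>u. inv z \<otimes> u) ` {u \<in> ?G. u \<otimes> a \<otimes> inv u = w} \<subseteq> ?C a - {\<zero>}"
        proof (rule image_subsetI)
          fix u assume "u \<in> {u \<in> ?G. u \<otimes> a \<otimes> inv u = w}"
          then have u: "u \<in> Units R" "u \<in> carrier R" "u \<otimes> a = w \<otimes> u"
            using GU conj_eq[OF _ a wc] by auto
          have "inv z \<otimes> u \<otimes> a = inv z \<otimes> w \<otimes> u" using u zc wc a by (simp add: m_assoc)
          also have "\<dots> = a \<otimes> (inv z \<otimes> u)" using ziw zc u a by (simp add: m_assoc)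
          finally have "inv z \<otimes> u \<in> ?C a" using zc u by (simp add: centralizer_def)
          moreover have "inv z \<otimes> u \<in> Units R" using z u by simp
          ultimately show "inv z \<otimes> u \<in> ?C a - {\<zero>}" using GU by blast
        qed
      qed
      from bij_betw_same_card[OF this] show ?thesis by simp
    qed
    have "card ?G = (\<Sum>w\<in>conj_class a. card {z \<in> ?G. z \<otimes> a \<otimes> inv z = w})"
      using sum.image_gen[of ?G "\<lambda>_. 1::nat" "\<lambda>z. z \<otimes> a \<otimes> inv z"] fin by (simp add: conj_class_def)
    also have "\<dots> = card (?C a - {\<zero>}) * card (conj_class a)" using fiber by simp
    finally show ?thesis .
  qed
  have cardG: "int (card ?G) = int q ^ n - 1"
    using n fin q2 by (simp add: of_nat_diff)
  have N_dvd_class: "N' dvd card (conj_class a)" if a: "a \<in> carrier R - Z" for a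
  proof -
    obtain m where m: "card (?C a) = q ^ m" "m dvd n" "0 < m" "m < n" using dim a by blast
    have finC: "finite (?C a)" using fin by (auto simp: centralizer_def)
    have "\<zero> \<in> ?C a" using a by (auto simp: centralizer_def)
    then have "int (card (?C a - {\<zero>})) = int q ^ m - 1"
      using m finC q2 by (simp add: of_nat_diff)
    then have "int q ^ n - 1 = (int q ^ m - 1) * int (card (conj_class a))"
      using card_class[of a] a cardG by (metis of_nat_mult DiffD1)
    then have "(int q ^ m - 1) * N dvd (int q ^ m - 1) * int (card (conj_class a))"
      using N(3)[OF m(3,4,2)] by (simp add: mult.commute)
    moreover have "1 < int q ^ m" using q2 m(3) by (intro one_less_power) simp_all
    then have "int q ^ m - 1 \<noteq> 0" by linarith
    ultimately have "N dvd int (card (conj_class a))" by simp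
    then show ?thesis by (simp add: N')
  qed
  have class_sub: "conj_class a \<subseteq> carrier R - Z" if a: "a \<in> carrier R - Z" for a
  proof
    fix w assume "w \<in> conj_class a"
    then obtain z where z: "z \<in> Units R" "z \<otimes> a = w \<otimes> z" "w \<in> carrier R" using class_iff a by blast
    have "a \<in> Z" if "w \<in> Z"
    proof -
      have "w \<otimes> z = z \<otimes> w" using that z unfolding Z_def centralizer_def by blast
      then have "z \<otimes> a = z \<otimes> w" using z by simp
      then have "a = w" using z a by simp
      then show ?thesis using that by simp
    qed
    then show "w \<in> carrier R - Z" using a z by blast
  qed
  have self_class: "a \<in> conj_class a" if "a \<in> carrier R" for a
    using class_iff[OF that] that by (auto intro!: bexI[of _ \<one>])
  \<comment> \<open>Transitivity of conjugacy, followed by symmetry; together they make classes with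
    a common element equal.\<close>
  have class_sym: "conj_class w \<subseteq> conj_class a" if aw: "a \<in> carrier R" "w \<in> conj_class a" for a w
  proof
    fix u assume u: "u \<in> conj_class w"
    obtain z where z: "z \<in> Units R" "z \<otimes> a = w \<otimes> z" "w \<in> carrier R" using class_iff aw by blast
    obtain z' where z': "z' \<in> Units R" "z' \<otimes> w = u \<otimes> z'" "u \<in> carrier R" using class_iff z u by blast
    have "(z' \<otimes> z) \<otimes> a = (z' \<otimes> w) \<otimes> z" using z z'(1,3) aw by (simp add: m_assoc Units_closed)
    also have "\<dots> = u \<otimes> (z' \<otimes> z)" using z(1,3) z' by (simp add: m_assoc[symmetric] Units_closed)
    finally have "(z' \<otimes> z) \<otimes> a = u \<otimes> (z' \<otimes> z)" .
    then show "u \<in> conj_class a" using class_iff aw z z' by blast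
  qed
  have class_sym': "a \<in> conj_class w" if aw: "a \<in> carrier R" "w \<in> conj_class a" for a w
  proof -
    obtain z where z: "z \<in> Units R" "z \<otimes> a = w \<otimes> z" "w \<in> carrier R" using class_iff aw by blast
    have "a \<otimes> inv z = inv z \<otimes> (z \<otimes> a) \<otimes> inv z" using z(1) aw by (simp add: m_assoc[symmetric] Units_closed)
    also have "\<dots> = inv z \<otimes> (w \<otimes> z) \<otimes> inv z" by (simp only: z(2))
    also have "\<dots> = inv z \<otimes> (w \<otimes> (z \<otimes> inv z))"
      using z(1,3) Units_closed[OF z(1)] Units_inv_closed[OF z(1)] by (simp only: m_assoc m_closed)
    finally have "inv z \<otimes> w = a \<otimes> inv z" using z by simp
    then show ?thesis using class_iff[OF z(3)] aw z by blast
  qed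
  have "N' dvd card (\<Union> (conj_class ` (carrier R - Z)))"
  proof (rule dvd_partition)
    show "finite (\<Union> (conj_class ` (carrier R - Z)))"
      using class_sub fin by (meson UN_least finite_Diff finite_subset)
    show "\<forall>c\<in>conj_class ` (carrier R - Z). N' dvd card c" using N_dvd_class by blast
    show "\<forall>c1\<in>conj_class ` (carrier R - Z). \<forall>c2\<in>conj_class ` (carrier R - Z). c1 \<noteq> c2 \<longrightarrow> c1 \<inter> c2 = {}"
    proof (intro ballI impI, rule ccontr)
      fix c1 c2 assume "c1 \<in> conj_class ` (carrier R - Z)" "c2 \<in> conj_class ` (carrier R - Z)"
        and neq: "c1 \<noteq> c2" "c1 \<inter> c2 \<noteq> {}"
      then obtain a b w where ab: "a \<in> carrier R" "c1 = conj_class a" "b \<in> carrier R" "c2 = conj_class b"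
        "w \<in> conj_class a" "w \<in> conj_class b" by blast
      then have "w \<in> carrier R" using class_iff by blast
      then have "conj_class a = conj_class w" "conj_class b = conj_class w"
        using ab class_sym class_sym' by (metis subset_antisym)+
      then show False using ab neq by blast
    qed
  qed
  moreover have "\<Union> (conj_class ` (carrier R - Z)) = carrier R - Z"
    using class_sub self_class by blast
  \<comment> \<open>Only the classes off the centre are counted, and the centre contains zero, so
    the total is \<open>q ^ n - q\<close>. Subtracting it from \<open>q ^ n - 1\<close> leaves
    \<open>q - 1\<close>.\<close>
  ultimately have "N' dvd q ^ n - q"
    using n fin Zc by (simp add: card_Diff_subset finite_subset q_def)
  moreover have "q \<le> q ^ n" using q2 n2 by (simp add: self_le_power)
  ultimately have "N dvd int q ^ n - int q"
    unfolding N' by (metis int_dvd_int_iff of_nat_diff of_nat_power)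
  then have "N dvd (int q ^ n - 1) - (int q ^ n - int q)" using N(2) by (rule dvd_diff[rotated])
  then have "N dvd int q - 1" by simp
  then show False using N(1) q2 zdvd_imp_le[of N "int q - 1"] by simp
qed

lemma finite_division_ring_field:
  assumes "finite (carrier R)" "\<one> \<noteq> \<zero>"
    and "\<And>x. x \<in> carrier R \<Longrightarrow> x \<noteq> \<zero> \<Longrightarrow> x \<in> Units R"
  shows "field R"
proof -
  interpret cring R
    by unfold_locales (use finite_division_ring_commute[OF assms] in auto)
  show ?thesis
  proof (rule cring_fieldI)
    have "\<zero> \<notin> Units R"
    proof
      assume "\<zero> \<in> Units R"
      then have "\<zero> \<otimes> inv \<zero> = \<one>" "inv \<zero> \<in> carrier R" by simp_all
      then show False using assms(2) by simp
    qed
    then show "Units R = carrier R - {\<zero>}" using assms(3) Units_closed by blast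
  qed
qed

end

section \<open>Structure of finite chain rings\<close>

text \<open>Right multiplication by \<open>y\<close> is undone by \<open>x\<close>, so it is
  injective, and by finiteness some \<open>z\<close> satisfies
  \<open>z \<otimes> y = \<one>\<close>; associativity gives \<open>z = x\<close>.\<close>

lemma (in ring) finite_left_inverse_units:
  assumes fin: "finite (carrier R)" and x: "x \<in> carrier R" and y: "y \<in> carrier R" and yx: "y \<otimes> x = \<one>"
  shows "x \<in> Units R" "y \<in> Units R"
proof -
  have "inj_on (\<lambda>z. z \<otimes> y) (carrier R)"
  proof (rule inj_onI)
    fix z w assume zw: "z \<in> carrier R" "w \<in> carrier R" "z \<otimes> y = w \<otimes> y"
    have "z \<otimes> y \<otimes> x = w \<otimes> y \<otimes> x" by (simp only: zw(3))
    then show "z = w" using zw(1,2) x y by (simp add: m_assoc yx)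
  qed
  then have "(\<lambda>z. z \<otimes> y) ` carrier R = carrier R"
    using fin y by (intro endo_inj_surj) auto
  then obtain z where z: "z \<in> carrier R" "z \<otimes> y = \<one>" using one_closed by (metis imageE)
  have "z = z \<otimes> y \<otimes> x" using z(1) x y by (simp add: m_assoc yx)
  then have "z = x" using x z(2) by simp
  then have "x \<otimes> y = \<one>" using z by simp
  then show "x \<in> Units R" "y \<in> Units R" using x y yx by (auto simp: Units_def)
qed

lemma (in ring) PIdl_left_ideal: 
  assumes x: "x \<in> carrier R" shows "left_ideal R (PIdl x)"
  unfolding left_ideal_def
proof (intro conjI ballI)
  show "additive_subgroup (PIdl x) R"
  proof (intro additive_subgroup.intro add.subgroupI)
    show "PIdl x \<subseteq> carrier R" "PIdl x \<noteq> {}" using x by (auto simp: cgenideal_def)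
    fix a assume "a \<in> PIdl x"
    then obtain r where r: "r \<in> carrier R" "a = r \<otimes> x" by (auto simp: cgenideal_def)
    then have "\<ominus> a = (\<ominus> r) \<otimes> x" using x by (simp add: l_minus)
    then show "\<ominus> a \<in> PIdl x" using r by (auto simp: cgenideal_def)
    fix b assume "b \<in> PIdl x"
    then obtain r' where r': "r' \<in> carrier R" "b = r' \<otimes> x" by (auto simp: cgenideal_def)
    then have "a \<oplus> b = (r \<oplus> r') \<otimes> x" using x r by (simp add: l_distr)
    then show "a \<oplus> b \<in> PIdl x" using r r' by (auto simp: cgenideal_def)
  qed
  fix r y assume r: "r \<in> carrier R" and "y \<in> PIdl x"
  then obtain a where a: "a \<in> carrier R" "y = a \<otimes> x" by (auto simp: cgenideal_def)
  then have "r \<otimes> y = (r \<otimes> a) \<otimes> x" using r x by (simp add: m_assoc)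
  then show "r \<otimes> y \<in> PIdl x" using r a by (auto simp: cgenideal_def)
qed

lemma (in ring) zero_notin_Units: "\<one> \<noteq> \<zero> \<Longrightarrow> \<zero> \<notin> Units R"
  by (metis Units_l_inv Units_inv_closed r_null)

text \<open>The chain condition gives closure under addition: if \<open>R a\<close> lies in
  \<open>R b\<close>, then \<open>a \<oplus> b\<close> is a left multiple of \<open>b\<close>, so a
  unit sum would make \<open>b\<close> a unit. Absorption on both sides holds because factors of
  units are units in a finite ring.\<close>

lemma (in finite_chain_ring) nonunits_ideal: "ideal (carrier R - Units R) R"
proof (rule idealI)
  note unit = finite_left_inverse_units[OF finite_carrier]
  have zU: "\<zero> \<notin> Units R" using one_noteq_zero by (rule zero_notin_Units)
  have left: "b \<in> Units R" if "a \<in> carrier R" "b \<in> carrier R" "a \<otimes> b \<in> Units R" for a b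
  proof -
    have "inv (a \<otimes> b) \<otimes> a \<otimes> b = \<one>" using that by (simp add: m_assoc)
    then show ?thesis using that by (intro unit(1)[of b "inv (a \<otimes> b) \<otimes> a"]) auto
  qed
  have right: "a \<in> Units R" if "a \<in> carrier R" "b \<in> carrier R" "a \<otimes> b \<in> Units R" for a b
  proof -
    have "a \<otimes> (b \<otimes> inv (a \<otimes> b)) = a \<otimes> b \<otimes> inv (a \<otimes> b)" using that by (simp only: m_assoc Units_inv_closed)
    then have "a \<otimes> (b \<otimes> inv (a \<otimes> b)) = \<one>" using that by simp
    then show ?thesis using that by (intro unit(2)[of "b \<otimes> inv (a \<otimes> b)" a]) auto
  qed
  show "ring R" by (rule ring_axioms)
  have sum: "b \<in> Units R"
    if ab: "a \<in> carrier R" "b \<in> carrier R" "PIdl a \<subseteq> PIdl b" "a \<oplus> b \<in> Units R" for a b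
  proof -
    have "a \<in> PIdl b" using ab cgenideal_self by blast
    then obtain c where c: "c \<in> carrier R" "a = c \<otimes> b" by (auto simp: cgenideal_def)
    then have "a \<oplus> b = (c \<oplus> \<one>) \<otimes> b" using ab by (simp add: l_distr)
    then show ?thesis using left[of "c \<oplus> \<one>" b] ab c by simp
  qed
  show "subgroup (carrier R - Units R) (add_monoid R)"
  proof (rule add.subgroupI)
    show "carrier R - Units R \<noteq> {}" using zU by blast
    fix a assume a: "a \<in> carrier R - Units R"
    have "a \<in> Units R" if "\<ominus> a \<in> Units R"
    proof -
      have "\<ominus> a = (\<ominus> \<one>) \<otimes> a" using a by (simp add: l_minus)
      then show ?thesis using left[of "\<ominus> \<one>" a] that a by simp
    qed
    then show "\<ominus> a \<in> carrier R - Units R" using a by auto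
    fix b assume b: "b \<in> carrier R - Units R"
    have "a \<oplus> b \<notin> Units R"
      using left_chain[OF PIdl_left_ideal PIdl_left_ideal, of a b] sum[of a b] sum[of b a] a b
      by (auto simp: a_comm)
    then show "a \<oplus> b \<in> carrier R - Units R" using a b by simp
  qed auto
  fix a x assume ax: "a \<in> carrier R - Units R" "x \<in> carrier R"
  show "x \<otimes> a \<in> carrier R - Units R" using left[of x a] ax by auto
  show "a \<otimes> x \<in> carrier R - Units R" using right[of a x] ax by auto
qed

section \<open>The maximal ideal, its generator and the socle\<close>

locale chain_ring_generator = finite_chain_ring R for R (structure) +
  fixes g
  assumes generator: "generates_maximal_ideal R g"
begin

abbreviation J where "J \<equiv> PIdl\<^bsub>R\<^esub> g"
abbreviation F where "F \<equiv> residue_field R g"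
abbreviation q where "q \<equiv> residue_size R g"
abbreviation s where "s \<equiv> nilpotency_index R g"
text \<open>A generator of the socle. In the field case \<open>s = 1\<close> it is
  \<open>\<one>\<close>, and the socle is the whole ring.\<close>

definition soc where "soc = g [^] (s - 1)"

lemma g_closed [simp, intro]: "g \<in> carrier R"
  using generator by (simp add: generates_maximal_ideal_def)

lemma J_maximal: "maximalideal J R"
  using generator unfolding generates_maximal_ideal_def by blast

lemma J_ideal: "ideal J R"
  using J_maximal by (rule maximalideal.axioms)

lemma J_subset: "J \<subseteq> carrier R"
  by (auto simp: cgenideal_def)

lemma J_left: "x \<in> J \<longleftrightarrow> (\<exists>r\<in>carrier R. x = r \<otimes> g)"
  by (auto simp: cgenideal_def)

text \<open>Together with \<open>J_left\<close> this says \<open>R g = g R\<close>, the substitute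
  for commuting with \<open>g\<close>.\<close>

lemma J_right: "x \<in> J \<longleftrightarrow> (\<exists>r\<in>carrier R. x = g \<otimes> r)"
  using generator by (auto simp: generates_maximal_ideal_def)

text \<open>The nonunits form a proper ideal containing \<open>J\<close>, and \<open>J\<close> is
  maximal.\<close>

lemma J_nonunits: "J = carrier R - Units R"
proof -
  have "J \<subseteq> carrier R - Units R"
  proof
    fix x assume x: "x \<in> J"
    have "x \<notin> Units R"
    proof
      assume U: "x \<in> Units R"
      have "r \<in> J" if "r \<in> carrier R" for r
      proof -
        have "r = (r \<otimes> inv x) \<otimes> x" using U that Units_closed[OF U] by (simp add: m_assoc)
        then show ?thesis using ideal.I_l_closed[OF J_ideal x, of "r \<otimes> inv x"] U that by simp
      qed
      then have "J = carrier R" using J_subset by blast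
      then show False using maximalideal.I_notcarr[OF J_maximal] by simp
    qed
    then show "x \<in> carrier R - Units R" using x J_subset by blast
  qed
  moreover have "carrier R - Units R \<noteq> carrier R" using Units_one_closed by blast
  ultimately show ?thesis
    using maximalideal.I_maximal[OF J_maximal nonunits_ideal] by blast
qed

text \<open>Finiteness gives \<open>g [^] i = g [^] j\<close> with \<open>i < j\<close>, that is,
  \<open>g [^] i \<otimes> (\<one> \<ominus> x) = \<zero>\<close> for some \<open>x\<close> in
  \<open>J\<close>. The second factor is a unit, since otherwise it and \<open>x\<close>, hence also
  \<open>\<one>\<close>, would lie in \<open>J\<close>.\<close>

lemma g_nilpotent: "\<exists>k>0. g [^] (k::nat) = \<zero>"
proof -
  have "\<not> inj (\<lambda>k::nat. g [^] k)"
    using finite_subset[OF _ finite_carrier, of "range (\<lambda>k::nat. g [^] k)"] finite_imageD[of "\<lambda>k::nat. g [^] k" UNIV]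
    by auto
  then obtain i j :: nat where ij: "i < j" "g [^] i = g [^] j"
    unfolding inj_def by (metis linorder_neqE_nat)
  define d where "d = j - i - 1"
  have "j = i + Suc d" using ij by (simp add: d_def)
  then have eq: "g [^] i = g [^] i \<otimes> (g [^] d \<otimes> g)" using ij by (simp add: nat_pow_mult[symmetric] m_assoc)
  let ?x = "g [^] d \<otimes> g"
  have x: "?x \<in> J" by (auto simp: J_left)
  have "\<one> \<ominus> ?x \<in> Units R"
  proof (rule ccontr)
    assume "\<one> \<ominus> ?x \<notin> Units R"
    then have "\<one> \<ominus> ?x \<in> J" by (simp add: J_nonunits)
    then have "(\<one> \<ominus> ?x) \<oplus> ?x \<in> J"
      using x by (intro additive_subgroup.a_closed[OF ideal.axioms(1)[OF J_ideal]])
    then have "\<one> \<in> J" by (simp add: minus_eq a_assoc l_neg)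
    then show False by (simp add: J_nonunits)
  qed
  then have U: "\<one> \<ominus> ?x \<in> Units R" .
  have "g [^] i \<otimes> (\<one> \<ominus> ?x) = \<zero>"
    using eq by (simp add: minus_eq r_distr r_minus r_neg)
  then have "g [^] i \<otimes> (\<one> \<ominus> ?x) \<otimes> inv (\<one> \<ominus> ?x) = \<zero>" using U by simp
  then have "g [^] i = \<zero>" using U Units_closed[OF U] by (simp add: m_assoc)
  moreover have "0 < i" using \<open>g [^] i = \<zero>\<close> one_noteq_zero by (cases i) auto
  ultimately show ?thesis by blast
qed

lemma s_pos: "0 < s" and g_pow_s: "g [^] s = \<zero>"
  using LeastI_ex[OF g_nilpotent] by (auto simp: nilpotency_index_def)

lemma g_pow_nonzero: "k < s \<Longrightarrow> g [^] k \<noteq> \<zero>"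
  using not_less_Least[of k "\<lambda>s. 0 < s \<and> g [^] s = \<zero>"] one_noteq_zero
  by (cases "k = 0") (auto simp: nilpotency_index_def)

lemma g_pow_zero_iff: "g [^] k = \<zero> \<longleftrightarrow> s \<le> k"
proof
  assume "s \<le> k"
  then have "g [^] k = g [^] s \<otimes> g [^] (k - s)" by (simp add: nat_pow_mult)
  then show "g [^] k = \<zero>" by (simp add: g_pow_s)
next
  assume "g [^] k = \<zero>"
  then show "s \<le> k" using g_pow_nonzero[of k] by (meson not_le)
qed

text \<open>Moving one factor \<open>g\<close> at a time past the coefficient replaces the
  coefficient by another one.\<close>

lemma g_pow_swap:
  assumes "r \<in> carrier R"
  shows "\<exists>r'\<in>carrier R. r \<otimes> g [^] (k::nat) = g [^] k \<otimes> r'" "\<exists>r'\<in>carrier R. g [^] (k::nat) \<otimes> r = r' \<otimes> g [^] k"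
proof -
  have "\<exists>r'\<in>carrier R. r \<otimes> g [^] k = g [^] k \<otimes> r'"
    using assms
  proof (induction k arbitrary: r)
    case (Suc k)
    then obtain r' where r': "r' \<in> carrier R" "r \<otimes> g [^] k = g [^] k \<otimes> r'" by blast
    obtain r'' where r'': "r'' \<in> carrier R" "r' \<otimes> g = g \<otimes> r''" using J_left J_right r' by blast
    have "r \<otimes> g [^] Suc k = (r \<otimes> g [^] k) \<otimes> g" using Suc.prems by (simp add: m_assoc)
    also have "\<dots> = g [^] k \<otimes> (r' \<otimes> g)" using r' by (simp add: m_assoc)
    also have "\<dots> = g [^] Suc k \<otimes> r''" using r'' by (simp add: m_assoc)
    finally show ?case using r'' by blast
  qed auto
  then show "\<exists>r'\<in>carrier R. r \<otimes> g [^] k = g [^] k \<otimes> r'" .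
  have "\<exists>r'\<in>carrier R. g [^] k \<otimes> r = r' \<otimes> g [^] k"
    using assms
  proof (induction k arbitrary: r)
    case (Suc k)
    obtain r' where r': "r' \<in> carrier R" "g \<otimes> r = r' \<otimes> g" using J_left J_right Suc.prems by blast
    obtain r'' where r'': "r'' \<in> carrier R" "g [^] k \<otimes> r' = r'' \<otimes> g [^] k" using Suc.IH r' by blast
    have "g [^] Suc k \<otimes> r = g [^] k \<otimes> (g \<otimes> r)" using Suc.prems by (simp add: m_assoc)
    also have "\<dots> = (g [^] k \<otimes> r') \<otimes> g" using r' by (simp add: m_assoc)
    also have "\<dots> = r'' \<otimes> g [^] Suc k" using r'' by (simp add: m_assoc)
    finally show ?case using r'' by blast
  qed auto
  then show "\<exists>r'\<in>carrier R. g [^] k \<otimes> r = r' \<otimes> g [^] k" .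
qed

lemma soc_closed [simp, intro]: "soc \<in> carrier R"
  by (simp add: soc_def)

lemma soc_swap:
  assumes "r \<in> carrier R"
  obtains r' where "r' \<in> carrier R" "r \<otimes> soc = soc \<otimes> r'"
  using g_pow_swap(1)[OF assms, of "s - 1"] by (fold soc_def) (elim bexE)

lemma g_soc: "g \<otimes> soc = \<zero>"
proof -
  have "g [^] Suc (s - 1) = g \<otimes> soc" unfolding soc_def by (rule nat_pow_Suc2) simp
  then show ?thesis using s_pos by (simp add: g_pow_s)
qed

lemma soc_nonzero: "soc \<noteq> \<zero>"
  unfolding soc_def using g_pow_nonzero[of "s - 1"] s_pos by simp

lemma socle_iff: "x \<in> socle R g \<longleftrightarrow> (\<exists>r\<in>carrier R. x = r \<otimes> soc)"
  by (auto simp: socle_def cgenideal_def soc_def)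

text \<open>\<open>soc\<close> is killed by \<open>g\<close> and, being nonzero, by no unit. So
  \<open>J\<close> is the kernel of \<open>r \<mapsto> r \<otimes> soc\<close>, which makes this map
  well defined and injective on cosets.\<close>

lemma mult_soc_zero_iff:
  assumes r: "r \<in> carrier R" shows "r \<otimes> soc = \<zero> \<longleftrightarrow> r \<in> J"
proof
  assume "r \<in> J"
  then obtain a where "a \<in> carrier R" "r = a \<otimes> g" by (auto simp: J_left)
  then show "r \<otimes> soc = \<zero>" using g_soc by (simp add: m_assoc)
next
  assume eq: "r \<otimes> soc = \<zero>"
  show "r \<in> J"
  proof (rule ccontr)
    assume "r \<notin> J"
    then have U: "r \<in> Units R" using r by (simp add: J_nonunits)
    have "inv r \<otimes> (r \<otimes> soc) = soc" using U r by (simp add: m_assoc[symmetric])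
    then show False using eq U soc_nonzero by simp
  qed
qed

lemma socle_subset: "socle R g \<subseteq> carrier R"
  by (auto simp: socle_iff)

text \<open>A nonzero \<open>x\<close> is \<open>g [^] k \<otimes> u\<close> with a unit
  \<open>u\<close>, and \<open>g \<otimes> x = \<zero>\<close> then forces \<open>k = s - 1\<close>.
  Annihilation by left multiplication is the form that suits left submodules.\<close>

lemma socle_annihilator: "x \<in> socle R g \<longleftrightarrow> x \<in> carrier R \<and> g \<otimes> x = \<zero>"
proof
  assume "x \<in> socle R g"
  then obtain r where r: "r \<in> carrier R" "x = r \<otimes> soc" unfolding socle_iff by blast
  obtain r' where r': "r' \<in> carrier R" "r \<otimes> soc = soc \<otimes> r'"
    using r(1) by (rule soc_swap)
  then have "x = soc \<otimes> r'" using r by simp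
  then have "g \<otimes> x = (g \<otimes> soc) \<otimes> r'" using r' by (simp only: m_assoc g_closed soc_closed)
  then show "x \<in> carrier R \<and> g \<otimes> x = \<zero>" using r r' by (simp add: g_soc)
next
  assume x: "x \<in> carrier R \<and> g \<otimes> x = \<zero>"
  show "x \<in> socle R g"
  proof (cases "x = \<zero>")
    case True
    then show ?thesis by (auto simp: socle_iff intro!: bexI[of _ \<zero>])
  next
    case False
    let ?P = "\<lambda>k. \<exists>u\<in>carrier R. x = g [^] (k::nat) \<otimes> u"
    \<comment> \<open>Divisibility of \<open>x\<close> by powers of \<open>g\<close> must stop,
      because \<open>g [^] s = \<zero>\<close> and \<open>x\<close> is nonzero.\<close>
    have "\<exists>k. ?P k \<and> \<not> ?P (Suc k)"
    proof (rule ccontr)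
      assume "\<not> (\<exists>k. ?P k \<and> \<not> ?P (Suc k))"
      moreover have "?P 0" using x by auto
      ultimately have "?P k" for k by (induction k) blast+
      then have "?P s" .
      then show False using False by (auto simp: g_pow_s)
    qed
    then obtain k where k: "?P k" "\<not> ?P (Suc k)" by blast
    then obtain u where u: "u \<in> carrier R" "x = g [^] k \<otimes> u" by blast
    have "u \<notin> J"
    proof
      assume "u \<in> J"
      then obtain w where "w \<in> carrier R" "u = g \<otimes> w" by (auto simp: J_right)
      then have "x = g [^] Suc k \<otimes> w" using u by (simp add: m_assoc)
      then show False using k(2) \<open>w \<in> carrier R\<close> by blast
    qed
    then have U: "u \<in> Units R" using u by (simp add: J_nonunits)
    have "g \<otimes> x = g [^] Suc k \<otimes> u"
      unfolding nat_pow_Suc2[OF g_closed] using u by (simp only: m_assoc g_closed nat_pow_closed)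
    then have "g [^] Suc k \<otimes> u = \<zero>" using x by simp
    then have "g [^] Suc k \<otimes> u \<otimes> inv u = \<zero>" by (simp only: l_null Units_inv_closed[OF U])
    moreover have "g [^] Suc k \<otimes> u \<otimes> inv u = g [^] Suc k"
      using m_assoc[of "g [^] Suc k" u "inv u"] U u by simp
    ultimately have "g [^] Suc k = \<zero>" by simp
    then have "s \<le> Suc k" by (simp only: g_pow_zero_iff)
    moreover have "k < s" using False u g_pow_zero_iff[of k] by (cases "s \<le> k") auto
    ultimately have "k = s - 1" by simp
    then have "x = soc \<otimes> u" using u by (simp add: soc_def)
    \<comment> \<open>The socle consists of left multiples of \<open>soc\<close>, so the factor
      \<open>u\<close> has to be carried to the other side.\<close>
    then show ?thesis using g_pow_swap(2)[OF u(1), of "s - 1"] unfolding socle_iff soc_def by simp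
  qed
qed

lemma socle_zero: "\<zero> \<in> socle R g"
  and socle_add: "x \<in> socle R g \<Longrightarrow> y \<in> socle R g \<Longrightarrow> x \<oplus> y \<in> socle R g"
  and socle_neg: "x \<in> socle R g \<Longrightarrow> \<ominus> x \<in> socle R g"
  by (auto simp: socle_annihilator r_distr r_minus)

lemma socle_mult:
  assumes "r \<in> carrier R" "x \<in> socle R g"
  shows "r \<otimes> x \<in> socle R g"
proof -
  obtain a where a: "a \<in> carrier R" "x = a \<otimes> soc" using assms(2) unfolding socle_iff by blast
  then have "r \<otimes> x = (r \<otimes> a) \<otimes> soc" using assms(1) by (simp only: m_assoc soc_closed)
  then show ?thesis using a assms(1) unfolding socle_iff by blast
qed

section \<open>The residue field and its identification with the socle\<close>

lemma carrier_F: "carrier F = (\<lambda>r. J +> r) ` carrier R"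
  by (auto simp: residue_field_def FactRing_def A_RCOSETS_def')

lemma F_add: "r \<in> carrier R \<Longrightarrow> t \<in> carrier R \<Longrightarrow> (J +> r) \<oplus>\<^bsub>F\<^esub> (J +> t) = J +> (r \<oplus> t)"
  using ring_hom_add[OF ideal.rcos_ring_hom[OF J_ideal]] by (simp add: residue_field_def)

lemma F_mult: "r \<in> carrier R \<Longrightarrow> t \<in> carrier R \<Longrightarrow> (J +> r) \<otimes>\<^bsub>F\<^esub> (J +> t) = J +> (r \<otimes> t)"
  using ring_hom_mult[OF ideal.rcos_ring_hom[OF J_ideal]] by (simp add: residue_field_def)

lemma F_one: "\<one>\<^bsub>F\<^esub> = J +> \<one>"
  using ring_hom_one[OF ideal.rcos_ring_hom[OF J_ideal]] by (simp add: residue_field_def)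

lemma F_zero: "\<zero>\<^bsub>F\<^esub> = J"
  by (simp add: residue_field_def FactRing_def)

lemma F_ring: "ring F"
  unfolding residue_field_def by (rule ideal.quotient_is_ring[OF J_ideal])

text \<open>Elements of \<open>J\<close> kill \<open>soc\<close>, so all members of a coset have the
  same product with \<open>soc\<close> and \<open>the_elem\<close> is applied to a
  singleton.\<close>

lemma socle_iso_coset:
  assumes r: "r \<in> carrier R" shows "socle_iso R g (J +> r) = r \<otimes> soc"
proof -
  have "(j \<oplus> r) \<otimes> soc = r \<otimes> soc" if "j \<in> J" for j
    proof -
    have "j \<in> carrier R" "j \<otimes> soc = \<zero>" using that J_subset mult_soc_zero_iff[of j] by blast+
    then show ?thesis using r by (simp add: l_distr)
  qed
  moreover have "J \<noteq> {}" using cgenideal_self by blast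
  moreover have "(\<lambda>r. r \<otimes> soc) ` (J +> r) = (\<lambda>j. (j \<oplus> r) \<otimes> soc) ` J"
    unfolding a_r_coset_def' by blast
  ultimately have "(\<lambda>r. r \<otimes> soc) ` (J +> r) = {r \<otimes> soc}"
    by (simp add: image_constant_conv)
  then show ?thesis by (simp add: socle_iso_def soc_def)
qed

lemma socle_iso_add: 
  assumes "a \<in> carrier F" "b \<in> carrier F"
  shows "socle_iso R g (a \<oplus>\<^bsub>F\<^esub> b) = socle_iso R g a \<oplus> socle_iso R g b"
  using assms by (auto simp: carrier_F F_add socle_iso_coset l_distr)

lemma socle_iso_mult: 
  assumes "r \<in> carrier R" "b \<in> carrier F"
  shows "socle_iso R g ((J +> r) \<otimes>\<^bsub>F\<^esub> b) = r \<otimes> socle_iso R g b"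
  using assms by (auto simp: carrier_F F_mult socle_iso_coset m_assoc)

lemma coset_eq_iff:
  assumes "r \<in> carrier R" "t \<in> carrier R"
  shows "J +> r = J +> t \<longleftrightarrow> r \<otimes> soc = t \<otimes> soc"
proof
  assume "r \<otimes> soc = t \<otimes> soc"
  then have "(r \<ominus> t) \<otimes> soc = \<zero>" using assms by (simp add: minus_eq l_distr l_minus r_neg)
  then have "r \<ominus> t \<in> J" using assms mult_soc_zero_iff by simp
  then show "J +> r = J +> t"
    using assms quotient_eq_iff_same_a_r_cos[OF J_ideal] by simp
next
  assume "J +> r = J +> t"
  then show "r \<otimes> soc = t \<otimes> soc" using socle_iso_coset assms by metis
qed

lemma socle_iso_bij: "bij_betw (socle_iso R g) (carrier F) (socle R g)"
  unfolding bij_betw_def inj_on_def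
  by (auto simp: carrier_F socle_iso_coset coset_eq_iff socle_iff image_iff)

lemma finite_F: "finite (carrier F)"
  by (simp add: carrier_F finite_carrier)

lemma card_F: "card (carrier F) = q"
  by (simp add: residue_size_def)

lemma card_socle: "card (socle R g) = q"
  using bij_betw_same_card[OF socle_iso_bij] by (simp add: card_F)

lemma F_one_nonzero: "\<one>\<^bsub>F\<^esub> \<noteq> \<zero>\<^bsub>F\<^esub>"
proof
  assume "\<one>\<^bsub>F\<^esub> = \<zero>\<^bsub>F\<^esub>"
  then have "J = J +> \<one>" by (simp add: F_one F_zero)
  moreover have "\<one> \<in> J +> \<one>"
  proof -
    have "\<zero> \<in> J" using additive_subgroup.zero_closed[OF ideal.axioms(1)[OF J_ideal]] .
    then have "\<zero> \<oplus> \<one> \<in> J +> \<one>" unfolding a_r_coset_def' by blast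
    then show ?thesis by simp
  qed
  ultimately show False by (simp add: J_nonunits)
qed

text \<open>A coset other than \<open>J\<close> is represented by an element outside
  \<open>J\<close>, which is a unit of \<open>R\<close>, and the coset of its inverse inverts it.
  Commutativity then follows from finiteness.\<close>

lemma residue_field_field: "field F"
proof (rule ring.finite_division_ring_field[OF F_ring finite_F F_one_nonzero])
  fix x assume x: "x \<in> carrier F" "x \<noteq> \<zero>\<^bsub>F\<^esub>"
  then obtain r where r: "r \<in> carrier R" "x = J +> r" by (auto simp: carrier_F)
  have "r \<notin> J"
  proof
    assume "r \<in> J"
    then have "J +> r = J" using r by (simp add: a_coset_join2 additive_subgroup.a_subgroup ideal.axioms(1) J_ideal)
    then show False using r x by (simp add: F_zero)
  qed
  then have U: "r \<in> Units R" using r by (simp add: J_nonunits)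
  have "(J +> r) \<otimes>\<^bsub>F\<^esub> (J +> inv r) = \<one>\<^bsub>F\<^esub>" "(J +> inv r) \<otimes>\<^bsub>F\<^esub> (J +> r) = \<one>\<^bsub>F\<^esub>"
    using U r by (auto simp: F_mult F_one)
  moreover have "J +> inv r \<in> carrier F" using U by (auto simp: carrier_F)
  ultimately show "x \<in> Units F" using x r by (auto simp: Units_def)
qed

lemma q_ge_2: "2 \<le> q"
proof -
  have "{\<zero>\<^bsub>F\<^esub>, \<one>\<^bsub>F\<^esub>} \<subseteq> carrier F"
    using ring.ring_simprules(2,6)[OF F_ring] by blast
  then have "card {\<zero>\<^bsub>F\<^esub>, \<one>\<^bsub>F\<^esub>} \<le> card (carrier F)" using finite_F card_mono by blast
  then show ?thesis using F_one_nonzero by (simp add: card_F)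
qed

text \<open>One preimage of each socle element under \<open>r \<mapsto> r \<otimes> soc\<close>
  gives representatives of the cosets of \<open>J\<close>. They serve as digits when a code
  \<open>C\<close> is counted modulo \<open>g C\<close>.\<close>

lemma transversal:
  obtains T where "T \<subseteq> carrier R" "finite T" "card T = q"
    "\<And>r. r \<in> carrier R \<Longrightarrow> \<exists>t\<in>T. r \<ominus> t \<in> J"
    "\<And>t t'. t \<in> T \<Longrightarrow> t' \<in> T \<Longrightarrow> t \<ominus> t' \<in> J \<Longrightarrow> t = t'"
proof -
  have "socle R g \<subseteq> (\<lambda>r. r \<otimes> soc) ` carrier R" by (auto simp: socle_iff)
  then obtain T where T: "T \<subseteq> carrier R" "inj_on (\<lambda>r. r \<otimes> soc) T" "socle R g = (\<lambda>r. r \<otimes> soc) ` T"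
    by (meson subset_image_inj)
  have diff: "r \<ominus> t \<in> J \<longleftrightarrow> r \<otimes> soc = t \<otimes> soc" if "r \<in> carrier R" "t \<in> carrier R" for r t
    using coset_eq_iff[OF that] quotient_eq_iff_same_a_r_cos[OF J_ideal that] by simp
  show thesis
  proof (rule that[of T])
    show "T \<subseteq> carrier R" by (rule T)
    show "finite T" using T(1) finite_carrier by (rule finite_subset)
    show "card T = q" using card_socle T(2,3) by (simp add: card_image)
    fix r assume r: "r \<in> carrier R"
    then have "r \<otimes> soc \<in> (\<lambda>r. r \<otimes> soc) ` T" unfolding T(3)[symmetric] socle_iff by blast
    then obtain t where "t \<in> T" "r \<otimes> soc = t \<otimes> soc" by blast
    then show "\<exists>t\<in>T. r \<ominus> t \<in> J" using diff[OF r, of t] T(1) by blast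
  next
    fix t t' assume "t \<in> T" "t' \<in> T" "t \<ominus> t' \<in> J"
    then show "t = t'" using diff[of t t'] T(1,2) by (auto dest: inj_onD)
  qed
qed

end

section \<open>Generators and rank of linear codes\<close>

context ring begin

section \<open>Words, linear combinations and hulls\<close>

abbreviation words :: "nat \<Rightarrow> (nat \<Rightarrow> 'a) set" where
  "words n \<equiv> {..<n} \<rightarrow>\<^sub>E carrier R"

definition vzero :: "nat \<Rightarrow> nat \<Rightarrow> 'a" where "vzero n = (\<lambda>i\<in>{..<n}. \<zero>)"
definition vadd :: "nat \<Rightarrow> (nat \<Rightarrow> 'a) \<Rightarrow> (nat \<Rightarrow> 'a) \<Rightarrow> nat \<Rightarrow> 'a" where
  "vadd n x y = (\<lambda>i\<in>{..<n}. x i \<oplus> y i)"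
definition vsmul :: "nat \<Rightarrow> 'a \<Rightarrow> (nat \<Rightarrow> 'a) \<Rightarrow> nat \<Rightarrow> 'a" where
  "vsmul n r x = (\<lambda>i\<in>{..<n}. r \<otimes> x i)"
definition combo :: "nat \<Rightarrow> (nat \<Rightarrow> 'a) set \<Rightarrow> ((nat \<Rightarrow> 'a) \<Rightarrow> 'a) \<Rightarrow> nat \<Rightarrow> 'a" where
  "combo n S r = (\<lambda>i\<in>{..<n}. \<Oplus>s\<in>S. r s \<otimes> s i)"

lemma v_apply [simp]:
  assumes "i < n"
  shows "vzero n i = \<zero>" "vadd n x y i = x i \<oplus> y i" "vsmul n r x i = r \<otimes> x i"
    "combo n S f i = (\<Oplus>s\<in>S. f s \<otimes> s i)"
  using assms by (auto simp: vzero_def vadd_def vsmul_def combo_def)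

lemma words_coord: "x \<in> words n \<Longrightarrow> i < n \<Longrightarrow> x i \<in> carrier R"
  by auto

lemma words_eqI: "x \<in> words n \<Longrightarrow> y \<in> words n \<Longrightarrow> (\<And>i. i < n \<Longrightarrow> x i = y i) \<Longrightarrow> x = y"
  by (rule PiE_ext) auto

lemma words_eq_zeroI: "x \<in> words n \<Longrightarrow> (\<And>i. i < n \<Longrightarrow> x i = \<zero>) \<Longrightarrow> x = vzero n"
  by (rule words_eqI) (auto simp: vzero_def)

lemma vzero_closed: "vzero n \<in> words n"
  by (auto simp: vzero_def)

lemma vadd_closed: "x \<in> words n \<Longrightarrow> y \<in> words n \<Longrightarrow> vadd n x y \<in> words n"
  by (auto simp: vadd_def)

lemma vsmul_closed: "r \<in> carrier R \<Longrightarrow> x \<in> words n \<Longrightarrow> vsmul n r x \<in> words n"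
  by (auto simp: vsmul_def)

lemma finite_words: "finite (carrier R) \<Longrightarrow> finite (words n)"
  by (simp add: finite_PiE)

lemma linear_code_iff:
  "linear_code R n C \<longleftrightarrow> C \<subseteq> words n \<and> vzero n \<in> C \<and> (\<forall>x\<in>C. \<forall>y\<in>C. vadd n x y \<in> C) \<and>
    (\<forall>r\<in>carrier R. \<forall>x\<in>C. vsmul n r x \<in> C)"
  by (simp add: linear_code_def vzero_def vadd_def vsmul_def)

lemma zero_code_eq: "zero_code R n = {vzero n}"
  by (simp add: zero_code_def vzero_def)

lemma linear_code_words: "linear_code R n C \<Longrightarrow> C \<subseteq> words n"
  and linear_code_zero: "linear_code R n C \<Longrightarrow> vzero n \<in> C"
  and linear_code_add: "linear_code R n C \<Longrightarrow> x \<in> C \<Longrightarrow> y \<in> C \<Longrightarrow> vadd n x y \<in> C"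
  and linear_code_smul: "linear_code R n C \<Longrightarrow> r \<in> carrier R \<Longrightarrow> x \<in> C \<Longrightarrow> vsmul n r x \<in> C"
  by (simp_all add: linear_code_iff)

lemma finite_linear_code: "finite (carrier R) \<Longrightarrow> linear_code R n C \<Longrightarrow> finite C"
  by (rule finite_subset[OF linear_code_words finite_words])

text \<open>Built from addition and the scalar \<open>\<ominus> \<one>\<close>, the operations under
  which a linear code is closed by definition.\<close>

definition vsub :: "nat \<Rightarrow> (nat \<Rightarrow> 'a) \<Rightarrow> (nat \<Rightarrow> 'a) \<Rightarrow> nat \<Rightarrow> 'a" where
  "vsub n x y = vadd n x (vsmul n (\<ominus> \<one>) y)"

lemma vsub_apply: "i < n \<Longrightarrow> x \<in> words n \<Longrightarrow> y \<in> words n \<Longrightarrow> vsub n x y i = x i \<ominus> y i"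
  using words_coord[of y n i] by (simp add: vsub_def minus_eq l_minus)

lemma vsub_closed: "x \<in> words n \<Longrightarrow> y \<in> words n \<Longrightarrow> vsub n x y \<in> words n"
  by (simp add: vsub_def vadd_closed vsmul_closed)

lemma linear_code_sub: "linear_code R n C \<Longrightarrow> x \<in> C \<Longrightarrow> y \<in> C \<Longrightarrow> vsub n x y \<in> C"
  by (simp add: vsub_def linear_code_add linear_code_smul)

lemma vsub_eq_zero:
  assumes "x \<in> words n" "y \<in> words n" "vsub n x y = vzero n"
  shows "x = y"
proof (rule words_eqI[OF assms(1,2)])
  fix i assume i: "i < n"
  have "x i \<ominus> y i = \<zero>" using vsub_apply[OF i assms(1,2)] assms(3) i by simp
  then show "x i = y i" using words_coord[OF assms(1) i] words_coord[OF assms(2) i] by simp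
qed

lemma linear_code_Int: "linear_code R n C \<Longrightarrow> linear_code R n D \<Longrightarrow> linear_code R n (C \<inter> D)"
  by (auto simp: linear_code_iff)

lemma combo_term: "S \<subseteq> words n \<Longrightarrow> r \<in> S \<rightarrow> carrier R \<Longrightarrow> i < n \<Longrightarrow> (\<lambda>s. r s \<otimes> s i) \<in> S \<rightarrow> carrier R"
  by auto

lemma combo_closed: "S \<subseteq> words n \<Longrightarrow> r \<in> S \<rightarrow> carrier R \<Longrightarrow> combo n S r \<in> words n"
  using combo_term[of S n r] by (auto simp: combo_def intro!: finsum_closed)

lemma combo_cong:
  assumes "S \<subseteq> words n" "t \<in> S \<rightarrow> carrier R" "\<And>s. s \<in> S \<Longrightarrow> r s = t s"
  shows "combo n S r = combo n S t"
  unfolding combo_def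
  by (intro restrict_ext finsum_cong') (use combo_term[OF assms(1,2)] assms(3) in auto)

lemma combo_zero:
  assumes "S \<subseteq> words n"
  shows "combo n S (\<lambda>_. \<zero>) = vzero n"
proof (rule words_eqI)
  show "combo n S (\<lambda>_. \<zero>) \<in> words n" using assms by (rule combo_closed) simp
  fix i assume i: "i < n"
  have "(\<Oplus>s\<in>S. \<zero> \<otimes> s i) = (\<Oplus>s\<in>S. \<zero>)"
    using assms i by (intro finsum_cong') (auto intro!: l_null)
  then show "combo n S (\<lambda>_. \<zero>) i = vzero n i" using i by simp
qed (rule vzero_closed)

lemma combo_add:
  assumes S: "S \<subseteq> words n" and r: "r \<in> S \<rightarrow> carrier R" and t: "t \<in> S \<rightarrow> carrier R"
  shows "combo n S (\<lambda>s. r s \<oplus> t s) = vadd n (combo n S r) (combo n S t)"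
proof (rule words_eqI)
  show "combo n S (\<lambda>s. r s \<oplus> t s) \<in> words n" using S by (rule combo_closed) (use r t in auto)
  show "vadd n (combo n S r) (combo n S t) \<in> words n" using S r t by (simp add: vadd_closed combo_closed)
  fix i assume i: "i < n"
  have "(\<Oplus>s\<in>S. (r s \<oplus> t s) \<otimes> s i) = (\<Oplus>s\<in>S. r s \<otimes> s i \<oplus> t s \<otimes> s i)"
  proof (rule finsum_cong')
    show "(\<lambda>s. r s \<otimes> s i \<oplus> t s \<otimes> s i) \<in> S \<rightarrow> carrier R"
      using combo_term[OF S r i] combo_term[OF S t i] by auto
    fix s assume "s \<in> S"
    then show "(r s \<oplus> t s) \<otimes> s i = r s \<otimes> s i \<oplus> t s \<otimes> s i"
      using r t words_coord[of s n i] S i by (intro l_distr) auto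
  qed simp
  also have "\<dots> = (\<Oplus>s\<in>S. r s \<otimes> s i) \<oplus> (\<Oplus>s\<in>S. t s \<otimes> s i)"
    by (rule finsum_addf) (use combo_term[OF S r i] combo_term[OF S t i] in auto)
  finally show "combo n S (\<lambda>s. r s \<oplus> t s) i = vadd n (combo n S r) (combo n S t) i" using i by simp
qed

lemma combo_smul:
  assumes S: "S \<subseteq> words n" and fin: "finite S" and r: "r \<in> S \<rightarrow> carrier R" and a: "a \<in> carrier R"
  shows "combo n S (\<lambda>s. a \<otimes> r s) = vsmul n a (combo n S r)"
proof (rule words_eqI)
  show "combo n S (\<lambda>s. a \<otimes> r s) \<in> words n" using S by (rule combo_closed) (use r a in auto)
  show "vsmul n a (combo n S r) \<in> words n" using S r a by (simp add: vsmul_closed combo_closed)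
  fix i assume i: "i < n"
  have "(\<Oplus>s\<in>S. (a \<otimes> r s) \<otimes> s i) = (\<Oplus>s\<in>S. a \<otimes> (r s \<otimes> s i))"
  proof (rule finsum_cong')
    show "(\<lambda>s. a \<otimes> (r s \<otimes> s i)) \<in> S \<rightarrow> carrier R"
      using combo_term[OF S r i] a by auto
    fix s assume "s \<in> S"
    then show "(a \<otimes> r s) \<otimes> s i = a \<otimes> (r s \<otimes> s i)"
      using r a words_coord[of s n i] S i by (intro m_assoc) auto
  qed simp
  also have "\<dots> = a \<otimes> (\<Oplus>s\<in>S. r s \<otimes> s i)"
    by (rule finsum_rdistr[symmetric]) (use fin a combo_term[OF S r i] in auto)
  finally show "combo n S (\<lambda>s. a \<otimes> r s) i = vsmul n a (combo n S r) i" using i by simp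
qed

lemma combo_sub:
  assumes S: "S \<subseteq> words n" and fin: "finite S" and r: "r \<in> S \<rightarrow> carrier R" and t: "t \<in> S \<rightarrow> carrier R"
  shows "combo n S (\<lambda>s. r s \<ominus> t s) = vsub n (combo n S r) (combo n S t)"
proof -
  have t': "(\<lambda>s. \<ominus> \<one> \<otimes> t s) \<in> S \<rightarrow> carrier R" using t by auto
  have "combo n S (\<lambda>s. r s \<ominus> t s) = combo n S (\<lambda>s. r s \<oplus> \<ominus> \<one> \<otimes> t s)"
  proof (rule combo_cong[OF S])
    show "(\<lambda>s. r s \<oplus> \<ominus> \<one> \<otimes> t s) \<in> S \<rightarrow> carrier R" using r t by auto
    fix s assume "s \<in> S"
    then have "r s \<in> carrier R" "t s \<in> carrier R" using r t by auto
    then show "r s \<ominus> t s = r s \<oplus> \<ominus> \<one> \<otimes> t s" by (simp add: minus_eq l_minus)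
  qed
  then show ?thesis
    using combo_add[OF S r t'] combo_smul[OF S fin t, of "\<ominus> \<one>"] by (simp add: vsub_def)
qed

lemma combo_insert:
  assumes S: "insert s S \<subseteq> words n" and fin: "finite S" "s \<notin> S" and r: "r \<in> insert s S \<rightarrow> carrier R"
  shows "combo n (insert s S) r = vadd n (vsmul n (r s) s) (combo n S r)"
proof (rule words_eqI)
  have S': "S \<subseteq> words n" and r': "r \<in> S \<rightarrow> carrier R" and s: "s \<in> words n" "r s \<in> carrier R" using S r by auto
  show "combo n (insert s S) r \<in> words n" using S r by (rule combo_closed)
  show "vadd n (vsmul n (r s) s) (combo n S r) \<in> words n"
    using s S' r' by (simp add: vadd_closed vsmul_closed combo_closed)
  fix i assume i: "i < n"
  have "(\<Oplus>s\<in>insert s S. r s \<otimes> s i) = r s \<otimes> s i \<oplus> (\<Oplus>s\<in>S. r s \<otimes> s i)"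
    using fin combo_term[OF S' r' i] s words_coord[OF s(1) i] by (intro finsum_insert) auto
  then show "combo n (insert s S) r i = vadd n (vsmul n (r s) s) (combo n S r) i" using i by simp
qed

lemma combo_empty: "combo n {} r = vzero n"
  by (rule words_eqI[OF combo_closed vzero_closed]) auto

lemma combo_delta:
  assumes S: "S \<subseteq> words n" and fin: "finite S" and s: "s \<in> S"
  shows "combo n S (\<lambda>t. if t = s then \<one> else \<zero>) = s"
proof -
  let ?r = "\<lambda>t. if t = s then \<one> else \<zero>"
  have S': "insert s (S - {s}) = S" using s by blast
  have sw: "s \<in> words n" using S s by blast
  have "combo n (insert s (S - {s})) ?r = vadd n (vsmul n (?r s) s) (combo n (S - {s}) ?r)"
    by (rule combo_insert) (use S s fin in auto)
  also have "combo n (S - {s}) ?r = combo n (S - {s}) (\<lambda>_. \<zero>)"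
    by (rule combo_cong) (use S in auto)
  also have "\<dots> = vzero n" by (rule combo_zero) (use S in auto)
  also have "vadd n (vsmul n (?r s) s) (vzero n) = s"
    by (rule words_eqI[OF vadd_closed[OF vsmul_closed vzero_closed] sw]) (use sw words_coord[OF sw] in auto)
  finally show ?thesis by (simp only: S')
qed

lemma combo_in_code:
  assumes C: "linear_code R n C" and fin: "finite S" and S: "S \<subseteq> C" and r: "r \<in> S \<rightarrow> carrier R"
  shows "combo n S r \<in> C"
  using fin S r
proof (induction S rule: finite_induct)
  case empty
  then show ?case using linear_code_zero[OF C] by (simp add: combo_empty)
next
  case (insert s S)
  have "combo n S r \<in> C" using insert by auto
  moreover have "vsmul n (r s) s \<in> C" using insert.prems by (intro linear_code_smul[OF C]) auto
  moreover have "insert s S \<subseteq> words n" using insert.prems linear_code_words[OF C] by blast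
  ultimately show ?case
    using combo_insert[OF _ insert.hyps insert.prems(2)] linear_code_add[OF C] by simp
qed

lemma linear_code_combos:
  assumes S: "S \<subseteq> words n" and fin: "finite S"
  shows "linear_code R n ((\<lambda>r. combo n S r) ` (S \<rightarrow> carrier R))"
  unfolding linear_code_iff
proof (intro conjI ballI)
  show "combo n S ` (S \<rightarrow> carrier R) \<subseteq> words n" using combo_closed[OF S] by blast
  show "vzero n \<in> combo n S ` (S \<rightarrow> carrier R)"
    using imageI[of "\<lambda>_. \<zero>" "S \<rightarrow> carrier R" "combo n S"] by (simp add: combo_zero[OF S])
  fix x assume "x \<in> combo n S ` (S \<rightarrow> carrier R)"
  then obtain r where r: "r \<in> S \<rightarrow> carrier R" "x = combo n S r" by blast
  {
    fix y assume "y \<in> combo n S ` (S \<rightarrow> carrier R)"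
    then obtain t where t: "t \<in> S \<rightarrow> carrier R" "y = combo n S t" by blast
    have "(\<lambda>s. r s \<oplus> t s) \<in> S \<rightarrow> carrier R" using r t by auto
    then show "vadd n x y \<in> combo n S ` (S \<rightarrow> carrier R)"
      by (rule rev_image_eqI) (simp only: r(2) t(2) combo_add[OF S r(1) t(1)])
  next
    fix a assume a: "a \<in> carrier R"
    have "(\<lambda>s. a \<otimes> r s) \<in> S \<rightarrow> carrier R" using r a by auto
    then show "vsmul n a x \<in> combo n S ` (S \<rightarrow> carrier R)"
      by (rule rev_image_eqI) (simp only: r(2) combo_smul[OF S fin r(1) a])
  }
qed

text \<open>The combinations form a linear code containing \<open>S\<close>, and every linear code
  containing \<open>S\<close> contains them.\<close>

lemma hull_eq_combos:
  assumes S: "S \<subseteq> words n" and fin: "finite S"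
  shows "linear_code R n hull S = combo n S ` (S \<rightarrow> carrier R)"
proof (rule subset_antisym)
  have "S \<subseteq> combo n S ` (S \<rightarrow> carrier R)"
  proof
    fix s assume s: "s \<in> S"
    have "(\<lambda>t. if t = s then \<one> else \<zero>) \<in> S \<rightarrow> carrier R" by auto
    then show "s \<in> combo n S ` (S \<rightarrow> carrier R)"
      by (rule rev_image_eqI) (simp only: combo_delta[OF S fin s])
  qed
  then show "linear_code R n hull S \<subseteq> combo n S ` (S \<rightarrow> carrier R)"
    by (rule hull_minimal) (rule linear_code_combos[OF S fin])
  show "combo n S ` (S \<rightarrow> carrier R) \<subseteq> linear_code R n hull S"
    unfolding hull_def using combo_in_code[OF _ fin] by blast
qed

lemma hull_linear:
  assumes S: "S \<subseteq> words n" and fin: "finite S"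
  shows "linear_code R n (linear_code R n hull S)"
  unfolding hull_eq_combos[OF S fin] by (rule linear_code_combos[OF S fin])

section \<open>Minimal generating sets, independence and cardinality\<close>

lemma code_rank_generators:
  assumes fin: "finite (carrier R)" and C: "linear_code R n C"
  obtains S where "S \<subseteq> C" "finite S" "card S = code_rank R n C" "linear_code R n hull S = C"
proof -
  have "finite C" using finite_linear_code[OF fin C] .
  then have "\<exists>S\<subseteq>C. finite S \<and> card S = card C \<and> linear_code R n hull S = C"
    using hull_same[of "linear_code R n" C] C by blast
  then have "\<exists>k. \<exists>S\<subseteq>C. finite S \<and> card S = k \<and> linear_code R n hull S = C" by blast
  from LeastI_ex[OF this] show thesis using that unfolding code_rank_def by blast
qed

lemma code_rank_le:
  "S \<subseteq> C \<Longrightarrow> finite S \<Longrightarrow> linear_code R n hull S = C \<Longrightarrow> code_rank R n C \<le> card S"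
  unfolding code_rank_def by (rule Least_le) blast

text \<open>A unit coefficient would let us solve for its generator and drop it.\<close>
lemma minimal_generators_relation:
  assumes C: "linear_code R n C"
    and S: "S \<subseteq> C" "finite S" "card S = code_rank R n C" "linear_code R n hull S = C"
    and r: "r \<in> S \<rightarrow> carrier R" and rel: "combo n S r = vzero n" and s: "s \<in> S"
  shows "r s \<notin> Units R"
proof
  assume U: "r s \<in> Units R"
  have Uc: "r s \<in> carrier R" "inv (r s) \<in> carrier R" using U by auto
  let ?S = "S - {s}"
  have SW: "S \<subseteq> words n" using S(1) linear_code_words[OF C] by blast
  have S'W: "?S \<subseteq> words n" and fin': "finite ?S" and r': "r \<in> ?S \<rightarrow> carrier R" using SW S(2) r by auto
  have sW: "s \<in> words n" using SW s by blast
  let ?H = "linear_code R n hull ?S"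
  have H: "linear_code R n ?H" by (rule hull_linear[OF S'W fin'])
  have "combo n ?S r \<in> ?H" unfolding hull_eq_combos[OF S'W fin'] using r' by blast
  then have inH: "vsmul n (\<ominus> (inv (r s))) (combo n ?S r) \<in> ?H"
    using Uc by (intro linear_code_smul[OF H]) auto
  have ins: "insert s ?S = S" using s by blast
  have "combo n (insert s ?S) r = vadd n (vsmul n (r s) s) (combo n ?S r)"
    by (rule combo_insert) (use SW s S(2) r in auto)
  then have rel': "vadd n (vsmul n (r s) s) (combo n ?S r) = vzero n" using rel by (simp only: ins)
  have "s = vsmul n (\<ominus> (inv (r s))) (combo n ?S r)"
  proof (rule words_eqI[OF sW])
    show cw: "vsmul n (\<ominus> (inv (r s))) (combo n ?S r) \<in> words n"
      using Uc by (intro vsmul_closed combo_closed[OF S'W r']) auto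
    fix i assume i: "i < n"
    have si: "s i \<in> carrier R" using words_coord[OF sW i] .
    define c where "c = combo n ?S r i"
    have cc: "c \<in> carrier R" unfolding c_def using words_coord[OF combo_closed[OF S'W r'] i] .
    have "vadd n (vsmul n (r s) s) (combo n ?S r) i = \<zero>" using rel' i by simp
    then have "r s \<otimes> s i \<oplus> c = \<zero>" using i by (simp only: v_apply c_def)
    then have "c = \<ominus> (r s \<otimes> s i)" using cc Uc si by (metis m_closed minus_equality a_comm)
    then have "\<ominus> (inv (r s)) \<otimes> c = inv (r s) \<otimes> (r s \<otimes> s i)" using Uc si by (simp add: l_minus r_minus)
    also have "\<dots> = s i" using m_assoc[of "inv (r s)" "r s" "s i"] U Uc si by simp
    finally show "s i = vsmul n (\<ominus> (inv (r s))) (combo n ?S r) i" using i by (simp only: v_apply(3) c_def)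
  qed
  then have "s \<in> ?H" using inH by simp
  then have "S \<subseteq> ?H" using hull_subset[of ?S "linear_code R n"] by blast
  then have "C \<subseteq> ?H" using hull_minimal[of S ?H "linear_code R n"] H S(4) by simp
  moreover have "?H \<subseteq> C" using hull_mono[of ?S S "linear_code R n"] S(4) by blast
  ultimately have "?H = C" by blast
  then have "code_rank R n C \<le> card ?S" using S(1) fin' by (intro code_rank_le) auto
  moreover have "card ?S < card S" using S(2) s by (rule card_Diff1_less)
  ultimately show False using S(3) by simp
qed

text \<open>Two extensional coefficient functions with the same combination differ by a relation, so
  they coincide; restricting coefficients to \<open>B\<close> does not change a combination.\<close>

lemma card_hull_lin_indep:
  assumes fin: "finite (carrier R)" and B: "B \<subseteq> words n" and ind: "lin_indep R n B"
  shows "card (linear_code R n hull B) = card (carrier R) ^ card B"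
proof -
  have finB: "finite B" using ind by (simp add: lin_indep_def)
  have "inj_on (combo n B) (B \<rightarrow>\<^sub>E carrier R)"
  proof (rule inj_onI)
    fix r t assume rt: "r \<in> B \<rightarrow>\<^sub>E carrier R" "t \<in> B \<rightarrow>\<^sub>E carrier R" and eq: "combo n B r = combo n B t"
    have r': "r \<in> B \<rightarrow> carrier R" and t': "t \<in> B \<rightarrow> carrier R" using rt by auto
    have sub: "(\<lambda>s. r s \<ominus> t s) \<in> B \<rightarrow> carrier R" using r' t' by auto
    have W: "combo n B t \<in> words n" by (rule combo_closed[OF B t'])
    have z: "combo n B (\<lambda>s. r s \<ominus> t s) i = \<zero>" if i: "i < n" for i
      using vsub_apply[OF i W W] words_coord[OF W i] combo_sub[OF B finB r' t'] by (simp add: eq minus_eq r_neg)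
    have "(\<Oplus>b\<in>B. (r b \<ominus> t b) \<otimes> b i) = \<zero>" if "i < n" for i
      using z[OF that] that by simp
    then have z': "\<forall>b\<in>B. r b \<ominus> t b = \<zero>"
      using ind[unfolded lin_indep_def, THEN conjunct2, THEN bspec, OF sub] by blast
    show "r = t"
    proof (rule PiE_ext[OF rt])
      fix b assume b: "b \<in> B"
      have "r b \<in> carrier R" "t b \<in> carrier R" using r' t' b by auto
      then show "r b = t b" using bspec[OF z' b] by simp
    qed
  qed
  moreover have "combo n B ` (B \<rightarrow>\<^sub>E carrier R) = combo n B ` (B \<rightarrow> carrier R)"
  proof (intro subset_antisym image_subsetI)
    fix r assume r: "r \<in> B \<rightarrow> carrier R"
    have "combo n B r = combo n B (restrict r B)"
      by (rule combo_cong[OF B]) (use r in auto)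
    moreover have "restrict r B \<in> B \<rightarrow>\<^sub>E carrier R" using r by auto
    ultimately show "combo n B r \<in> combo n B ` (B \<rightarrow>\<^sub>E carrier R)" by (metis imageI)
  next
    fix r assume "r \<in> B \<rightarrow>\<^sub>E carrier R"
    then show "combo n B r \<in> combo n B ` (B \<rightarrow> carrier R)" by (intro imageI) auto
  qed
  ultimately have "card (combo n B ` (B \<rightarrow> carrier R)) = card (B \<rightarrow>\<^sub>E carrier R)"
    by (metis card_image)
  then show ?thesis using finB by (simp add: hull_eq_combos[OF B finB] card_PiE)
qed

end

lemma (in field) two_le_card: "finite (carrier R) \<Longrightarrow> 2 \<le> card (carrier R)"
  using card_mono[of "carrier R" "{\<zero>, \<one>}"] by simp

text \<open>Nonunits of a field are zero, so a generating set of least size is independent and a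
  basis exists. The size of the code fixes the size of every basis, which gives the
  \<open>THE\<close> in \<open>code_dim\<close> its value and lets dimensions be read off from
  cardinalities.\<close>

lemma (in field) code_dim_iff:
  assumes fin: "finite (carrier R)" and C: "linear_code R n C"
  shows "code_dim R n C = k \<longleftrightarrow> card C = card (carrier R) ^ k"
proof -
  obtain S where S: "S \<subseteq> C" "finite S" "card S = code_rank R n C" "linear_code R n hull S = C"
    using code_rank_generators[OF fin C] by blast
  have CW: "C \<subseteq> words n" by (rule linear_code_words[OF C])
  have SW: "S \<subseteq> words n" using S(1) CW by blast
  have ind: "lin_indep R n S"
    unfolding lin_indep_def
  proof (intro conjI ballI impI)
    fix r s assume r: "r \<in> S \<rightarrow> carrier R" and z: "\<forall>i<n. (\<Oplus>b\<in>S. r b \<otimes> b i) = \<zero>" and s: "s \<in> S"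
    have "combo n S r = vzero n"
      by (rule words_eq_zeroI[OF combo_closed[OF SW r]]) (use z in simp)
    then have "r s \<notin> Units R" using minimal_generators_relation[OF C S r _ s] by blast
    then show "r s = \<zero>" using r s by (auto simp: field_Units)
  qed (rule S(2))
  have basis: "code_basis R n C S" using S ind by (simp add: code_basis_def)
  have card: "card C = card (carrier R) ^ card B" if "code_basis R n C B" for B
    using that card_hull_lin_indep[OF fin, of B n] CW unfolding code_basis_def by auto
  have q: "2 \<le> card (carrier R)" by (rule two_le_card[OF fin])
  have uniq: "card B = card S" if "code_basis R n C B" for B
    using card[OF that] card[OF basis] q by (simp add: power_inject_exp)
  have "code_dim R n C = card S"
    unfolding code_dim_def by (rule the_equality) (use basis uniq in blast)+
  then show ?thesis using card[OF basis] q by (auto simp: power_inject_exp)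
qed

section \<open>MDS codes and the socle of a code\<close>

context ring begin

lemma add_minus_cancel:
  assumes "x \<in> carrier R" "y \<in> carrier R"
  shows "x \<oplus> (y \<ominus> x) = y" "(x \<oplus> y) \<ominus> x = y"
proof -
  show "x \<oplus> (y \<ominus> x) = y"
    unfolding minus_eq using assms a_comm[of y "\<ominus> x"] by (simp add: r_neg2)
  show "(x \<oplus> y) \<ominus> x = y"
    unfolding minus_eq using assms a_comm[of "x \<oplus> y" "\<ominus> x"] by (simp add: r_neg1)
qed

lemma minus_eq_swap:
  assumes c: "x \<in> carrier R" "y \<in> carrier R" "u \<in> carrier R" "v \<in> carrier R" and e: "x \<oplus> u = y \<oplus> v"
  shows "x \<ominus> y = v \<ominus> u"
proof -
  have "x = (u \<oplus> x) \<ominus> u" using add_minus_cancel(2)[OF c(3,1)] by simp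
  also have "\<dots> = y \<oplus> (v \<ominus> u)" using c e by (simp add: a_comm[of u x] minus_eq a_assoc)
  finally show ?thesis using add_minus_cancel(2)[OF c(2), of "v \<ominus> u"] c by simp
qed

lemma vadd_zero:
  assumes "x \<in> words n" shows "vadd n x (vzero n) = x"
  by (rule words_eqI[OF vadd_closed[OF assms vzero_closed] assms]) (simp add: words_coord[OF assms])

lemma vsub_vadd_cancel:
  assumes "x \<in> words n" "y \<in> words n"
  shows "vsub n (vadd n x y) x = y"
proof (rule words_eqI[OF vsub_closed[OF vadd_closed[OF assms] assms(1)] assms(2)])
  fix i assume i: "i < n"
  have c: "x i \<in> carrier R" "y i \<in> carrier R" using assms i words_coord by blast+
  have "vsub n (vadd n x y) x i = (x i \<oplus> y i) \<ominus> x i"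
    using vsub_apply[OF i vadd_closed[OF assms] assms(1)] i by simp
  also have "\<dots> = y i" using c by (rule add_minus_cancel(2))
  finally show "vsub n (vadd n x y) x i = y i" .
qed

lemma vadd_vsub_cancel:
  assumes "x \<in> words n" "y \<in> words n"
  shows "vadd n x (vsub n y x) = y"
proof (rule words_eqI[OF vadd_closed[OF assms(1) vsub_closed[OF assms(2,1)]] assms(2)])
  fix i assume i: "i < n"
  have c: "x i \<in> carrier R" "y i \<in> carrier R" using assms i words_coord by blast+
  have "vadd n x (vsub n y x) i = x i \<oplus> (y i \<ominus> x i)"
    using vsub_apply[OF i assms(2,1)] i by simp
  also have "\<dots> = y i" using c by (rule add_minus_cancel(1))
  finally show "vadd n x (vsub n y x) i = y i" .
qed

lemma vsmul_vadd:
  assumes "r \<in> carrier R" "x \<in> words n" "y \<in> words n"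
  shows "vsmul n r (vadd n x y) = vadd n (vsmul n r x) (vsmul n r y)"
proof (rule words_eqI)
  show "vsmul n r (vadd n x y) \<in> words n" using assms by (intro vsmul_closed vadd_closed)
  show "vadd n (vsmul n r x) (vsmul n r y) \<in> words n" using assms by (intro vsmul_closed vadd_closed)
  fix i assume i: "i < n"
  then show "vsmul n r (vadd n x y) i = vadd n (vsmul n r x) (vsmul n r y) i"
    using r_distr[OF words_coord[OF assms(2) i] words_coord[OF assms(3) i] assms(1)] by simp
qed

lemma vsmul_vsub:
  assumes "r \<in> carrier R" "x \<in> words n" "y \<in> words n"
  shows "vsmul n r (vsub n x y) = vsub n (vsmul n r x) (vsmul n r y)"
proof (rule words_eqI)
  fix i assume i: "i < n"
  have c: "x i \<in> carrier R" "y i \<in> carrier R" using assms i words_coord by blast+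
  show "vsmul n r (vsub n x y) i = vsub n (vsmul n r x) (vsmul n r y) i"
    using assms i c vsub_apply[OF i assms(2,3)] vsub_apply[OF i vsmul_closed[OF assms(1,2)] vsmul_closed[OF assms(1,3)]]
    by (simp add: minus_eq r_distr r_minus)
next
  show "vsmul n r (vsub n x y) \<in> words n" using assms by (intro vsmul_closed vsub_closed)
  show "vsub n (vsmul n r x) (vsmul n r y) \<in> words n" using assms by (intro vsmul_closed vsub_closed)
qed

lemma vsub_self: "x \<in> words n \<Longrightarrow> vsub n x x = vzero n"
  by (rule words_eqI[OF vsub_closed vzero_closed]) (simp_all add: vsub_apply words_coord minus_eq r_neg)

text \<open>Words agreeing on \<open>T\<close> differ by a word supported on the other
  \<open>n - k\<close> positions, which is too light to be nonzero. Writing the weight bound with a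
  sum avoids truncated subtraction.\<close>

lemma restrict_inj_on_code:
  assumes C: "linear_code R n C" and wt: "\<And>x. x \<in> C \<Longrightarrow> x \<noteq> vzero n \<Longrightarrow> n < k + hamming_weight R n x"
    and T: "T \<subseteq> {..<n}" "card T = k"
  shows "inj_on (\<lambda>x. restrict x T) C"
proof (rule inj_onI)
  fix x y assume xy: "x \<in> C" "y \<in> C" and eq: "restrict x T = restrict y T"
  have W: "x \<in> words n" "y \<in> words n" using xy linear_code_words[OF C] by auto
  have "vsub n x y = vzero n"
  proof (rule ccontr)
    assume nz: "vsub n x y \<noteq> vzero n"
    have "{i. i < n \<and> vsub n x y i \<noteq> \<zero>} \<subseteq> {..<n} - T"
    proof (intro subsetI DiffI)
      fix i assume i: "i \<in> {i. i < n \<and> vsub n x y i \<noteq> \<zero>}"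
      then show "i \<in> {..<n}" by simp
      show "i \<notin> T"
      proof
        assume "i \<in> T"
        then have "x i = y i" using eq by (metis restrict_apply')
        then have "vsub n x y i = \<zero>"
          using i W vsub_apply[of i n x y] words_coord[of y n i] by (simp add: minus_eq r_neg)
        then show False using i by simp
      qed
    qed
    then have "hamming_weight R n (vsub n x y) \<le> card ({..<n} - T)"
      unfolding hamming_weight_def by (rule card_mono[rotated]) simp
    also have "\<dots> = n - k" using T finite_subset[OF T(1)] by (simp add: card_Diff_subset)
    finally have "hamming_weight R n (vsub n x y) \<le> n - k" .
    moreover have "k \<le> n" using T card_mono[of "{..<n}" T] by simp
    ultimately show False using wt[OF linear_code_sub[OF C xy] nz] by linarith
  qed
  then show "x = y" by (rule vsub_eq_zero[OF W])
qed

text \<open>By counting, the injection of \<open>restrict_inj_on_code\<close> is onto: any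
  \<open>k\<close> coordinates can be prescribed freely. The alphabet \<open>A\<close> is a
  parameter because both the whole field and the socle are used for it.\<close>

lemma code_interpolation:
  assumes C: "linear_code R n C" and wt: "\<And>x. x \<in> C \<Longrightarrow> x \<noteq> vzero n \<Longrightarrow> n < k + hamming_weight R n x"
    and T: "T \<subseteq> {..<n}" "card T = k" and CA: "C \<subseteq> {..<n} \<rightarrow>\<^sub>E A" and A: "finite A" "card C = card A ^ k"
  shows "bij_betw (\<lambda>x. restrict x T) C (T \<rightarrow>\<^sub>E A)"
proof -
  have inj: "inj_on (\<lambda>x. restrict x T) C" by (rule restrict_inj_on_code[OF C wt T])
  have finT: "finite T" using T(1) finite_subset by blast
  have sub: "(\<lambda>x. restrict x T) ` C \<subseteq> T \<rightarrow>\<^sub>E A"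
  proof (rule image_subsetI)
    fix x assume "x \<in> C"
    then have "x \<in> {..<n} \<rightarrow>\<^sub>E A" using CA by blast
    then show "restrict x T \<in> T \<rightarrow>\<^sub>E A" using T(1) by (auto simp: PiE_iff)
  qed
  have "card ((\<lambda>x. restrict x T) ` C) = card (T \<rightarrow>\<^sub>E A)"
    using inj A finT T(2) by (simp add: card_image card_PiE)
  then have "(\<lambda>x. restrict x T) ` C = T \<rightarrow>\<^sub>E A"
    using card_subset_eq[OF _ sub] finT A(1) by (simp add: finite_PiE)
  then show ?thesis using inj by (simp add: bij_betw_def)
qed

end

text \<open>The Singleton bound supplies one half of the equality in \<open>mds_code\<close>, so
  only a lower bound on weights remains. The dimension appears as an exponent of the size, which is
  easy to carry along bijections.\<close>

lemma (in field) mds_code_iff: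
  assumes fin: "finite (carrier R)" and E: "linear_code R n E"
  shows "mds_code R n E \<longleftrightarrow> (\<exists>k. card E = card (carrier R) ^ k \<and>
    (\<forall>x\<in>E. x \<noteq> vzero n \<longrightarrow> n < k + hamming_weight R n x))"
proof -
  let ?Q = "card (carrier R)"
  have Q: "2 \<le> ?Q" by (rule two_le_card[OF fin])
  have EW: "E \<subseteq> words n" by (rule linear_code_words[OF E])
  have finE: "finite E" by (rule finite_linear_code[OF fin E])
  define k where "k = code_dim R n E"
  have k: "card E = ?Q ^ k" using code_dim_iff[OF fin E, of k] by (simp add: k_def)
  have "card E \<le> card (words n)" using EW finite_words[OF fin] card_mono by blast
  then have kn: "k \<le> n" using k Q by (simp add: card_PiE)
  have z: "vzero n \<in> E" by (rule linear_code_zero[OF E])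
  have uniq: "card E = ?Q ^ l \<longleftrightarrow> l = k" for l using k Q by (auto simp: power_inject_exp)
  have "int (hamming_dist R n E) = int n - int k + 1 \<longleftrightarrow>
    (\<forall>x\<in>E. x \<noteq> vzero n \<longrightarrow> n < k + hamming_weight R n x)"
  proof (cases "E = {vzero n}")
    \<comment> \<open>For the zero code the conventional distance \<open>n + 1\<close> matches
      dimension 0, and the weight condition is vacuous.\<close>
    case True
    then have "k = 0" using uniq[of 0] by simp
    then show ?thesis using True by (simp add: hamming_dist_def zero_code_eq)
  next
    case False
    let ?W = "hamming_weight R n ` (E - {vzero n})"
    have W: "finite ?W" "?W \<noteq> {}" using finE False z by auto
    have d: "hamming_dist R n E = Min ?W" using False by (simp add: hamming_dist_def zero_code_eq)
    have k0: "k \<noteq> 0"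
    proof
      assume "k = 0"
      then have "card E = 1" using k by simp
      then show False using False z by (auto simp: card_1_singleton_iff)
    qed
    \<comment> \<open>A larger minimum would make restriction to \<open>k - 1\<close> coordinates
      injective, leaving too few words.\<close>
    have singleton: "Min ?W \<le> n - k + 1"
    proof (rule ccontr)
      assume "\<not> Min ?W \<le> n - k + 1"
      then have less: "n - k + 1 < Min ?W" by simp
      have wt: "n < (k - 1) + hamming_weight R n x" if "x \<in> E" "x \<noteq> vzero n" for x
      proof -
        have "Min ?W \<le> hamming_weight R n x" using W that by (intro Min_le) auto
        then show ?thesis using less k0 kn by linarith
      qed
      have "inj_on (\<lambda>x. restrict x {..<k - 1}) E"
        by (rule restrict_inj_on_code[OF E wt]) (use kn in auto)
      then have "card E = card ((\<lambda>x. restrict x {..<k - 1}) ` E)" by (simp add: card_image)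
      also have "\<dots> \<le> card ({..<k - 1} \<rightarrow>\<^sub>E carrier R)"
      proof (rule card_mono)
        show "finite ({..<k - 1} \<rightarrow>\<^sub>E carrier R)" using fin by (simp add: finite_PiE)
        show "(\<lambda>x. restrict x {..<k - 1}) ` E \<subseteq> {..<k - 1} \<rightarrow>\<^sub>E carrier R"
        proof (rule image_subsetI)
          fix x assume "x \<in> E"
          then have "x \<in> words n" using EW by blast
          then show "restrict x {..<k - 1} \<in> {..<k - 1} \<rightarrow>\<^sub>E carrier R" using kn by (simp add: PiE_iff)
        qed
      qed
      also have "\<dots> = ?Q ^ (k - 1)" by (simp add: card_PiE)
      finally have "?Q ^ k \<le> ?Q ^ (k - 1)" using k by simp
      then have "k \<le> k - 1" using Q by (subst (asm) power_increasing_iff) auto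
      then show False using k0 by simp
    qed
    have le_iff: "n - k + 1 \<le> w \<longleftrightarrow> n < k + w" for w using kn by linarith
    have "int (Min ?W) = int n - int k + 1 \<longleftrightarrow> n - k + 1 \<le> Min ?W"
      using singleton kn by linarith
    also have "\<dots> \<longleftrightarrow> (\<forall>w\<in>?W. n - k + 1 \<le> w)" using W by simp
    also have "\<dots> \<longleftrightarrow> (\<forall>x\<in>E. x \<noteq> vzero n \<longrightarrow> n < k + hamming_weight R n x)"
      using le_iff by (simp only: ball_simps) blast
    finally show ?thesis by (simp only: d)
  qed
  then show ?thesis using E uniq by (simp add: mds_code_def k_def[symmetric])
qed

section \<open>Counting a code modulo the maximal ideal\<close>

context chain_ring_generator begin

lemma socle_words_iff: "x \<in> words n \<Longrightarrow> x \<in> socle_words R g n \<longleftrightarrow> vsmul n g x = vzero n"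
proof
  assume x: "x \<in> words n" "x \<in> socle_words R g n"
  show "vsmul n g x = vzero n"
  proof (rule words_eq_zeroI)
    show "vsmul n g x \<in> words n" using x by (intro vsmul_closed) auto
    fix i assume i: "i < n"
    then have "x i \<in> socle R g" using x(2) by (auto simp: socle_words_def)
    then show "vsmul n g x i = \<zero>" using i socle_annihilator by simp
  qed
next
  assume x: "x \<in> words n" "vsmul n g x = vzero n"
  have "x i \<in> socle R g" if i: "i < n" for i
  proof -
    have "g \<otimes> x i = \<zero>" using v_apply(3)[OF i, of g x] v_apply(1)[OF i] x(2) by simp
    then show ?thesis using words_coord[OF x(1) i] socle_annihilator by simp
  qed
  then show "x \<in> socle_words R g n" using x(1) by (auto simp: socle_words_def PiE_iff)
qed

lemma socle_words_subset: "socle_words R g n \<subseteq> words n"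
  unfolding socle_words_def by (rule PiE_mono) (rule socle_subset)

lemma linear_code_socle_words: "linear_code R n (socle_words R g n)"
  unfolding linear_code_iff
proof (intro conjI ballI)
  show "socle_words R g n \<subseteq> words n" by (rule socle_words_subset)
  show "vzero n \<in> socle_words R g n" by (auto simp: socle_words_def vzero_def socle_zero)
  fix x assume x: "x \<in> socle_words R g n"
  show "vadd n x y \<in> socle_words R g n" if "y \<in> socle_words R g n" for y
    using x that by (auto simp: socle_words_def vadd_def intro!: socle_add)
  show "vsmul n r x \<in> socle_words R g n" if "r \<in> carrier R" for r
    using x that by (auto simp: socle_words_def vsmul_def intro!: socle_mult)
qed

text \<open>The fibres of \<open>vsmul n g\<close> on \<open>C\<close> are translates of its kernel,
  which is the socle part.\<close>

lemma card_socle_code_mult: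
  assumes C: "linear_code R n C"
  shows "card C = card (vsmul n g ` C) * card (C \<inter> socle_words R g n)"
proof -
  let ?D = "C \<inter> socle_words R g n"
  have CW: "C \<subseteq> words n" by (rule linear_code_words[OF C])
  have finC: "finite C" using finite_linear_code[OF finite_carrier C] .
  have fiber: "card {c \<in> C. vsmul n g c = y} = card ?D" if y: "y \<in> vsmul n g ` C" for y
  proof -
    obtain c0 where c0: "c0 \<in> C" "y = vsmul n g c0" using y by blast
    have c0W: "c0 \<in> words n" using c0 CW by blast
    have "bij_betw (vadd n c0) ?D {c \<in> C. vsmul n g c = y}"
    proof (rule bij_betw_byWitness[where f' = "\<lambda>c. vsub n c c0"])
      show "\<forall>d\<in>?D. vsub n (vadd n c0 d) c0 = d" using CW c0W by (auto intro!: vsub_vadd_cancel)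
      show "\<forall>c\<in>{c \<in> C. vsmul n g c = y}. vadd n c0 (vsub n c c0) = c"
        using CW c0W by (auto intro!: vadd_vsub_cancel)
      show "vadd n c0 ` ?D \<subseteq> {c \<in> C. vsmul n g c = y}"
      proof (rule image_subsetI)
        fix d assume d: "d \<in> ?D"
        then have dW: "d \<in> words n" using CW by blast
        have "vsmul n g (vadd n c0 d) = vadd n y (vzero n)"
          using vsmul_vadd[OF g_closed c0W dW] socle_words_iff[OF dW] d c0(2) by simp
        also have "\<dots> = y"
          unfolding c0(2) by (rule vadd_zero[OF vsmul_closed[OF g_closed c0W]])
        finally show "vadd n c0 d \<in> {c \<in> C. vsmul n g c = y}"
          using linear_code_add[OF C c0(1)] d by blast
      qed
      show "(\<lambda>c. vsub n c c0) ` {c \<in> C. vsmul n g c = y} \<subseteq> ?D"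
      proof (rule image_subsetI)
        fix c assume c: "c \<in> {c \<in> C. vsmul n g c = y}"
        then have cW: "c \<in> words n" using CW by blast
        have "vsmul n g (vsub n c c0) = vzero n"
          using vsmul_vsub[OF g_closed cW c0W] c c0(2) vsub_self[OF vsmul_closed[OF g_closed c0W]] by simp
        then have "vsub n c c0 \<in> socle_words R g n" using socle_words_iff[OF vsub_closed[OF cW c0W]] by simp
        then show "vsub n c c0 \<in> ?D" using linear_code_sub[OF C _ c0(1)] c by blast
      qed
    qed
    from bij_betw_same_card[OF this] show ?thesis by simp
  qed
  have "card C = (\<Sum>y\<in>vsmul n g ` C. card {c \<in> C. vsmul n g c = y})"
    using sum.image_gen[OF finC, of "\<lambda>_. 1::nat" "vsmul n g"] by simp
  also have "\<dots> = (\<Sum>y\<in>vsmul n g ` C. card ?D)" by (intro sum.cong refl fiber)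
  finally show ?thesis by simp
qed

lemma J_diff_cancel: "x \<in> carrier R \<Longrightarrow> y \<in> J \<Longrightarrow> x \<ominus> y \<in> J \<Longrightarrow> x \<in> J"
proof -
  assume x: "x \<in> carrier R" "y \<in> J" "x \<ominus> y \<in> J"
  have "(x \<ominus> y) \<oplus> y \<in> J"
    using x by (intro additive_subgroup.a_closed[OF ideal.axioms(1)[OF J_ideal]])
  moreover have "y \<in> carrier R" using x J_subset by blast
  ultimately show ?thesis using x by (simp add: minus_eq a_assoc l_neg)
qed

text \<open>With minimal generators \<open>S\<close> and digits \<open>T\<close>, each word of
  \<open>C\<close> is uniquely a combination with coefficients in \<open>T\<close> plus an element
  of \<open>g C\<close>. This counts the quotient of \<open>C\<close> by \<open>g C\<close> without
  forming it.\<close>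

lemma card_code_rank:
  assumes C: "linear_code R n C"
  shows "card C = q ^ code_rank R n C * card (vsmul n g ` C)"
proof -
  obtain S where S: "S \<subseteq> C" "finite S" "card S = code_rank R n C" "linear_code R n hull S = C"
    using code_rank_generators[OF finite_carrier C] by blast
  obtain T where T: "T \<subseteq> carrier R" "finite T" "card T = q"
    "\<And>r. r \<in> carrier R \<Longrightarrow> \<exists>t\<in>T. r \<ominus> t \<in> J"
    "\<And>t t'. t \<in> T \<Longrightarrow> t' \<in> T \<Longrightarrow> t \<ominus> t' \<in> J \<Longrightarrow> t = t'"
    using transversal by blast
  have CW: "C \<subseteq> words n" by (rule linear_code_words[OF C])
  have SW: "S \<subseteq> words n" using S(1) CW by blast
  have Ceq: "C = combo n S ` (S \<rightarrow> carrier R)" using hull_eq_combos[OF SW S(2)] S(4) by simp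
  let ?gC = "vsmul n g ` C"
  have gC: "?gC \<subseteq> C" using linear_code_smul[OF C g_closed] by blast
  let ?f = "\<lambda>(t, v). vadd n (combo n S t) v"
  have Tfun: "t \<in> S \<rightarrow> carrier R" if "t \<in> S \<rightarrow>\<^sub>E T" for t using that T(1) by auto
  have inj: "inj_on ?f ((S \<rightarrow>\<^sub>E T) \<times> ?gC)"
  proof (rule inj_onI, clarify)
    fix t c t' c'
    assume t: "t \<in> S \<rightarrow>\<^sub>E T" "t' \<in> S \<rightarrow>\<^sub>E T" and c: "c \<in> C" "c' \<in> C"
      and eq: "vadd n (combo n S t) (vsmul n g c) = vadd n (combo n S t') (vsmul n g c')"
    note t' = Tfun[OF t(1)] Tfun[OF t(2)]
    have W: "c \<in> words n" "c' \<in> words n" using c CW by auto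
    note tW = combo_closed[OF SW t'(1)] combo_closed[OF SW t'(2)]
    note gW = vsmul_closed[OF g_closed W(1)] vsmul_closed[OF g_closed W(2)]
    \<comment> \<open>Expanding \<open>c' - c\<close> in the generators turns the equality into a
      relation with coefficients \<open>(t s \<ominus> t' s) \<ominus> g \<otimes> a s\<close>. None
      of these is a unit, so they lie in \<open>J\<close>, and hence so do the differences of
      digits.\<close>
    have "vsub n c' c \<in> C" by (rule linear_code_sub[OF C c(2,1)])
    then obtain a where a: "a \<in> S \<rightarrow> carrier R" "vsub n c' c = combo n S a" using Ceq by blast
    have ga: "(\<lambda>s. g \<otimes> a s) \<in> S \<rightarrow> carrier R" using a(1) by auto
    have tt: "(\<lambda>s. t s \<ominus> t' s) \<in> S \<rightarrow> carrier R" using t' by auto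
    have "combo n S (\<lambda>s. t s \<ominus> t' s) = vsub n (combo n S t) (combo n S t')"
      by (rule combo_sub[OF SW S(2) t'])
    also have "\<dots> = vsub n (vsmul n g c') (vsmul n g c)"
    proof (rule words_eqI[OF vsub_closed[OF tW] vsub_closed[OF gW(2,1)]])
      fix i assume i: "i < n"
      define x y u v where "x = combo n S t i" and "y = combo n S t' i" and "u = vsmul n g c i" and "v = vsmul n g c' i"
      have cl: "x \<in> carrier R" "y \<in> carrier R" "u \<in> carrier R" "v \<in> carrier R"
        unfolding x_def y_def u_def v_def using tW gW i by (blast intro: words_coord)+
      have "vadd n (combo n S t) (vsmul n g c) i = vadd n (combo n S t') (vsmul n g c') i" by (simp only: eq)
      then have e: "x \<oplus> u = y \<oplus> v" unfolding x_def y_def u_def v_def v_apply(2)[OF i] .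
      have "x \<ominus> y = v \<ominus> u" using cl e by (rule minus_eq_swap)
      then show "vsub n (combo n S t) (combo n S t') i = vsub n (vsmul n g c') (vsmul n g c) i"
        unfolding vsub_apply[OF i tW] vsub_apply[OF i gW(2,1)] x_def y_def u_def v_def .
    qed
    also have "\<dots> = combo n S (\<lambda>s. g \<otimes> a s)"
      using combo_smul[OF SW S(2) a(1) g_closed] vsmul_vsub[OF g_closed W(2,1)] a(2) by simp
    finally have "combo n S (\<lambda>s. (t s \<ominus> t' s) \<ominus> g \<otimes> a s) = vzero n"
      using combo_sub[OF SW S(2) tt ga] vsub_self[OF combo_closed[OF SW ga]] by simp
    moreover have "(\<lambda>s. (t s \<ominus> t' s) \<ominus> g \<otimes> a s) \<in> S \<rightarrow> carrier R" using tt ga by auto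
    ultimately have nonunit: "(t s \<ominus> t' s) \<ominus> g \<otimes> a s \<notin> Units R" if "s \<in> S" for s
      using minimal_generators_relation[OF C S _ _ that] by blast
    have "t = t'"
    proof (rule PiE_ext[OF t])
      fix s assume s: "s \<in> S"
      have cl: "a s \<in> carrier R" "t s \<in> T" "t' s \<in> T" "t s \<in> carrier R" "t' s \<in> carrier R"
        using s a(1) t t' by auto
      have "g \<otimes> a s \<in> J" using cl J_right by blast
      moreover have "(t s \<ominus> t' s) \<ominus> g \<otimes> a s \<in> J" using nonunit[OF s] cl by (simp add: J_nonunits)
      ultimately have "t s \<ominus> t' s \<in> J" using cl by (intro J_diff_cancel[of "t s \<ominus> t' s" "g \<otimes> a s"]) auto
      then show "t s = t' s" using T(5) cl by blast
    qed
    moreover have "vsmul n g c = vsmul n g c'"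
    proof -
      have "vsmul n g c = vsub n (vadd n (combo n S t) (vsmul n g c)) (combo n S t)"
        by (rule vsub_vadd_cancel[OF tW(1) gW(1), symmetric])
      also have "\<dots> = vsub n (vadd n (combo n S t') (vsmul n g c')) (combo n S t')"
        by (simp only: eq) (simp only: \<open>t = t'\<close>)
      also have "\<dots> = vsmul n g c'" by (rule vsub_vadd_cancel[OF tW(2) gW(2)])
      finally show ?thesis .
    qed
    ultimately show "t = t' \<and> vsmul n g c = vsmul n g c'" by blast
  qed
  have "?f ` ((S \<rightarrow>\<^sub>E T) \<times> ?gC) = C"
  proof (intro subset_antisym subsetI)
    fix x assume "x \<in> ?f ` ((S \<rightarrow>\<^sub>E T) \<times> ?gC)"
    then obtain t v where tv: "t \<in> S \<rightarrow>\<^sub>E T" "v \<in> ?gC" "x = vadd n (combo n S t) v" by auto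
    have "combo n S t \<in> C" using combo_in_code[OF C S(2,1) Tfun[OF tv(1)]] .
    then show "x \<in> C" unfolding tv(3) using tv(2) gC by (intro linear_code_add[OF C]) auto
  next
    fix x assume "x \<in> C"
    then obtain r where r: "r \<in> S \<rightarrow> carrier R" "x = combo n S r" using Ceq by blast
    \<comment> \<open>Each coefficient is split into a digit and an element of \<open>J\<close>,
      written with \<open>g\<close> on the left so that \<open>g\<close> can be pulled out of the
      combination as a scalar.\<close>
    have "\<forall>s\<in>S. \<exists>t a. t \<in> T \<and> a \<in> carrier R \<and> r s \<ominus> t = g \<otimes> a"
    proof
      fix s assume "s \<in> S"
      then have "r s \<in> carrier R" using r by auto
      then obtain t where "t \<in> T" "r s \<ominus> t \<in> J" using T(4) by blast
      then show "\<exists>t a. t \<in> T \<and> a \<in> carrier R \<and> r s \<ominus> t = g \<otimes> a" unfolding J_right by blast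
    qed
    then obtain t a where ta: "\<And>s. s \<in> S \<Longrightarrow> t s \<in> T \<and> a s \<in> carrier R \<and> r s \<ominus> t s = g \<otimes> a s"
      by metis
    have t: "restrict t S \<in> S \<rightarrow>\<^sub>E T" and t': "t \<in> S \<rightarrow> carrier R" and a: "a \<in> S \<rightarrow> carrier R"
      and ga: "(\<lambda>s. g \<otimes> a s) \<in> S \<rightarrow> carrier R"
      using ta T(1) by auto
    have "x = combo n S (\<lambda>s. t s \<oplus> g \<otimes> a s)"
      unfolding r(2)
    proof (rule combo_cong[OF SW])
      show "(\<lambda>s. t s \<oplus> g \<otimes> a s) \<in> S \<rightarrow> carrier R" using t' ga by auto
      fix s assume s: "s \<in> S"
      have cl: "r s \<in> carrier R" "t s \<in> carrier R" using r t' s by auto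
      have "t s \<oplus> g \<otimes> a s = t s \<oplus> (r s \<ominus> t s)" using ta[OF s] by simp
      also have "\<dots> = r s" using cl by (intro add_minus_cancel(1))
      finally show "r s = t s \<oplus> g \<otimes> a s" by simp
    qed
    also have "\<dots> = vadd n (combo n S t) (vsmul n g (combo n S a))"
      using combo_add[OF SW t' ga] combo_smul[OF SW S(2) a g_closed] by simp
    also have "combo n S t = combo n S (restrict t S)"
      by (rule combo_cong[OF SW Tfun[OF t]]) simp
    finally have x: "x = ?f (restrict t S, vsmul n g (combo n S a))" by simp
    have "combo n S a \<in> C" using combo_in_code[OF C S(2,1) a] .
    then show "x \<in> ?f ` ((S \<rightarrow>\<^sub>E T) \<times> ?gC)" unfolding x using t by (intro imageI SigmaI) auto
  qed
  then have "card C = card ((S \<rightarrow>\<^sub>E T) \<times> ?gC)" using card_image[OF inj] by simp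
  then show ?thesis using S(2,3) T(3) by (simp add: card_cartesian_product card_PiE)
qed

text \<open>The two factorizations of \<open>card C\<close> share the size of \<open>g C\<close>,
  which is positive and cancels.\<close>

lemma card_socle_code:
  assumes C: "linear_code R n C"
  shows "card (C \<inter> socle_words R g n) = q ^ code_rank R n C"
proof -
  have "finite C" using finite_linear_code[OF finite_carrier C] .
  then have "card (vsmul n g ` C) \<noteq> 0" using linear_code_zero[OF C] by auto
  moreover have "card (vsmul n g ` C) * card (C \<inter> socle_words R g n) = card (vsmul n g ` C) * q ^ code_rank R n C"
    using card_socle_code_mult[OF C] card_code_rank[OF C] by (metis mult.commute)
  ultimately show ?thesis by simp
qed

section \<open>Socle words as words over the residue field\<close>

abbreviation F_words where "F_words n \<equiv> {..<n} \<rightarrow>\<^sub>E carrier F"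

definition socle_lift :: "nat \<Rightarrow> (nat \<Rightarrow> 'a set) \<Rightarrow> nat \<Rightarrow> 'a" where
  "socle_lift n v = (\<lambda>i\<in>{..<n}. socle_iso R g (v i))"

lemma residue_code_eq: "residue_code R g n D = {v \<in> ring.words F n. socle_lift n v \<in> D}"
  by (simp add: residue_code_def socle_lift_def)

lemma socle_lift_bij: "bij_betw (socle_lift n) (F_words n) (socle_words R g n)"
proof -
  let ?h = "the_inv_into (carrier F) (socle_iso R g)"
  have inj: "inj_on (socle_iso R g) (carrier F)" and im: "socle_iso R g ` carrier F = socle R g"
    using socle_iso_bij by (auto simp: bij_betw_def)
  show ?thesis
  proof (rule bij_betw_byWitness[where f' = "\<lambda>x. \<lambda>i\<in>{..<n}. ?h (x i)"])
    show "\<forall>v\<in>F_words n. (\<lambda>i\<in>{..<n}. ?h (socle_lift n v i)) = v"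
    proof
      fix v assume v: "v \<in> F_words n"
      show "(\<lambda>i\<in>{..<n}. ?h (socle_lift n v i)) = v"
      proof (rule PiE_ext[OF _ v])
        have hv: "?h (socle_lift n v i) = v i" if "i < n" for i
        proof -
          have "v i \<in> carrier F" using v that by (simp add: PiE_iff)
          then show ?thesis using that the_inv_into_f_f[OF inj] by (simp add: socle_lift_def)
        qed
        show "(\<lambda>i\<in>{..<n}. ?h (socle_lift n v i)) \<in> F_words n"
          using v hv by (auto simp: PiE_iff)
        fix i assume "i \<in> {..<n}"
        then show "(\<lambda>i\<in>{..<n}. ?h (socle_lift n v i)) i = v i" using hv by simp
      qed
    qed
    show "\<forall>x\<in>socle_words R g n. socle_lift n (\<lambda>i\<in>{..<n}. ?h (x i)) = x"
    proof
      fix x assume x: "x \<in> socle_words R g n"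
      have hx: "socle_iso R g (?h (x i)) = x i" if "i < n" for i
      proof -
        have "x i \<in> socle R g" using x that by (auto simp: socle_words_def PiE_iff)
        then show ?thesis using f_the_inv_into_f[OF inj] im by simp
      qed
      show "socle_lift n (\<lambda>i\<in>{..<n}. ?h (x i)) = x"
        using x hx by (intro extensionalityI[of _ "{..<n}"]) (auto simp: socle_lift_def socle_words_def PiE_iff)
    qed
    show "socle_lift n ` (F_words n) \<subseteq> socle_words R g n"
      using im by (auto simp: socle_lift_def socle_words_def PiE_iff)
    show "(\<lambda>x. \<lambda>i\<in>{..<n}. ?h (x i)) ` socle_words R g n \<subseteq> F_words n"
      using the_inv_into_into[OF inj] im by (auto simp: socle_words_def PiE_iff)
  qed
qed

lemma socle_lift_add:
  assumes v: "v \<in> F_words n" "w \<in> F_words n"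
  shows "socle_lift n (ring.vadd F n v w) = vadd n (socle_lift n v) (socle_lift n w)"
proof -
  interpret F: ring F by (rule F_ring)
  show ?thesis
  proof
    fix i
    show "socle_lift n (F.vadd n v w) i = vadd n (socle_lift n v) (socle_lift n w) i"
    proof (cases "i < n")
      case True
      then have "v i \<in> carrier F" "w i \<in> carrier F" using v by (auto simp: PiE_iff)
      then show ?thesis using True socle_iso_add by (simp add: socle_lift_def)
    qed (simp add: socle_lift_def vadd_def)
  qed
qed

lemma socle_lift_smul:
  assumes v: "v \<in> F_words n" and r: "r \<in> carrier R"
  shows "socle_lift n (ring.vsmul F n (J +> r) v) = vsmul n r (socle_lift n v)"
proof -
  interpret F: ring F by (rule F_ring)
  show ?thesis
  proof
    fix i
    show "socle_lift n (F.vsmul n (J +> r) v) i = vsmul n r (socle_lift n v) i"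
    proof (cases "i < n")
      case True
      then have "v i \<in> carrier F" using v by (auto simp: PiE_iff)
      then show ?thesis using True socle_iso_mult[OF r] by (simp add: socle_lift_def)
    qed (simp add: socle_lift_def vsmul_def)
  qed
qed

lemma socle_iso_zero: "socle_iso R g \<zero>\<^bsub>F\<^esub> = \<zero>"
proof -
  interpret F: ring F by (rule F_ring)
  have c: "socle_iso R g \<zero>\<^bsub>F\<^esub> \<in> carrier R"
    using socle_iso_bij socle_subset F.zero_closed by (auto simp: bij_betw_def)
  have "socle_iso R g \<zero>\<^bsub>F\<^esub> \<oplus> socle_iso R g \<zero>\<^bsub>F\<^esub> = socle_iso R g \<zero>\<^bsub>F\<^esub>"
    using socle_iso_add[OF F.zero_closed F.zero_closed] by simp
  then show ?thesis using c by (simp add: add.r_cancel_one)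
qed

lemma socle_iso_eq_zero: "a \<in> carrier F \<Longrightarrow> socle_iso R g a = \<zero> \<longleftrightarrow> a = \<zero>\<^bsub>F\<^esub>"
  using socle_iso_zero socle_iso_bij ring.ring_simprules(2)[OF F_ring]
  by (metis bij_betw_inv_into_left)

lemma socle_lift_zero: "socle_lift n (ring.vzero F n) = vzero n"
proof -
  interpret F: ring F by (rule F_ring)
  show ?thesis by (rule ext) (simp add: socle_lift_def F.vzero_def vzero_def socle_iso_zero)
qed

lemma socle_lift_weight:
  assumes v: "v \<in> F_words n"
  shows "hamming_weight R n (socle_lift n v) = hamming_weight F n v"
proof -
  have "{i. i < n \<and> socle_lift n v i \<noteq> \<zero>} = {i. i < n \<and> v i \<noteq> \<zero>\<^bsub>F\<^esub>}"
    using v socle_iso_eq_zero by (auto simp: socle_lift_def PiE_iff)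
  then show ?thesis by (simp add: hamming_weight_def)
qed

lemma linear_code_residue:
  assumes D: "linear_code R n D"
  shows "linear_code F n (residue_code R g n D)"
proof -
  interpret F: ring F by (rule F_ring)
  show ?thesis
    unfolding F.linear_code_iff residue_code_eq
  proof (intro conjI ballI)
    show "F.vzero n \<in> {v \<in> F.words n. socle_lift n v \<in> D}"
      using linear_code_zero[OF D] by (simp add: socle_lift_zero F.vzero_closed)
    fix v assume v: "v \<in> {v \<in> F.words n. socle_lift n v \<in> D}"
    show "F.vadd n v w \<in> {v \<in> F.words n. socle_lift n v \<in> D}" if "w \<in> {v \<in> F.words n. socle_lift n v \<in> D}" for w
      using v that F.vadd_closed linear_code_add[OF D] by (simp add: socle_lift_add)
    fix a assume a: "a \<in> carrier F"
    then obtain r where r: "r \<in> carrier R" "a = J +> r" by (auto simp: carrier_F)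
    then show "F.vsmul n a v \<in> {v \<in> F.words n. socle_lift n v \<in> D}"
      using v a F.vsmul_closed linear_code_smul[OF D r(1)] by (simp add: socle_lift_smul)
  qed blast
qed

lemma linear_code_lift:
  assumes E: "linear_code F n E"
  shows "linear_code R n (socle_lift n ` E)"
proof -
  interpret F: ring F by (rule F_ring)
  have EW: "E \<subseteq> F.words n" by (rule F.linear_code_words[OF E])
  show ?thesis
    unfolding linear_code_iff
  proof (intro conjI ballI)
    have "socle_lift n ` E \<subseteq> socle_words R g n" using EW bij_betwE[OF socle_lift_bij[of n]] by blast
    then show "socle_lift n ` E \<subseteq> words n" using socle_words_subset by blast
    show "vzero n \<in> socle_lift n ` E"
      using F.linear_code_zero[OF E] socle_lift_zero[of n] by (metis imageI)
    fix x assume "x \<in> socle_lift n ` E"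
    then obtain v where v: "v \<in> E" "x = socle_lift n v" by blast
    show "vadd n x y \<in> socle_lift n ` E" if y: "y \<in> socle_lift n ` E" for y
    proof -
      obtain w where w: "w \<in> E" "y = socle_lift n w" using y by blast
      have "vadd n x y = socle_lift n (F.vadd n v w)" using v w EW by (subst socle_lift_add) auto
      then show ?thesis using F.linear_code_add[OF E v(1) w(1)] by simp
    qed
    fix r assume r: "r \<in> carrier R"
    have "vsmul n r x = socle_lift n (F.vsmul n (J +> r) v)" using v r EW by (subst socle_lift_smul) auto
    moreover have "J +> r \<in> carrier F" using r by (auto simp: carrier_F)
    ultimately show "vsmul n r x \<in> socle_lift n ` E" using F.linear_code_smul[OF E _ v(1)] by simp
  qed
qed

lemma residue_code_bij:
  assumes "D \<subseteq> socle_words R g n"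
  shows "bij_betw (socle_lift n) (residue_code R g n D) D"
proof -
  have "socle_lift n ` residue_code R g n D = D"
    using assms socle_lift_bij[of n] by (auto simp: residue_code_eq bij_betw_def)
  moreover have "inj_on (socle_lift n) (residue_code R g n D)"
    using socle_lift_bij[of n] by (auto simp: residue_code_eq bij_betw_def intro: inj_on_subset)
  ultimately show ?thesis by (simp add: bij_betw_def)
qed

text \<open>\<open>socle_lift\<close> preserves size, zero and Hamming weight, so the MDS condition
  can be tested on the socle words themselves.\<close>

lemma socle_mds_code_iff:
  assumes D: "linear_code R n D" "D \<subseteq> socle_words R g n"
  shows "socle_mds_code R g n D \<longleftrightarrow>
    (\<exists>k. card D = q ^ k \<and> (\<forall>x\<in>D. x \<noteq> vzero n \<longrightarrow> n < k + hamming_weight R n x))"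
proof -
  interpret F: field F by (rule residue_field_field)
  let ?E = "residue_code R g n D"
  note bij = residue_code_bij[OF D(2)]
  have EW: "?E \<subseteq> F.words n" by (auto simp: residue_code_eq)
  have im: "socle_lift n ` ?E = D" using bij by (simp add: bij_betw_def)
  have card: "card D = card ?E" using bij_betw_same_card[OF bij] by simp
  have zero: "socle_lift n v = vzero n \<longleftrightarrow> v = F.vzero n" if "v \<in> ?E" for v
  proof -
    have "F.vzero n \<in> ?E" using F.linear_code_zero[OF linear_code_residue[OF D(1)]] .
    then show ?thesis using that bij socle_lift_zero[of n] by (metis bij_betw_inv_into_left)
  qed
  have "(\<forall>x\<in>D. x \<noteq> vzero n \<longrightarrow> n < k + hamming_weight R n x) \<longleftrightarrow>
      (\<forall>v\<in>?E. v \<noteq> F.vzero n \<longrightarrow> n < k + hamming_weight F n v)" for k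
  proof -
    have "(\<forall>x\<in>D. x \<noteq> vzero n \<longrightarrow> n < k + hamming_weight R n x) \<longleftrightarrow>
        (\<forall>v\<in>?E. socle_lift n v \<noteq> vzero n \<longrightarrow> n < k + hamming_weight R n (socle_lift n v))"
      by (subst im[symmetric]) (simp only: ball_simps)
    also have "\<dots> \<longleftrightarrow> (\<forall>v\<in>?E. v \<noteq> F.vzero n \<longrightarrow> n < k + hamming_weight F n v)"
    proof (rule ball_cong[OF refl])
      fix v assume v: "v \<in> ?E"
      then have "v \<in> F.words n" using EW by blast
      from socle_lift_weight[OF this] zero[OF v]
      show "(socle_lift n v \<noteq> vzero n \<longrightarrow> n < k + hamming_weight R n (socle_lift n v)) \<longleftrightarrow>
        (v \<noteq> F.vzero n \<longrightarrow> n < k + hamming_weight F n v)" by simp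
    qed
    finally show ?thesis .
  qed
  then show ?thesis
    using D by (simp add: socle_mds_code_def F.mds_code_iff[OF finite_F linear_code_residue[OF D(1)]] card card_F)
qed

end

section \<open>Criteria for MHD codes\<close>

context chain_ring_generator begin

abbreviation M where "M \<equiv> hom_max R g"

lemma M_eq: "M * (real q - 1) = real q" and M_ge_1: "1 \<le> M"
  using q_ge_2 by (auto simp: hom_max_def field_simps)

lemma linear_code_socle_part:
  "linear_code R n C \<Longrightarrow> linear_code R n (C \<inter> socle_words R g n)"
  by (rule linear_code_Int[OF _ linear_code_socle_words])

text \<open>The exponent in \<open>socle_mds_code_iff\<close> is forced to be the rank by
  \<open>card_socle_code\<close>.\<close>

lemma socle_mds_part_iff:
  assumes "linear_code R n C"
  shows "socle_mds_code R g n (C \<inter> socle_words R g n) \<longleftrightarrow>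
    (\<forall>x\<in>C \<inter> socle_words R g n. x \<noteq> vzero n \<longrightarrow> n < code_rank R n C + hamming_weight R n x)"
proof -
  have "card (C \<inter> socle_words R g n) = q ^ k \<longleftrightarrow> k = code_rank R n C" for k
    using card_socle_code[OF assms] q_ge_2 by (auto simp: power_inject_exp)
  then show ?thesis
    by (simp only: socle_mds_code_iff[OF linear_code_socle_part[OF assms] Int_lower2]) blast
qed

lemma hom_wt_zero: "hom_wt R g \<zero> = 0"
  and hom_wt_socle: "x \<in> socle R g \<Longrightarrow> x \<noteq> \<zero> \<Longrightarrow> hom_wt R g x = M"
  and hom_wt_nonsocle: "x \<notin> socle R g \<Longrightarrow> hom_wt R g x = 1"
  using socle_zero by (auto simp: hom_wt_def)

lemma hom_weight_socle:
  assumes "x \<in> socle_words R g n"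
  shows "hom_weight R g n x = M * real (hamming_weight R n x)"
proof -
  have "hom_weight R g n x = (\<Sum>i<n. if x i \<noteq> \<zero> then M else 0)"
    unfolding hom_weight_def
  proof (rule sum.cong[OF refl])
    fix i assume "i \<in> {..<n}"
    then have "x i \<in> socle R g" using assms by (simp add: socle_words_def PiE_iff)
    then show "hom_wt R g (x i) = (if x i \<noteq> \<zero> then M else 0)" by (simp add: hom_wt_zero hom_wt_socle)
  qed
  also have "\<dots> = (\<Sum>i\<in>{i \<in> {..<n}. x i \<noteq> \<zero>}. M)"
    by (rule sum.inter_filter[symmetric]) simp
  finally show ?thesis by (simp add: hamming_weight_def mult.commute)
qed

lemma hom_weight_ge: "real (hamming_weight R n x) \<le> hom_weight R g n x"
proof -
  have "real (hamming_weight R n x) = (\<Sum>i\<in>{i \<in> {..<n}. x i \<noteq> \<zero>}. 1)"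
    by (simp add: hamming_weight_def)
  also have "\<dots> = (\<Sum>i<n. if x i \<noteq> \<zero> then 1 else 0)"
    by (rule sum.inter_filter) simp
  also have "\<dots> \<le> hom_weight R g n x"
    unfolding hom_weight_def by (rule sum_mono) (use M_ge_1 in \<open>simp add: hom_wt_def\<close>)
  finally show ?thesis .
qed

lemma mhd_code_iff:
  assumes C: "linear_code R n C"
  shows "mhd_code R g n C \<longleftrightarrow>
    (\<forall>x\<in>C. x \<noteq> vzero n \<longrightarrow> M * (real n - real (code_rank R n C)) < hom_weight R g n x)"
proof (cases "C = {vzero n}")
  case True
  \<comment> \<open>The conventional distance of the zero code exceeds the bound whatever the rank,
    and there are no nonzero words to test.\<close>
  have "M * (real n - real (code_rank R n C)) < M * (real n + 1)"
    using M_ge_1 by (intro mult_strict_left_mono) auto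
  then show ?thesis using True C by (simp add: mhd_code_def hom_dist_def zero_code_eq)
next
  case False
  let ?W = "hom_weight R g n ` (C - {vzero n})"
  have "finite C" using finite_linear_code[OF finite_carrier C] .
  moreover have "C - {vzero n} \<noteq> {}" using False linear_code_zero[OF C] by blast
  ultimately have W: "finite ?W" "?W \<noteq> {}" by auto
  have "mhd_code R g n C \<longleftrightarrow> (\<forall>w\<in>?W. M * (real n - real (code_rank R n C)) < w)"
    using False C W by (simp add: mhd_code_def hom_dist_def zero_code_eq)
  then show ?thesis by (simp only: ball_simps) blast
qed

lemma mhd_imp_socle_mds:
  assumes C: "linear_code R n C" and mhd: "mhd_code R g n C"
  shows "socle_mds_code R g n (C \<inter> socle_words R g n)"
  unfolding socle_mds_part_iff[OF C]
proof (intro ballI impI)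
  fix x assume x: "x \<in> C \<inter> socle_words R g n" "x \<noteq> vzero n"
  then have "M * (real n - real (code_rank R n C)) < M * real (hamming_weight R n x)"
    using mhd mhd_code_iff[OF C] hom_weight_socle by auto
  then have "real n - real (code_rank R n C) < real (hamming_weight R n x)" using M_ge_1 by simp
  then show "n < code_rank R n C + hamming_weight R n x" by linarith
qed

lemma hom_weight_socle_mds:
  assumes C: "linear_code R n C" and mds: "socle_mds_code R g n (C \<inter> socle_words R g n)"
    and x: "x \<in> C \<inter> socle_words R g n" "x \<noteq> vzero n"
  shows "M * (real n - real (code_rank R n C)) < hom_weight R g n x"
proof -
  have "n < code_rank R n C + hamming_weight R n x" using mds x socle_mds_part_iff[OF C] by blast
  then have "real n - real (code_rank R n C) < real (hamming_weight R n x)" by linarith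
  then show ?thesis using hom_weight_socle[of x n] x M_ge_1 by simp
qed

lemma socle_mds_imp_mhd:
  assumes C: "linear_code R n C" "C \<subseteq> socle_words R g n" and mds: "socle_mds_code R g n C"
  shows "mhd_code R g n C"
proof -
  have "C \<inter> socle_words R g n = C" using C(2) by blast
  then show ?thesis using hom_weight_socle_mds[OF C(1)] mds mhd_code_iff[OF C(1)] by simp
qed

lemma vsmul_vsmul:
  assumes "a \<in> carrier R" "b \<in> carrier R" "x \<in> words n"
  shows "vsmul n a (vsmul n b x) = vsmul n (a \<otimes> b) x"
proof (rule words_eqI)
  show "vsmul n a (vsmul n b x) \<in> words n" "vsmul n (a \<otimes> b) x \<in> words n"
    using assms by (simp_all only: vsmul_closed m_closed)
  fix i assume i: "i < n"
  show "vsmul n a (vsmul n b x) i = vsmul n (a \<otimes> b) x i"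
    using i m_assoc[OF assms(1,2) words_coord[OF assms(3) i]] by simp
qed

lemma vsmul_one: "x \<in> words n \<Longrightarrow> vsmul n \<one> x = x"
  by (rule words_eqI[OF vsmul_closed]) (simp_all add: words_coord)

text \<open>The last power of \<open>g\<close> that does not kill \<open>c\<close> yields a nonzero
  word killed by \<open>g\<close>, that is, a socle word.\<close>

lemma power_into_socle:
  assumes c: "c \<in> words n" "c \<noteq> vzero n"
  obtains j where "vsmul n (g [^] (j::nat)) c \<noteq> vzero n" "vsmul n (g [^] j) c \<in> socle_words R g n"
proof -
  let ?P = "\<lambda>j::nat. vsmul n (g [^] j) c \<noteq> vzero n"
  have "\<exists>j. ?P j \<and> \<not> ?P (Suc j)"
  proof (rule ccontr)
    assume "\<not> (\<exists>j. ?P j \<and> \<not> ?P (Suc j))"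
    moreover have "?P 0" using vsmul_one[OF c(1)] c(2) by simp
    ultimately have "?P j" for j by (induction j) blast+
    then have "?P s" .
    moreover have "vsmul n (g [^] s) c = vzero n"
      by (rule words_eq_zeroI[OF vsmul_closed[OF _ c(1)]]) (simp_all add: g_pow_s words_coord[OF c(1)])
    ultimately show False by blast
  qed
  then obtain j where j: "?P j" "\<not> ?P (Suc j)" by blast
  have pc: "g [^] j \<in> carrier R" by simp
  have "vsmul n g (vsmul n (g [^] j) c) = vsmul n (g [^] Suc j) c"
    unfolding nat_pow_Suc2[OF g_closed] by (rule vsmul_vsmul[OF g_closed pc c(1)])
  then have "vsmul n (g [^] j) c \<in> socle_words R g n"
    using j(2) socle_words_iff[OF vsmul_closed[OF pc c(1)]] by simp
  then show thesis using j(1) that by blast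
qed

lemma hamming_weight_vsmul:
  assumes "a \<in> carrier R" "x \<in> words n"
  shows "hamming_weight R n (vsmul n a x) \<le> hamming_weight R n x"
  unfolding hamming_weight_def
proof (rule card_mono)
  show "{i. i < n \<and> vsmul n a x i \<noteq> \<zero>} \<subseteq> {i. i < n \<and> x i \<noteq> \<zero>}"
    using assms(1) by (auto simp: r_null)
qed simp

lemma socle_mds_high_rank_imp_mhd:
  assumes C: "linear_code R n C" and mds: "socle_mds_code R g n (C \<inter> socle_words R g n)"
    and K: "int (code_rank R n C) > int n - int q + 1"
  shows "mhd_code R g n C"
  unfolding mhd_code_iff[OF C]
proof (intro ballI impI)
  fix c assume c: "c \<in> C" "c \<noteq> vzero n"
  let ?K = "code_rank R n C"
  have cW: "c \<in> words n" using c linear_code_words[OF C] by blast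
  obtain j where j: "vsmul n (g [^] (j::nat)) c \<noteq> vzero n" "vsmul n (g [^] j) c \<in> socle_words R g n"
    using power_into_socle[OF cW c(2)] by blast
  have pc: "g [^] j \<in> carrier R" by simp
  have inC: "vsmul n (g [^] j) c \<in> C" by (rule linear_code_smul[OF C pc c(1)])
  show "M * (real n - real ?K) < hom_weight R g n c"
  proof (cases "c \<in> socle_words R g n")
    case True
    then show ?thesis using hom_weight_socle_mds[OF C mds] c by blast
  next
    case False
    have "n < ?K + hamming_weight R n (vsmul n (g [^] j) c)"
      using mds j inC socle_mds_part_iff[OF C] by blast
    then have "n < ?K + hamming_weight R n c" using hamming_weight_vsmul[OF pc cW] by linarith
    then have "real n - real ?K + 1 \<le> real (hamming_weight R n c)" by linarith
    moreover have "M * (real n - real ?K) < real n - real ?K + 1"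
    proof -
      have "real n - real ?K < real q - 1" using K by linarith
      moreover have q1: "0 < real q - 1" using q_ge_2 by simp
      ultimately have "(real n - real ?K) * real q < (real n - real ?K + 1) * (real q - 1)"
        by (simp add: algebra_simps)
      then show ?thesis using q1 by (simp add: hom_max_def field_simps)
    qed
    ultimately show ?thesis using hom_weight_ge[of n c] by linarith
  qed
qed

text \<open>The power of \<open>g\<close> is chosen for \<open>g c\<close> instead of
  \<open>c\<close>. The multiple \<open>d\<close> of \<open>c\<close> by it then lies just above the
  socle: \<open>g d\<close> is a nonzero socle word, so \<open>d\<close> is not one.\<close>

lemma exists_lowest_nonsocle:
  assumes C: "linear_code R n C" and c: "c \<in> C" "c \<notin> socle_words R g n"
  obtains d where "d \<in> C" "vsmul n g d \<noteq> vzero n" "vsmul n g d \<in> C \<inter> socle_words R g n"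
proof -
  have cW: "c \<in> words n" using c linear_code_words[OF C] by blast
  let ?c = "vsmul n g c"
  have "?c \<noteq> vzero n" using c(2) socle_words_iff[OF cW] by blast
  then obtain j where j: "vsmul n (g [^] (j::nat)) ?c \<noteq> vzero n" "vsmul n (g [^] j) ?c \<in> socle_words R g n"
    using power_into_socle[OF vsmul_closed[OF g_closed cW]] by blast
  have pc: "g [^] j \<in> carrier R" by simp
  have "vsmul n g (vsmul n (g [^] j) c) = vsmul n (g \<otimes> g [^] j) c" by (rule vsmul_vsmul[OF g_closed pc cW])
  also have "g \<otimes> g [^] j = g [^] j \<otimes> g" using nat_pow_Suc2[OF g_closed, of j] by simp
  also have "vsmul n (g [^] j \<otimes> g) c = vsmul n (g [^] j) ?c" by (rule vsmul_vsmul[OF pc g_closed cW, symmetric])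
  finally have eq: "vsmul n g (vsmul n (g [^] j) c) = vsmul n (g [^] j) ?c" .
  have "vsmul n (g [^] j) c \<in> C" by (rule linear_code_smul[OF C pc c(1)])
  moreover from this have "vsmul n g (vsmul n (g [^] j) c) \<in> C" by (rule linear_code_smul[OF C g_closed])
  ultimately show thesis using that[of "vsmul n (g [^] j) c"] j by (simp add: eq)
qed

lemma not_socle_of_smul:
  assumes "x \<in> words n" "i < n" "vsmul n g x i \<noteq> \<zero>"
  shows "x i \<notin> socle R g"
proof
  assume "x i \<in> socle R g"
  then have "g \<otimes> x i = \<zero>" using socle_annihilator by blast
  then show False using assms(2,3) by simp
qed

lemma hamming_weight_full:
  assumes "n \<le> hamming_weight R n x" "i < n" shows "x i \<noteq> \<zero>"
proof
  assume z: "x i = \<zero>"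
  have "{i. i < n \<and> x i \<noteq> \<zero>} \<subseteq> {..<n} - {i}" using z by auto
  then have "hamming_weight R n x \<le> card ({..<n} - {i})"
    unfolding hamming_weight_def by (rule card_mono[rotated]) simp
  then show False using assms by simp
qed

lemma hamming_weight_one_zero:
  assumes w: "n - 1 \<le> hamming_weight R n x" and i: "i < n" "j < n" "i \<noteq> j" "x i = \<zero>"
  shows "x j \<noteq> \<zero>"
proof
  assume z: "x j = \<zero>"
  have "{i. i < n \<and> x i \<noteq> \<zero>} \<subseteq> {..<n} - {i, j}" using z i by auto
  then have "hamming_weight R n x \<le> card ({..<n} - {i, j})"
    unfolding hamming_weight_def by (rule card_mono[rotated]) simp
  also have "\<dots> = n - 2" using i by (simp add: card_Diff_subset)
  finally show False using w i by linarith
qed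

text \<open>For \<open>d\<close> just above the socle, \<open>g d\<close> is a nonzero word of a
  one-dimensional MDS code and has no zero coordinate. So no coordinate of \<open>d\<close> lies in
  the socle, and \<open>d\<close> has homogeneous weight exactly \<open>n\<close>, which is at most
  \<open>M (n - 1)\<close> once \<open>n \<ge> q\<close>.\<close>

lemma mhd_rank_one_in_socle:
  assumes C: "linear_code R n C" and K: "code_rank R n C = 1" and n: "q \<le> n" and mhd: "mhd_code R g n C"
  shows "C \<subseteq> socle_words R g n"
proof
  fix c assume c: "c \<in> C"
  show "c \<in> socle_words R g n"
  proof (rule ccontr)
    assume "c \<notin> socle_words R g n"
    then obtain d where d: "d \<in> C" "vsmul n g d \<noteq> vzero n" "vsmul n g d \<in> C \<inter> socle_words R g n"
      using exists_lowest_nonsocle[OF C c] by blast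
    have dW: "d \<in> words n" using d linear_code_words[OF C] by blast
    have "n < 1 + hamming_weight R n (vsmul n g d)"
      using mhd_imp_socle_mds[OF C mhd] d socle_mds_part_iff[OF C] K by auto
    then have full: "n \<le> hamming_weight R n (vsmul n g d)" by simp
    have "hom_wt R g (d i) = 1" if "i < n" for i
      by (rule hom_wt_nonsocle, rule not_socle_of_smul[OF dW that], rule hamming_weight_full[OF full that])
    then have wt: "hom_weight R g n d = real n" by (simp add: hom_weight_def)
    have "d \<noteq> vzero n"
    proof
      assume "d = vzero n"
      then have "vsmul n g d = vzero n"
        by (intro words_eq_zeroI[OF vsmul_closed[OF g_closed dW]]) simp
      then show False using d by blast
    qed
    then have "M * (real n - 1) < real n" using mhd mhd_code_iff[OF C] d K wt by auto
    then have "real q * (real n - 1) < real n * (real q - 1)"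
      using q_ge_2 by (simp add: hom_max_def field_simps)
    then have "real n < real q" by (simp add: algebra_simps)
    then show False using n by simp
  qed
qed

text \<open>By interpolation \<open>q - 1\<close> nonzero words vanish at a given coordinate, and no
  nonzero word vanishes at two. Over the \<open>q + 1\<close> coordinates this accounts for
  \<open>q ^ 2 - 1\<close> words, so every nonzero word has a zero.\<close>

lemma mds_two_dim_has_zero:
  assumes D: "linear_code R n D" "D \<subseteq> socle_words R g n" "card D = q ^ 2" and n: "n = q + 1"
    and wt: "\<And>x. x \<in> D \<Longrightarrow> x \<noteq> vzero n \<Longrightarrow> n < 2 + hamming_weight R n x"
    and x: "x \<in> D" "x \<noteq> vzero n"
  obtains i where "i < n" "x i = \<zero>"
proof -
  have DW: "D \<subseteq> words n" by (rule linear_code_words[OF D(1)])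
  have finD: "finite D" by (rule finite_linear_code[OF finite_carrier D(1)])
  have finS: "finite (socle R g)" using finite_subset[OF socle_subset finite_carrier] .
  have zD: "vzero n \<in> D" by (rule linear_code_zero[OF D(1)])
  let ?Z = "\<lambda>i. {y \<in> D. y i = \<zero>} - {vzero n}"
  have cardZ: "card (?Z i) = q - 1" if i: "i < n" for i
  proof -
    obtain j where j: "j < n" "j \<noteq> i"
    proof -
      have "\<exists>j<n. j \<noteq> i" using n q_ge_2 by (intro exI[of _ "if i = 0 then 1 else 0"]) auto
      then show thesis using that by blast
    qed
    have ij: "{i, j} \<subseteq> {..<n}" "card {i, j} = 2" using i j by auto
    have bij: "bij_betw (\<lambda>x. restrict x {i, j}) D ({i, j} \<rightarrow>\<^sub>E socle R g)"
      by (rule code_interpolation[OF D(1) wt ij _ finS]) (use D card_socle in \<open>simp_all add: socle_words_def\<close>)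
    \<comment> \<open>Prescribing zero at \<open>i\<close> leaves the value at \<open>j\<close> free
      in the socle, and the two values determine the word.\<close>
    have "bij_betw (\<lambda>y. y j) {y \<in> D. y i = \<zero>} (socle R g)"
      unfolding bij_betw_def
    proof
      show "inj_on (\<lambda>y. y j) {y \<in> D. y i = \<zero>}"
      proof (rule inj_onI)
        fix y z assume yz: "y \<in> {y \<in> D. y i = \<zero>}" "z \<in> {y \<in> D. y i = \<zero>}" "y j = z j"
        then have "restrict y {i, j} = restrict z {i, j}" by (intro restrict_ext) auto
        then show "y = z" using bij yz unfolding bij_betw_def inj_on_def by blast
      qed
      show "(\<lambda>y. y j) ` {y \<in> D. y i = \<zero>} = socle R g"
      proof (intro subset_antisym subsetI)
        fix a assume "a \<in> (\<lambda>y. y j) ` {y \<in> D. y i = \<zero>}"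
        then obtain y where y: "y \<in> D" "a = y j" by blast
        then have "y \<in> socle_words R g n" using D(2) by blast
        then show "a \<in> socle R g" using y j by (simp add: socle_words_def PiE_iff)
      next
        fix a assume a: "a \<in> socle R g"
        let ?f = "\<lambda>k\<in>{i, j}. if k = j then a else \<zero>"
        have "?f \<in> {i, j} \<rightarrow>\<^sub>E socle R g" using a socle_zero by simp
        then have "?f \<in> (\<lambda>x. restrict x {i, j}) ` D" by (simp only: bij_betw_imp_surj_on[OF bij])
        then obtain y where y: "?f = restrict y {i, j}" "y \<in> D" by (rule imageE)
        have "y i = \<zero>" "y j = a" using fun_cong[OF y(1), of i] fun_cong[OF y(1), of j] j(2) by simp_all
        then show "a \<in> (\<lambda>y. y j) ` {y \<in> D. y i = \<zero>}" using y by blast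
      qed
    qed
    then have "card {y \<in> D. y i = \<zero>} = q" by (simp only: bij_betw_same_card card_socle)
    moreover have "vzero n \<in> {y \<in> D. y i = \<zero>}" using zD i by simp
    ultimately show ?thesis using finD by (simp add: card_Diff_singleton)
  qed
  have "card (\<Union>i\<in>{..<n}. ?Z i) = (\<Sum>i\<in>{..<n}. card (?Z i))"
  proof (rule card_UN_disjoint)
    show "\<forall>i\<in>{..<n}. \<forall>j\<in>{..<n}. i \<noteq> j \<longrightarrow> ?Z i \<inter> ?Z j = {}"
    proof (intro ballI impI)
      fix i j assume ij: "i \<in> {..<n}" "j \<in> {..<n}" "i \<noteq> j"
      have False if y: "y \<in> D" "y i = \<zero>" "y j = \<zero>" "y \<noteq> vzero n" for y
      proof -
        have "n - 1 \<le> hamming_weight R n y" using wt[OF y(1,4)] by simp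
        then show False using hamming_weight_one_zero[of n y i j] ij y by simp
      qed
      then show "?Z i \<inter> ?Z j = {}" by blast
    qed
  qed (use finD in auto)
  also have "\<dots> = n * (q - 1)" using cardZ by simp
  also have "\<dots> = card (D - {vzero n})"
  proof -
    have "card (D - {vzero n}) = q ^ 2 - 1" using D(3) zD finD by (simp add: card_Diff_singleton)
    also have "\<dots> = n * (q - 1)" using q_ge_2 by (simp add: n power2_eq_square algebra_simps)
    finally show ?thesis by simp
  qed
  finally have "(\<Union>i\<in>{..<n}. ?Z i) = D - {vzero n}"
    using finD by (intro card_subset_eq) auto
  then have "x \<in> (\<Union>i\<in>{..<n}. ?Z i)" using x by simp
  then show thesis using that by blast
qed

text \<open>Here \<open>g d\<close> has exactly one zero coordinate \<open>i\<close>, so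
  \<open>d i\<close> is a socle element and no other coordinate of \<open>d\<close> is. Adding a
  word of the socle part with entry \<open>\<ominus> d i\<close> at \<open>i\<close> clears this
  coordinate and leaves weight \<open>q = M (n - 2)\<close>, which does not exceed the MHD
  bound.\<close>

lemma mhd_rank_two_in_socle:
  assumes C: "linear_code R n C" and K: "code_rank R n C = 2" and n: "n = q + 1" and mhd: "mhd_code R g n C"
  shows "C \<subseteq> socle_words R g n"
proof
  fix c assume c: "c \<in> C"
  show "c \<in> socle_words R g n"
  proof (rule ccontr)
    assume "c \<notin> socle_words R g n"
    then obtain d where d: "d \<in> C" "vsmul n g d \<noteq> vzero n" "vsmul n g d \<in> C \<inter> socle_words R g n"
      using exists_lowest_nonsocle[OF C c] by blast
    let ?D = "C \<inter> socle_words R g n"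
    have dW: "d \<in> words n" using d linear_code_words[OF C] by blast
    have D: "linear_code R n ?D" by (rule linear_code_socle_part[OF C])
    have cardD: "card ?D = q ^ 2" using card_socle_code[OF C] K by simp
    have finS: "finite (socle R g)" using finite_subset[OF socle_subset finite_carrier] .
    have wt: "n < 2 + hamming_weight R n x" if "x \<in> ?D" "x \<noteq> vzero n" for x
      using mhd_imp_socle_mds[OF C mhd] that socle_mds_part_iff[OF C] K by auto
    obtain i where i: "i < n" "vsmul n g d i = \<zero>"
      using mds_two_dim_has_zero[OF D Int_lower2 cardD n wt d(3,2)] by blast
    have "d i \<in> socle R g" using i words_coord[OF dW i(1)] socle_annihilator by simp
    then have nd: "\<ominus> d i \<in> socle R g" by (rule socle_neg)
    obtain j where j: "j < n" "j \<noteq> i"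
    proof -
      have "\<exists>j<n. j \<noteq> i" using n q_ge_2 by (intro exI[of _ "if i = 0 then 1 else 0"]) auto
      then show thesis using that by blast
    qed
    have ij: "{i, j} \<subseteq> {..<n}" "card {i, j} = 2" using i j by auto
    have bij: "bij_betw (\<lambda>x. restrict x {i, j}) ?D ({i, j} \<rightarrow>\<^sub>E socle R g)"
      by (rule code_interpolation[OF D wt ij _ finS]) (use cardD card_socle in \<open>auto simp: socle_words_def\<close>)
    \<comment> \<open>Two coordinates must be prescribed to interpolate; the entry at
      \<open>i\<close> does the work, and the entry at \<open>j\<close> may be any socle
      element.\<close>
    have "(\<lambda>k\<in>{i, j}. \<ominus> d i) \<in> {i, j} \<rightarrow>\<^sub>E socle R g" using nd by simp
    then have "(\<lambda>k\<in>{i, j}. \<ominus> d i) \<in> (\<lambda>x. restrict x {i, j}) ` ?D"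
      by (simp only: bij_betw_imp_surj_on[OF bij])
    then obtain y where y': "(\<lambda>k\<in>{i, j}. \<ominus> d i) = restrict y {i, j}" and y: "y \<in> ?D" by (rule imageE)
    have yi: "y i = \<ominus> d i" using fun_cong[OF y', of i] by simp
    have yW: "y \<in> words n" using y linear_code_words[OF C] by blast
    let ?c = "vadd n d y"
    have cW: "?c \<in> words n" by (rule vadd_closed[OF dW yW])
    have ci: "?c i = \<zero>" using i yi words_coord[OF dW i(1)] by (simp add: r_neg)
    \<comment> \<open>Socle words are killed by \<open>g\<close>, so the correction leaves
      \<open>g d\<close> unchanged, and nonzero coordinates of \<open>g d\<close> still mark
      coordinates outside the socle.\<close>
    have gc: "vsmul n g ?c = vsmul n g d"
      using vsmul_vadd[OF g_closed dW yW] socle_words_iff[OF yW] y vadd_zero[OF vsmul_closed[OF g_closed dW]] by simp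
    have w: "n - 1 \<le> hamming_weight R n (vsmul n g d)" using wt[OF d(3,2)] by simp
    have ck: "hom_wt R g (?c k) = 1" if k: "k < n" "k \<noteq> i" for k
    proof (rule hom_wt_nonsocle, rule not_socle_of_smul[OF cW k(1)])
      show "vsmul n g ?c k \<noteq> \<zero>"
        unfolding gc by (rule hamming_weight_one_zero[OF w i(1) k(1) k(2)[symmetric] i(2)])
    qed
    have "hom_weight R g n ?c = hom_wt R g (?c i) + (\<Sum>k\<in>{..<n} - {i}. hom_wt R g (?c k))"
      unfolding hom_weight_def using i(1) by (intro sum.remove) auto
    also have "\<dots> = (\<Sum>k\<in>{..<n} - {i}. 1)"
      using ck by (simp add: ci hom_wt_zero)
    also have "\<dots> = real q" using i(1) n by simp
    finally have wtc: "hom_weight R g n ?c = real q" .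
    have "?c \<noteq> vzero n"
    proof
      assume "?c = vzero n"
      then have "hom_wt R g (?c j) = 0" using j by (simp add: hom_wt_zero)
      then show False using ck[OF j] by simp
    qed
    moreover have "?c \<in> C" using linear_code_add[OF C d(1)] y by blast
    ultimately have "M * (real n - 2) < real q" using mhd mhd_code_iff[OF C] K wtc by auto
    then show False using M_eq n by (simp add: algebra_simps)
  qed
qed

text \<open>Rank 0 leaves only the zero word, and for rank \<open>n\<close> the bound is 0, which
  every nonzero word exceeds.\<close>

lemma mhd_extremal_rank:
  assumes C: "linear_code R n C" and K: "code_rank R n C = 0 \<or> code_rank R n C = n"
  shows "mhd_code R g n C"
  unfolding mhd_code_iff[OF C]
proof (intro ballI impI)
  fix c assume c: "c \<in> C" "c \<noteq> vzero n"
  have cW: "c \<in> words n" using c linear_code_words[OF C] by blast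
  obtain S where S: "S \<subseteq> C" "finite S" "card S = code_rank R n C" "linear_code R n hull S = C"
    using code_rank_generators[OF finite_carrier C] by blast
  have "code_rank R n C \<noteq> 0"
  proof
    assume "code_rank R n C = 0"
    then have "S = {}" using S by simp
    then have "C = {vzero n}" using S(4) hull_eq_combos[of "{}" n] by (auto simp: combo_empty)
    then show False using c by blast
  qed
  with K have K: "code_rank R n C = n" by simp
  have "\<not> (\<forall>i<n. c i = \<zero>)" using words_eq_zeroI[OF cW] c(2) by blast
  then have "hamming_weight R n c \<noteq> 0" by (auto simp: hamming_weight_def)
  then show "M * (real n - real (code_rank R n C)) < hom_weight R g n c"
    using hom_weight_ge[of n c] K by simp
qed

end

section \<open>Transfer of the MDS conjecture\<close>

context field begin

text \<open>The conjecture speaks about fields on natural numbers. A finite carrier embeds into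
  \<open>nat\<close>, and the coordinatewise image of the code over the image field keeps size, zero
  and weights, hence dimension and the MDS property.\<close>

lemma mds_conjecture_bound:
  assumes conj: "mds_conjecture" and fin: "finite (carrier R)" and n: "n \<ge> 1"
    and E: "linear_code R n E" and mds: "mds_code R n E" and k: "code_dim R n E = k" "k \<notin> {0, 1, n - 1, n}"
  shows "if even (card (carrier R)) \<and> (k = 3 \<or> k = card (carrier R) - 1)
    then n \<le> card (carrier R) + 2 else n \<le> card (carrier R) + 1"
proof -
  let ?Q = "card (carrier R)"
  obtain h :: "'a \<Rightarrow> nat" where h: "inj_on h (carrier R)"
    using finite_imp_inj_to_nat_seg[OF fin] by blast
  define G where "G = image_ring h R"
  interpret G: field G unfolding G_def by (rule inj_imp_image_ring_is_field[OF h])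
  have iso: "h \<in> ring_iso R G" unfolding G_def by (rule inj_imp_image_ring_iso[OF h])
  note hom = ring_iso_memE[OF iso]
  have h0: "h \<zero> = \<zero>\<^bsub>G\<^esub>" by (simp add: G_def image_ring_zero)
  have carG: "carrier G = h ` carrier R" by (simp add: G_def image_ring_carrier)
  have cardG: "card (carrier G) = ?Q" using h by (simp add: carG card_image)
  have finG: "finite (carrier G)" using fin by (simp add: carG)
  define f where "f x = (\<lambda>i\<in>{..<n}. h (x i))" for x
  have EW: "E \<subseteq> words n" by (rule linear_code_words[OF E])
  have f_apply: "f x i = h (x i)" if "i < n" for x i using that by (simp add: f_def)
  have f_closed: "f x \<in> G.words n" if x: "x \<in> words n" for x
    unfolding f_def using words_coord[OF x] hom(1) by (simp add: PiE_iff)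
  have f_inj: "inj_on f E"
  proof (rule inj_onI)
    fix x y assume xy: "x \<in> E" "y \<in> E" "f x = f y"
    have W: "x \<in> words n" "y \<in> words n" using xy EW by blast+
    show "x = y"
    proof (rule words_eqI[OF W])
      fix i assume i: "i < n"
      have "h (x i) = h (y i)" using xy(3) f_apply[OF i, of x] f_apply[OF i, of y] by simp
      then show "x i = y i" using h words_coord[OF W(1) i] words_coord[OF W(2) i] by (simp add: inj_on_eq_iff)
    qed
  qed
  have f_zero: "f (vzero n) = G.vzero n"
    by (rule G.words_eqI[OF f_closed[OF vzero_closed] G.vzero_closed]) (simp add: f_apply h0)
  have f_add: "f (vadd n x y) = G.vadd n (f x) (f y)" if xy: "x \<in> words n" "y \<in> words n" for x y
    by (rule G.words_eqI[OF f_closed[OF vadd_closed[OF xy]] G.vadd_closed[OF f_closed[OF xy(1)] f_closed[OF xy(2)]]])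
      (simp add: f_apply hom(3) words_coord[OF xy(1)] words_coord[OF xy(2)])
  have f_smul: "f (vsmul n r x) = G.vsmul n (h r) (f x)" if rx: "r \<in> carrier R" "x \<in> words n" for r x
    by (rule G.words_eqI[OF f_closed[OF vsmul_closed[OF rx]] G.vsmul_closed[OF hom(1)[OF rx(1)] f_closed[OF rx(2)]]])
      (simp add: f_apply hom(2) rx(1) words_coord[OF rx(2)])
  have f_weight: "hamming_weight G n (f x) = hamming_weight R n x" if x: "x \<in> words n" for x
  proof -
    have "f x i = \<zero>\<^bsub>G\<^esub> \<longleftrightarrow> x i = \<zero>" if i: "i < n" for i
      using h words_coord[OF x i] by (simp add: f_apply[OF i] h0[symmetric] inj_on_eq_iff)
    then have "{i. i < n \<and> f x i \<noteq> \<zero>\<^bsub>G\<^esub>} = {i. i < n \<and> x i \<noteq> \<zero>}" by blast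
    then show ?thesis by (simp add: hamming_weight_def)
  qed
  have E': "linear_code G n (f ` E)"
    unfolding G.linear_code_iff
  proof (intro conjI ballI)
    show "f ` E \<subseteq> G.words n" using EW f_closed by blast
    show "G.vzero n \<in> f ` E" using linear_code_zero[OF E] f_zero by (metis imageI)
    fix u assume "u \<in> f ` E"
    then obtain x where x: "u = f x" "x \<in> E" by (rule imageE)
    have xW: "x \<in> words n" using x EW by blast
    show "G.vadd n u v \<in> f ` E" if v: "v \<in> f ` E" for v
    proof -
      obtain y where y: "v = f y" "y \<in> E" using v by (rule imageE)
      have yW: "y \<in> words n" using y(2) EW by blast
      have "G.vadd n u v = f (vadd n x y)" unfolding x(1) y(1) by (rule f_add[OF xW yW, symmetric])
      then show ?thesis using linear_code_add[OF E x(2) y(2)] by simp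
    qed
    fix a assume "a \<in> carrier G"
    then obtain r where r: "a = h r" "r \<in> carrier R" unfolding carG by (rule imageE)
    have "G.vsmul n a u = f (vsmul n r x)" unfolding x(1) r(1) by (rule f_smul[OF r(2) xW, symmetric])
    then show "G.vsmul n a u \<in> f ` E" using linear_code_smul[OF E r(2) x(2)] by simp
  qed
  have cardE: "card E = ?Q ^ k" using code_dim_iff[OF fin E, of k] k(1) by blast
  have wt: "\<forall>x\<in>E. x \<noteq> vzero n \<longrightarrow> n < k + hamming_weight R n x"
  proof -
    obtain l where l: "card E = ?Q ^ l" "\<forall>x\<in>E. x \<noteq> vzero n \<longrightarrow> n < l + hamming_weight R n x"
      using mds unfolding mds_code_iff[OF fin E] by blast
    have "l = k" using l(1) code_dim_iff[OF fin E, of l] k(1) by blast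
    then show ?thesis using l(2) by simp
  qed
  have cardE': "card (f ` E) = card (carrier G) ^ k" using cardE by (simp add: card_image[OF f_inj] cardG)
  have "\<forall>u\<in>f ` E. u \<noteq> G.vzero n \<longrightarrow> n < k + hamming_weight G n u"
  proof (intro ballI impI)
    fix u assume "u \<in> f ` E" and nz: "u \<noteq> G.vzero n"
    then obtain x where x: "u = f x" "x \<in> E" by (blast elim: imageE)
    then have "x \<noteq> vzero n" using nz f_zero by blast
    then show "n < k + hamming_weight G n u" using wt x f_weight[of x] EW by auto
  qed
  then have mds': "mds_code G n (f ` E)"
    unfolding G.mds_code_iff[OF finG E'] using cardE' by blast
  have dim': "code_dim G n (f ` E) = k" using G.code_dim_iff[OF finG E', of k] cardE' by simp
  show ?thesis
    using conj[unfolded mds_conjecture_def, rule_format, of G n "f ` E"] G.field_axioms finG n mds' k(2)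
    by (simp only: Let_def dim' cardG simp_thms)
qed

end

section \<open>Parity check and hyperoval codes\<close>

context field begin

text \<open>Code with information set \<open>I\<close>; the row \<open>A j\<close> expresses the
  check coordinate \<open>j\<close> through the entries in \<open>I\<close>. Linearity and size come
  for free in this form, so only weights depend on the choice of \<open>A\<close>.\<close>

definition systematic_code :: "nat \<Rightarrow> nat set \<Rightarrow> (nat \<Rightarrow> nat \<Rightarrow> 'a) \<Rightarrow> (nat \<Rightarrow> 'a) set" where
  "systematic_code n I A = {x \<in> words n. \<forall>j\<in>{..<n} - I. x j = (\<Oplus>i\<in>I. A j i \<otimes> x i)}"

lemma systematic_code_words: "systematic_code n I A \<subseteq> words n"
  by (auto simp: systematic_code_def)

lemma finsum_prod_add:
  assumes a: "a \<in> I \<rightarrow> carrier R" and x: "x \<in> I \<rightarrow> carrier R" and y: "y \<in> I \<rightarrow> carrier R"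
  shows "(\<Oplus>i\<in>I. a i \<otimes> (x i \<oplus> y i)) = (\<Oplus>i\<in>I. a i \<otimes> x i) \<oplus> (\<Oplus>i\<in>I. a i \<otimes> y i)"
proof -
  have "(\<Oplus>i\<in>I. a i \<otimes> (x i \<oplus> y i)) = (\<Oplus>i\<in>I. a i \<otimes> x i \<oplus> a i \<otimes> y i)"
    by (rule finsum_cong') (use a x y in \<open>auto simp: Pi_iff r_distr\<close>)
  also have "\<dots> = (\<Oplus>i\<in>I. a i \<otimes> x i) \<oplus> (\<Oplus>i\<in>I. a i \<otimes> y i)"
    by (rule finsum_addf) (use a x y in \<open>auto simp: Pi_iff\<close>)
  finally show ?thesis .
qed

lemma finsum_prod_smul:
  assumes I: "finite I" and a: "a \<in> I \<rightarrow> carrier R" and x: "x \<in> I \<rightarrow> carrier R" and r: "r \<in> carrier R"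
  shows "(\<Oplus>i\<in>I. a i \<otimes> (r \<otimes> x i)) = r \<otimes> (\<Oplus>i\<in>I. a i \<otimes> x i)"
proof -
  have "(\<Oplus>i\<in>I. a i \<otimes> (r \<otimes> x i)) = (\<Oplus>i\<in>I. r \<otimes> (a i \<otimes> x i))"
    by (rule finsum_cong') (use a x r in \<open>auto simp: Pi_iff m_lcomm\<close>)
  also have "\<dots> = r \<otimes> (\<Oplus>i\<in>I. a i \<otimes> x i)"
    by (rule finsum_rdistr[symmetric]) (use I a x r in \<open>auto simp: Pi_iff\<close>)
  finally show ?thesis .
qed

lemma systematic_code:
  assumes fin: "finite (carrier R)" and I: "I \<subseteq> {..<n}"
    and A: "\<And>j i. j \<in> {..<n} - I \<Longrightarrow> i \<in> I \<Longrightarrow> A j i \<in> carrier R"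
  shows "linear_code R n (systematic_code n I A)"
    "card (systematic_code n I A) = card (carrier R) ^ card I"
proof -
  have finI: "finite I" using I finite_subset by blast
  have AI: "A j \<in> I \<rightarrow> carrier R" if "j \<in> {..<n} - I" for j using A[OF that] by blast
  have xI: "x \<in> I \<rightarrow> carrier R" if "x \<in> words n" for x using words_coord[OF that] I by blast
  have in_n: "i < n" if "i \<in> I" for i using that I by blast
  show "linear_code R n (systematic_code n I A)"
    unfolding linear_code_iff
  proof (intro conjI ballI)
    show "systematic_code n I A \<subseteq> words n" by (rule systematic_code_words)
    have "vzero n j = (\<Oplus>i\<in>I. A j i \<otimes> vzero n i)" if j: "j \<in> {..<n} - I" for j
    proof -
      have "(\<Oplus>i\<in>I. A j i \<otimes> vzero n i) = (\<Oplus>i\<in>I. \<zero>)"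
        by (rule finsum_cong') (use A[OF j] in_n in auto)
      then show ?thesis using j by simp
    qed
    then show "vzero n \<in> systematic_code n I A" by (simp only: systematic_code_def mem_Collect_eq vzero_closed) blast
    fix x assume "x \<in> systematic_code n I A"
    then have x: "x \<in> words n" "\<And>j. j \<in> {..<n} - I \<Longrightarrow> x j = (\<Oplus>i\<in>I. A j i \<otimes> x i)"
      by (simp_all add: systematic_code_def)
    show "vadd n x y \<in> systematic_code n I A" if "y \<in> systematic_code n I A" for y
    proof -
      have y: "y \<in> words n" "\<And>j. j \<in> {..<n} - I \<Longrightarrow> y j = (\<Oplus>i\<in>I. A j i \<otimes> y i)"
        using that by (simp_all add: systematic_code_def)
      have "vadd n x y j = (\<Oplus>i\<in>I. A j i \<otimes> vadd n x y i)" if j: "j \<in> {..<n} - I" for j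
      proof -
        have "(\<Oplus>i\<in>I. A j i \<otimes> vadd n x y i) = (\<Oplus>i\<in>I. A j i \<otimes> (x i \<oplus> y i))"
          by (rule finsum_cong') (use A[OF j] in_n words_coord[OF x(1)] words_coord[OF y(1)] in auto)
        also have "\<dots> = x j \<oplus> y j"
          using finsum_prod_add[OF AI[OF j] xI[OF x(1)] xI[OF y(1)]] x(2)[OF j] y(2)[OF j] by simp
        finally show ?thesis using j by simp
      qed
      then show ?thesis using vadd_closed[OF x(1) y(1)] by (simp only: systematic_code_def mem_Collect_eq) blast
    qed
    fix r assume r: "r \<in> carrier R"
    have "vsmul n r x j = (\<Oplus>i\<in>I. A j i \<otimes> vsmul n r x i)" if j: "j \<in> {..<n} - I" for j
    proof -
      have "(\<Oplus>i\<in>I. A j i \<otimes> vsmul n r x i) = (\<Oplus>i\<in>I. A j i \<otimes> (r \<otimes> x i))"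
        by (rule finsum_cong') (use A[OF j] in_n r words_coord[OF x(1)] in auto)
      also have "\<dots> = r \<otimes> x j"
        using finsum_prod_smul[OF finI AI[OF j] xI[OF x(1)] r] x(2)[OF j] by simp
      finally show ?thesis using j by simp
    qed
    then show "vsmul n r x \<in> systematic_code n I A"
      using vsmul_closed[OF r x(1)] by (simp only: systematic_code_def mem_Collect_eq) blast
  qed
  \<comment> \<open>Appending the check coordinates inverts restriction to \<open>I\<close>, so the
    entries in \<open>I\<close> are arbitrary.\<close>
  let ?ext = "\<lambda>f. \<lambda>j\<in>{..<n}. if j \<in> I then f j else (\<Oplus>i\<in>I. A j i \<otimes> f i)"
  have "bij_betw (\<lambda>x. restrict x I) (systematic_code n I A) (I \<rightarrow>\<^sub>E carrier R)"
  proof (rule bij_betw_byWitness[where f' = ?ext])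
    show "\<forall>x\<in>systematic_code n I A. ?ext (restrict x I) = x"
    proof
      fix x assume "x \<in> systematic_code n I A"
      then have x: "x \<in> words n" "\<And>j. j \<in> {..<n} - I \<Longrightarrow> x j = (\<Oplus>i\<in>I. A j i \<otimes> x i)"
        by (simp_all add: systematic_code_def)
      have c: "(\<Oplus>i\<in>I. A j i \<otimes> restrict x I i) = x j" if j: "j \<in> {..<n} - I" for j
        unfolding x(2)[OF j]
        by (rule finsum_cong') (use A[OF j] xI[OF x(1)] in auto)
      show "?ext (restrict x I) = x"
      proof
        fix j
        show "?ext (restrict x I) j = x j"
        proof (cases "j < n")
          case True
          then show ?thesis using c[of j] by (cases "j \<in> I") simp_all
        next
          case False
          then show ?thesis using x(1) by (simp add: PiE_iff extensional_def)
        qed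
      qed
    qed
    show "\<forall>f\<in>I \<rightarrow>\<^sub>E carrier R. restrict (?ext f) I = f"
    proof
      fix f assume f: "f \<in> I \<rightarrow>\<^sub>E carrier R"
      show "restrict (?ext f) I = f"
      proof
        fix j show "restrict (?ext f) I j = f j"
          using f in_n[of j] by (cases "j \<in> I") (simp_all add: PiE_iff extensional_def)
      qed
    qed
    show "(\<lambda>x. restrict x I) ` systematic_code n I A \<subseteq> I \<rightarrow>\<^sub>E carrier R"
    proof (rule image_subsetI)
      fix x assume "x \<in> systematic_code n I A"
      then have "x \<in> I \<rightarrow> carrier R" by (intro xI) (simp add: systematic_code_def)
      then show "restrict x I \<in> I \<rightarrow>\<^sub>E carrier R" by simp
    qed
    show "?ext ` (I \<rightarrow>\<^sub>E carrier R) \<subseteq> systematic_code n I A"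
    proof (rule image_subsetI)
      fix f assume "f \<in> I \<rightarrow>\<^sub>E carrier R"
      then have f: "f i \<in> carrier R" if "i \<in> I" for i using that by (simp add: PiE_iff)
      have sum: "(\<Oplus>i\<in>I. A j i \<otimes> f i) \<in> carrier R" if "j \<in> {..<n} - I" for j
        by (rule finsum_closed) (use A[OF that] f in auto)
      have W: "?ext f \<in> words n" using f sum by simp
      have "?ext f j = (\<Oplus>i\<in>I. A j i \<otimes> ?ext f i)" if j: "j \<in> {..<n} - I" for j
      proof -
        have "(\<Oplus>i\<in>I. A j i \<otimes> ?ext f i) = (\<Oplus>i\<in>I. A j i \<otimes> f i)"
          by (rule finsum_cong') (use A[OF j] f in_n in auto)
        then show ?thesis using j by simp
      qed
      then show "?ext f \<in> systematic_code n I A" using W by (simp only: systematic_code_def mem_Collect_eq) blast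
    qed
  qed
  then have "card (systematic_code n I A) = card (I \<rightarrow>\<^sub>E carrier R)" by (rule bij_betw_same_card)
  then show "card (systematic_code n I A) = card (carrier R) ^ card I"
    using finI by (simp add: card_PiE)
qed

lemma finsum_delta:
  assumes "finite I" "i0 \<in> I" "f i0 \<in> carrier R" "\<And>i. i \<in> I \<Longrightarrow> i \<noteq> i0 \<Longrightarrow> f i = \<zero>"
  shows "(\<Oplus>i\<in>I. f i) = f i0"
proof -
  have f: "f i \<in> carrier R" if "i \<in> I" for i using assms that by (cases "i = i0") auto
  have "(\<Oplus>i\<in>I. f i) = (\<Oplus>i\<in>I. if i = i0 then f i else \<zero>)"
    by (rule finsum_cong') (use assms f in auto)
  also have "\<dots> = f i0"
    by (rule add.finprod_singleton_swap) (use assms f in auto)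
  finally show ?thesis .
qed

text \<open>The last coordinate is the sum of the others, so no word has exactly one nonzero
  coordinate. Weight at least 2 is what dimension \<open>n - 1\<close> requires.\<close>

lemma parity_code:
  assumes fin: "finite (carrier R)" and n: "2 \<le> n"
  obtains E where "linear_code R n E" "card E = card (carrier R) ^ (n - 1)"
    "\<And>x. x \<in> E \<Longrightarrow> x \<noteq> vzero n \<Longrightarrow> n < n - 1 + hamming_weight R n x"
proof -
  let ?I = "{..<n - 1}"
  let ?E = "systematic_code n ?I (\<lambda>_ _. \<one>)"
  have I: "?I \<subseteq> {..<n}" by auto
  note sys = systematic_code[OF fin I, of "\<lambda>_ _. \<one>", OF one_closed]
  have "n < n - 1 + hamming_weight R n x" if x: "x \<in> ?E" "x \<noteq> vzero n" for x
  proof (rule ccontr)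
    assume "\<not> ?thesis"
    then have le: "card {i. i < n \<and> x i \<noteq> \<zero>} \<le> 1" using n by (simp add: hamming_weight_def)
    have xW: "x \<in> words n" and last: "x (n - 1) = (\<Oplus>i\<in>?I. \<one> \<otimes> x i)"
      using x(1) n by (simp_all add: systematic_code_def)
    obtain i0 where i0: "i0 < n" "x i0 \<noteq> \<zero>" using words_eq_zeroI[OF xW] x(2) by blast
    have uniq: "i = i0" if "i < n" "x i \<noteq> \<zero>" for i
      using le i0 that card_le_Suc0_iff_eq[of "{i. i < n \<and> x i \<noteq> \<zero>}"] by auto
    show False
    proof (cases "i0 = n - 1")
      case True
      have "x i = \<zero>" if "i \<in> ?I" for i
      proof -
        have "i < n" "i \<noteq> i0" using that True by auto
        then show ?thesis using uniq[of i] by blast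
      qed
      then have "(\<Oplus>i\<in>?I. \<one> \<otimes> x i) = (\<Oplus>i\<in>?I. \<zero>)" by (intro finsum_cong') auto
      then show False using last i0 True by simp
    next
      case False
      have "(\<Oplus>i\<in>?I. \<one> \<otimes> x i) = \<one> \<otimes> x i0"
      proof (rule finsum_delta)
        show "i0 \<in> ?I" using i0 False by auto
        show "\<one> \<otimes> x i0 \<in> carrier R" using words_coord[OF xW i0(1)] by simp
        fix i assume i: "i \<in> ?I" "i \<noteq> i0"
        then have "i < n" by simp
        then have "x i = \<zero>" using uniq[of i] i(2) by blast
        then show "\<one> \<otimes> x i = \<zero>" by simp
      qed simp
      then have "x (n - 1) = x i0" using last words_coord[OF xW i0(1)] by simp
      then show False using uniq[of "n - 1"] i0 False n by simp
    qed
  qed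
  then show thesis using that[OF sys(1)] sys(2) by simp
qed

text \<open>If \<open>\<one> \<oplus> \<one>\<close> were nonzero, negation would have no fixed
  point on the nonzero elements and would pair them off, making \<open>card (carrier R)\<close>
  odd.\<close>

lemma even_card_char_two:
  assumes fin: "finite (carrier R)" and ev: "even (card (carrier R))" and x: "x \<in> carrier R"
  shows "x \<oplus> x = \<zero>"
proof -
  have "\<one> \<oplus> \<one> = \<zero>"
  proof (rule ccontr)
    assume two: "\<one> \<oplus> \<one> \<noteq> \<zero>"
    let ?G = "carrier R - {\<zero>}"
    let ?P = "(\<lambda>y. {y, \<ominus> y}) ` ?G"
    have neq: "\<ominus> y \<noteq> y" if y: "y \<in> ?G" for y
    proof
      assume "\<ominus> y = y"
      then have "y \<oplus> y = \<zero>" using y r_neg[of y] by simp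
      then have "(\<one> \<oplus> \<one>) \<otimes> y = \<zero>" using y by (simp add: l_distr)
      then show False using two y integral[of "\<one> \<oplus> \<one>" y] by simp
    qed
    have neg: "\<ominus> y \<in> ?G" if "y \<in> ?G" for y using that by auto
    have "2 dvd card (\<Union> ?P)"
    proof (rule dvd_partition)
      show "finite (\<Union> ?P)" using fin by auto
      show "\<forall>c\<in>?P. 2 dvd card c"
      proof
        fix c assume "c \<in> ?P"
        then obtain y where y: "c = {y, \<ominus> y}" "y \<in> ?G" by (rule imageE)
        then show "2 dvd card c" using neq[OF y(2), THEN not_sym] by simp
      qed
      show "\<forall>c1\<in>?P. \<forall>c2\<in>?P. c1 \<noteq> c2 \<longrightarrow> c1 \<inter> c2 = {}"
      proof (intro ballI impI, rule ccontr)
        fix c1 c2 assume "c1 \<in> ?P" "c2 \<in> ?P" and ne: "c1 \<noteq> c2" and int: "c1 \<inter> c2 \<noteq> {}"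
        then obtain y z where yz: "y \<in> carrier R" "z \<in> carrier R" "c1 = {y, \<ominus> y}" "c2 = {z, \<ominus> z}" by blast
        have "y = z \<or> y = \<ominus> z \<or> \<ominus> y = z \<or> \<ominus> y = \<ominus> z" using int yz by auto
        then have "y = z \<or> y = \<ominus> z" using yz(1,2) minus_minus[of y] minus_minus[of z] by metis
        then show False using ne yz minus_minus[of z] by auto
      qed
    qed
    moreover have "\<Union> ?P = ?G"
    proof (intro subset_antisym subsetI)
      fix z assume "z \<in> \<Union> ?P"
      then obtain y where y: "z \<in> {y, \<ominus> y}" "y \<in> ?G" by (elim UnionE imageE) simp
      then show "z \<in> ?G" using neg[OF y(2)] by (cases "z = y") simp_all
    next
      fix z assume "z \<in> ?G"
      then have "{z, \<ominus> z} \<in> ?P" by (rule imageI)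
      then show "z \<in> \<Union> ?P" by (rule UnionI) simp
    qed
    ultimately have "even (card ?G)" by (simp only:)
    moreover have "card (carrier R) = Suc (card ?G)" using card_Suc_Diff1[OF fin zero_closed] by (simp only:)
    ultimately show False using ev by (metis even_Suc)
  qed
  then have "(\<one> \<oplus> \<one>) \<otimes> x = \<zero>" using x by simp
  then show ?thesis using x by (simp add: l_distr)
qed

text \<open>In characteristic two the sum of the two equations is
  \<open>(u + v) (b + (u + v) c) = 0\<close>, and \<open>u + v\<close> is nonzero.\<close>

lemma char_two_quadratic_roots:
  assumes two: "\<And>x. x \<in> carrier R \<Longrightarrow> x \<oplus> x = \<zero>"
    and c: "a \<in> carrier R" "b \<in> carrier R" "c \<in> carrier R" "u \<in> carrier R" "v \<in> carrier R" and uv: "u \<noteq> v"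
    and root: "a \<oplus> (u \<otimes> b \<oplus> u \<otimes> u \<otimes> c) = \<zero>" "a \<oplus> (v \<otimes> b \<oplus> v \<otimes> v \<otimes> c) = \<zero>"
  shows "b \<oplus> (u \<oplus> v) \<otimes> c = \<zero>"
proof -
  have two': "x \<oplus> (x \<oplus> y) = y" if "x \<in> carrier R" "y \<in> carrier R" for x y
    using that two[of x] by (simp add: a_assoc[symmetric])
  have "(u \<oplus> v) \<otimes> (b \<oplus> (u \<oplus> v) \<otimes> c) =
      (a \<oplus> (u \<otimes> b \<oplus> u \<otimes> u \<otimes> c)) \<oplus> (a \<oplus> (v \<otimes> b \<oplus> v \<otimes> v \<otimes> c))"
    using c by (simp add: l_distr r_distr m_ac a_ac two two')
  also have "\<dots> = \<zero>" unfolding root by simp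
  finally have prod: "(u \<oplus> v) \<otimes> (b \<oplus> (u \<oplus> v) \<otimes> c) = \<zero>" .
  have "u \<oplus> v \<noteq> \<zero>"
  proof
    assume "u \<oplus> v = \<zero>"
    then have "v = v \<oplus> (u \<oplus> v)" using c by simp
    also have "\<dots> = u" using c two'[of v u] by (simp add: a_comm)
    finally show False using uv by simp
  qed
  then show ?thesis using integral[OF prod] c by simp
qed

text \<open>The evaluation points of a hyperoval in even characteristic, with the coordinates \<open>0\<close>, \<open>1\<close>, \<open>2\<close>
  for the parameter value \<open>0\<close>, the nucleus and the point at infinity.\<close>
definition hyperoval_code :: "nat \<Rightarrow> (nat \<Rightarrow> 'a) \<Rightarrow> (nat \<Rightarrow> 'a) set" where
  "hyperoval_code n t = systematic_code n {0, 1, 2} (\<lambda>j i. if i = 0 then \<one> else if i = 1 then t j else t j \<otimes> t j)"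

text \<open>The check matrix of \<open>hyperoval_code\<close> is transposed, without a minus sign
  because of characteristic two: the free coordinates are now those from 3 on, and 0, 1, 2 carry the
  checks.\<close>

definition dual_hyperoval_code :: "nat \<Rightarrow> (nat \<Rightarrow> 'a) \<Rightarrow> (nat \<Rightarrow> 'a) set" where
  "dual_hyperoval_code n t =
    systematic_code n {3..<n} (\<lambda>j i. if j = 0 then \<one> else if j = 1 then t i else t i \<otimes> t i)"

section \<open>Weights of the hyperoval code and of its dual\<close>

context
  fixes n :: nat and t :: "nat \<Rightarrow> 'a"
  assumes fin: "finite (carrier R)" and even_card: "even (card (carrier R))"
    and n_def: "n = card (carrier R) + 2" and t: "bij_betw t {3..<n} (carrier R - {\<zero>})"
begin

lemma hyperoval_n: "4 \<le> n"
  using two_le_card[OF fin] n_def by simp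

lemma t_closed: "j \<in> {3..<n} \<Longrightarrow> t j \<in> carrier R" and t_nonzero: "j \<in> {3..<n} \<Longrightarrow> t j \<noteq> \<zero>"
  using bij_betwE[OF t] by blast+

lemma complement_012: "{..<n} - {0, 1, 2} = {3..<n}"
  by auto

lemma complement_3n: "{..<n} - {3..<n} = {0, 1, 2}"
  using hyperoval_n by auto

lemma hyperoval_linear: "linear_code R n (hyperoval_code n t)"
  and hyperoval_card: "card (hyperoval_code n t) = card (carrier R) ^ 3"
proof -
  have I: "{0, 1, 2} \<subseteq> {..<n}" using hyperoval_n by auto
  have card012: "card {0, 1, 2::nat} = 3" by simp
  have A: "(if i = 0 then \<one> else if i = 1 then t j else t j \<otimes> t j) \<in> carrier R"
    if "j \<in> {..<n} - {0, 1, 2}" for j i :: nat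
    using t_closed[of j] that complement_012 by auto
  show "linear_code R n (hyperoval_code n t)" "card (hyperoval_code n t) = card (carrier R) ^ 3"
    unfolding hyperoval_code_def
    using systematic_code[OF fin I, of "\<lambda>j i. if i = 0 then \<one> else if i = 1 then t j else t j \<otimes> t j", OF A] card012
    by (simp_all only:)
qed

lemma dual_hyperoval_linear: "linear_code R n (dual_hyperoval_code n t)"
  and dual_hyperoval_card: "card (dual_hyperoval_code n t) = card (carrier R) ^ (n - 3)"
proof -
  have I: "{3..<n} \<subseteq> {..<n}" by auto
  have A: "(if j = 0 then \<one> else if j = 1 then t i else t i \<otimes> t i) \<in> carrier R"
    if "i \<in> {3..<n}" for j i :: nat
    using t_closed[OF that] by auto
  show "linear_code R n (dual_hyperoval_code n t)" "card (dual_hyperoval_code n t) = card (carrier R) ^ (n - 3)"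
    unfolding dual_hyperoval_code_def
    using systematic_code[OF fin I, of "\<lambda>j i. if j = 0 then \<one> else if j = 1 then t i else t i \<otimes> t i"] A by simp_all
qed

lemma finsum_012:
  assumes "\<And>i. i < 3 \<Longrightarrow> f i \<in> carrier R"
  shows "(\<Oplus>i\<in>{0, 1, 2::nat}. f i) = f 0 \<oplus> (f 1 \<oplus> f 2)"
proof -
  have "f 0 \<in> carrier R" "f 1 \<in> carrier R" "f 2 \<in> carrier R" using assms by simp_all
  then show ?thesis by (simp add: finsum_insert)
qed

lemma hyperoval_coord:
  assumes x: "x \<in> hyperoval_code n t" and j: "j \<in> {3..<n}"
  shows "x j = x 0 \<oplus> (t j \<otimes> x 1 \<oplus> t j \<otimes> t j \<otimes> x 2)"
proof -
  have xW: "x \<in> words n" using x by (simp add: hyperoval_code_def systematic_code_def)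
  have c: "x i \<in> carrier R" if "i < 3" for i using words_coord[OF xW, of i] that hyperoval_n by simp
  let ?f = "\<lambda>i. (if i = 0 then \<one> else if i = 1 then t j else t j \<otimes> t j) \<otimes> x i"
  have "x j = (\<Oplus>i\<in>{0, 1, 2}. ?f i)"
    using x j complement_012 unfolding hyperoval_code_def systematic_code_def by blast
  also have "\<dots> = ?f 0 \<oplus> (?f 1 \<oplus> ?f 2)" by (rule finsum_012) (use c t_closed[OF j] in auto)
  finally show ?thesis using c[of 0] by simp
qed

text \<open>At the positions in \<open>P\<close> a word lists the values of the polynomial
  \<open>x 0 + x 1 u + x 2 u ^ 2\<close> at all field elements \<open>u\<close>, and positions 1 and
  2 hold its upper coefficients. Three zeros force the polynomial to vanish, whichever of these two
  positions are among them.\<close>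

lemma hyperoval_weight:
  assumes x: "x \<in> hyperoval_code n t" "x \<noteq> vzero n"
  shows "n < 3 + hamming_weight R n x"
proof (rule ccontr)
  assume neg: "\<not> n < 3 + hamming_weight R n x"
  have xW: "x \<in> words n" using x by (simp add: hyperoval_code_def systematic_code_def)
  define Z where "Z = {i. i < n \<and> x i = \<zero>}"
  define P where "P = insert 0 {3..<n}"
  \<comment> \<open>Position 0 belongs to the parameter value zero, while \<open>t\<close>
    enumerates the nonzero ones from position 3 on.\<close>
  define u where "u j = (if j = 0 then \<zero> else t j)" for j :: nat
  have "{..<n} = Z \<union> {i. i < n \<and> x i \<noteq> \<zero>}" "Z \<inter> {i. i < n \<and> x i \<noteq> \<zero>} = {}" by (auto simp: Z_def)
  then have "n = card Z + hamming_weight R n x"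
    unfolding hamming_weight_def by (metis card_Un_disjoint card_lessThan finite_Un finite_lessThan)
  then have Z3: "3 \<le> card Z" using neg by linarith
  have finZ: "finite Z" by (simp add: Z_def)
  have c: "x 0 \<in> carrier R" "x 1 \<in> carrier R" "x 2 \<in> carrier R" using words_coord[OF xW] hyperoval_n by simp_all
  have u: "u j \<in> carrier R" if "j \<in> P" for j using that t_closed[of j] by (auto simp: P_def u_def)
  have u_inj: "u i \<noteq> u j" if ij: "i \<in> P" "j \<in> P" "i \<noteq> j" for i j
  proof -
    have inj: "inj_on t {3..<n}" by (rule bij_betw_imp_inj_on[OF t])
    consider "i = 0" "j \<in> {3..<n}" | "j = 0" "i \<in> {3..<n}" | "i \<in> {3..<n}" "j \<in> {3..<n}"
      using ij unfolding P_def by blast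
    then show ?thesis
    proof cases
      case 1
      then show ?thesis using t_nonzero[of j] by (simp add: u_def)
    next
      case 2
      then show ?thesis using t_nonzero[of i] by (simp add: u_def)
    next
      case 3
      then show ?thesis using inj_onD[OF inj _ 3] ij(3) by (auto simp: u_def)
    qed
  qed
  have eval: "x j = x 0 \<oplus> (u j \<otimes> x 1 \<oplus> u j \<otimes> u j \<otimes> x 2)" if "j \<in> P" for j
    using that hyperoval_coord[OF x(1), of j] c unfolding P_def u_def by auto
  have two: "\<And>y. y \<in> carrier R \<Longrightarrow> y \<oplus> y = \<zero>" by (rule even_card_char_two[OF fin even_card])
  have two': "y \<oplus> (y \<oplus> z) = z" if "y \<in> carrier R" "z \<in> carrier R" for y z
    using that two[of y] by (simp add: a_assoc[symmetric])
  \<comment> \<open>Two zeros at distinct parameters give one linear relation between the upper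
    coefficients.\<close>
  have rel: "x 1 \<oplus> (u i \<oplus> u j) \<otimes> x 2 = \<zero>" if ij: "i \<in> P \<inter> Z" "j \<in> P \<inter> Z" "i \<noteq> j" for i j
  proof (rule char_two_quadratic_roots[OF two c u u])
    show "i \<in> P" "j \<in> P" "u i \<noteq> u j" using ij u_inj by blast+
    show "x 0 \<oplus> (u i \<otimes> x 1 \<oplus> u i \<otimes> u i \<otimes> x 2) = \<zero>" using ij eval[of i] by (simp add: Z_def)
    show "x 0 \<oplus> (u j \<otimes> x 1 \<oplus> u j \<otimes> u j \<otimes> x 2) = \<zero>" using ij eval[of j] by (simp add: Z_def)
  qed
  have u_sum: "u i \<oplus> u j \<noteq> \<zero>" if "i \<in> P" "j \<in> P" "i \<noteq> j" for i j
  proof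
    assume s: "u i \<oplus> u j = \<zero>"
    have "u j = u i \<oplus> (u i \<oplus> u j)" using two'[OF u[OF that(1)] u[OF that(2)]] by simp
    also have "\<dots> = u i" using s u[OF that(1)] by simp
    finally show False using u_inj[OF that] by simp
  qed
  have sub: "Z - {1, 2} \<subseteq> P \<inter> Z" by (auto simp: Z_def P_def)
  have pick: "\<exists>T. T \<subseteq> P \<inter> Z \<and> card T = m" if "m \<le> card (Z - {1, 2})" for m
    using obtain_subset_with_card_n[OF that] sub by (metis subset_trans)
  \<comment> \<open>If positions 1 and 2 are both zeros, a third zero is still left in
    \<open>P\<close>. If one of them is, two zeros in \<open>P\<close> and their relation settle the
    other coefficient. If neither is, three zeros in \<open>P\<close> give two relations whose sum
    isolates \<open>x 2\<close>.\<close>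
  have x12: "x 1 = \<zero> \<and> x 2 = \<zero> \<and> (\<exists>i. i \<in> P \<inter> Z)"
  proof (cases "1 \<in> Z"; cases "2 \<in> Z")
    assume 12: "1 \<in> Z" "2 \<in> Z"
    then have "1 \<le> card (Z - {1, 2})" using Z3 finZ by (simp add: card_Diff_subset)
    then obtain T where "T \<subseteq> P \<inter> Z" "card T = 1" using pick by blast
    then show ?thesis using 12 by (auto simp: card_1_singleton_iff Z_def)
  next
    assume 12: "1 \<in> Z" "2 \<notin> Z"
    then have "Z - {1, 2} = Z - {1}" by auto
    then have "2 \<le> card (Z - {1, 2})" using Z3 finZ 12 by (simp add: card_Diff_subset)
    then obtain T where T: "T \<subseteq> P \<inter> Z" "card T = 2" using pick by blast
    then obtain i j where ij: "i \<in> P \<inter> Z" "j \<in> P \<inter> Z" "i \<noteq> j" by (auto simp: card_2_iff)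
    have x1: "x 1 = \<zero>" using 12 by (simp add: Z_def)
    have cs: "u i \<oplus> u j \<in> carrier R" using u ij by blast
    then have "(u i \<oplus> u j) \<otimes> x 2 = \<zero>" using rel[OF ij] x1 c by simp
    then have "x 2 = \<zero>" using integral[OF _ cs c(3)] u_sum[of i j] ij by blast
    then show ?thesis using x1 ij by blast
  next
    assume 12: "1 \<notin> Z" "2 \<in> Z"
    then have "Z - {1, 2} = Z - {2}" by auto
    then have "2 \<le> card (Z - {1, 2})" using Z3 finZ 12 by (simp add: card_Diff_subset)
    then obtain T where T: "T \<subseteq> P \<inter> Z" "card T = 2" using pick by blast
    then obtain i j where ij: "i \<in> P \<inter> Z" "j \<in> P \<inter> Z" "i \<noteq> j" by (auto simp: card_2_iff)
    have x2: "x 2 = \<zero>" using 12 by (simp add: Z_def)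
    have cs: "u i \<oplus> u j \<in> carrier R" using u ij by blast
    then have "x 1 = \<zero>" using rel[OF ij] x2 c by simp
    then show ?thesis using x2 ij by blast
  next
    assume 12: "1 \<notin> Z" "2 \<notin> Z"
    then have "Z - {1, 2} = Z" by auto
    then obtain T where T: "T \<subseteq> P \<inter> Z" "card T = 3" using pick[of 3] Z3 by auto
    then obtain i j k where ijk: "i \<in> P \<inter> Z" "j \<in> P \<inter> Z" "k \<in> P \<inter> Z" "i \<noteq> j" "i \<noteq> k" "j \<noteq> k"
      by (auto simp: card_3_iff)
    have cu: "u i \<in> carrier R" "u j \<in> carrier R" "u k \<in> carrier R" using u ijk by blast+
    have "(u j \<oplus> u k) \<otimes> x 2 = (x 1 \<oplus> (u i \<oplus> u j) \<otimes> x 2) \<oplus> (x 1 \<oplus> (u i \<oplus> u k) \<otimes> x 2)"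
      using cu c by (simp add: l_distr a_ac two two')
    also have "\<dots> = \<zero>" using rel[OF ijk(1,2,4)] rel[OF ijk(1,3,5)] by simp
    finally have "(u j \<oplus> u k) \<otimes> x 2 = \<zero>" .
    then have x2: "x 2 = \<zero>" using integral[of "u j \<oplus> u k" "x 2"] cu c u_sum[of j k] ijk by auto
    then have "x 1 = \<zero>" using rel[OF ijk(1,2,4)] cu c by simp
    then show ?thesis using x2 ijk(1) by blast
  qed
  then obtain i where i: "i \<in> P" "x i = \<zero>" by (auto simp: Z_def)
  have x0: "x 0 = \<zero>" using eval[OF i(1)] i(2) x12 c u[OF i(1)] by simp
  have "x j = \<zero>" if "j < n" for j
  proof (cases "j \<in> P")
    case True
    then show ?thesis using eval[OF True] x0 x12 u[OF True] by simp
  next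
    case False
    then have "j = 1 \<or> j = 2" using that by (auto simp: P_def)
    then show ?thesis using x12 by blast
  qed
  then show False using words_eq_zeroI[OF xW] x(2) by blast
qed

text \<open>Expanding \<open>y i\<close> at the positions from 3 on and collecting the checks of
  \<open>x\<close> gives the same three terms as positions 0, 1, 2, and the doubled sum vanishes in
  characteristic two.\<close>

lemma hyperoval_orthogonal:
  assumes x: "x \<in> dual_hyperoval_code n t" and y: "y \<in> hyperoval_code n t"
  shows "(\<Oplus>i\<in>{..<n}. x i \<otimes> y i) = \<zero>"
proof -
  let ?I = "{3..<n}"
  have xW: "x \<in> words n" using x by (simp add: dual_hyperoval_code_def systematic_code_def)
  have yW: "y \<in> words n" using y by (simp add: hyperoval_code_def systematic_code_def)
  have cx: "x i \<in> carrier R" if "i < n" for i by (rule words_coord[OF xW that])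
  have cy: "y i \<in> carrier R" if "i < n" for i by (rule words_coord[OF yW that])
  have small: "i < n" if "i < 3" for i using that hyperoval_n by simp
  have xj: "x j = (\<Oplus>i\<in>?I. (if j = 0 then \<one> else if j = 1 then t i else t i \<otimes> t i) \<otimes> x i)"
    if "j \<in> {0, 1, 2}" for j
    using x that complement_3n unfolding dual_hyperoval_code_def systematic_code_def by blast
  define h where "h j i = (if j = 0 then \<one> else if j = 1 then t i else t i \<otimes> t i) \<otimes> x i" for j i :: nat
  have hc: "h j i \<in> carrier R" if "i \<in> ?I" for j i
    using that t_closed[OF that] cx[of i] by (simp add: h_def)
  have xh: "(\<Oplus>i\<in>?I. h j i) = x j" if "j \<in> {0, 1, 2}" for j using xj[OF that] by (simp add: h_def)
  have yc: "y 0 \<in> carrier R" "y 1 \<in> carrier R" "y 2 \<in> carrier R" using cy small by simp_all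
  have xc: "x 0 \<in> carrier R" "x 1 \<in> carrier R" "x 2 \<in> carrier R" using cx small by simp_all
  have "(\<Oplus>i\<in>?I. x i \<otimes> y i) = (\<Oplus>i\<in>?I. h 0 i \<otimes> y 0 \<oplus> (h 1 i \<otimes> y 1 \<oplus> h 2 i \<otimes> y 2))"
  proof (rule finsum_cong')
    show "(\<lambda>i. h 0 i \<otimes> y 0 \<oplus> (h 1 i \<otimes> y 1 \<oplus> h 2 i \<otimes> y 2)) \<in> ?I \<rightarrow> carrier R" using hc yc by auto
    fix i assume i: "i \<in> ?I"
    have "x i \<in> carrier R" "t i \<in> carrier R" using cx[of i] t_closed[OF i] i by simp_all
    then show "x i \<otimes> y i = h 0 i \<otimes> y 0 \<oplus> (h 1 i \<otimes> y 1 \<oplus> h 2 i \<otimes> y 2)"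
      unfolding hyperoval_coord[OF y i] h_def using yc by (simp add: r_distr m_ac)
  qed simp
  also have "\<dots> = (\<Oplus>i\<in>?I. h 0 i \<otimes> y 0) \<oplus> (\<Oplus>i\<in>?I. h 1 i \<otimes> y 1 \<oplus> h 2 i \<otimes> y 2)"
    by (rule finsum_addf) (use hc yc in auto)
  also have "(\<Oplus>i\<in>?I. h 1 i \<otimes> y 1 \<oplus> h 2 i \<otimes> y 2) = (\<Oplus>i\<in>?I. h 1 i \<otimes> y 1) \<oplus> (\<Oplus>i\<in>?I. h 2 i \<otimes> y 2)"
    by (rule finsum_addf) (use hc yc in auto)
  also have "(\<Oplus>i\<in>?I. h 0 i \<otimes> y 0) = x 0 \<otimes> y 0"
    using finsum_ldistr[of ?I "y 0" "h 0"] hc yc xh[of 0] by auto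
  also have "(\<Oplus>i\<in>?I. h 1 i \<otimes> y 1) = x 1 \<otimes> y 1"
    using finsum_ldistr[of ?I "y 1" "h 1"] hc yc xh[of 1] by auto
  also have "(\<Oplus>i\<in>?I. h 2 i \<otimes> y 2) = x 2 \<otimes> y 2"
    using finsum_ldistr[of ?I "y 2" "h 2"] hc yc xh[of 2] by auto
  finally have sumI: "(\<Oplus>i\<in>?I. x i \<otimes> y i) = x 0 \<otimes> y 0 \<oplus> (x 1 \<otimes> y 1 \<oplus> x 2 \<otimes> y 2)" .
  have sum012: "(\<Oplus>i\<in>{0, 1, 2}. x i \<otimes> y i) = x 0 \<otimes> y 0 \<oplus> (x 1 \<otimes> y 1 \<oplus> x 2 \<otimes> y 2)"
    by (rule finsum_012) (use cx cy small in auto)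
  have union: "{..<n} = {0, 1, 2} \<union> ?I" using hyperoval_n by auto
  have "(\<Oplus>i\<in>{..<n}. x i \<otimes> y i) = (\<Oplus>i\<in>{0, 1, 2}. x i \<otimes> y i) \<oplus> (\<Oplus>i\<in>?I. x i \<otimes> y i)"
    unfolding union by (rule finsum_Un_disjoint) (use cx cy small in auto)
  also have "\<dots> = \<zero>"
    unfolding sumI sum012 by (rule even_card_char_two[OF fin even_card]) (use xc yc in simp)
  finally show ?thesis .
qed

text \<open>If the support had at most three positions, interpolation would give a hyperoval word
  that is 1 at one of them, \<open>i0\<close>, and 0 at the others. Its product with
  \<open>x\<close> is \<open>x i0\<close>, against orthogonality.\<close>

lemma dual_hyperoval_weight:
  assumes x: "x \<in> dual_hyperoval_code n t" "x \<noteq> vzero n"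
  shows "n < n - 3 + hamming_weight R n x"
proof (rule ccontr)
  assume neg: "\<not> n < n - 3 + hamming_weight R n x"
  let ?S = "{i. i < n \<and> x i \<noteq> \<zero>}"
  have xW: "x \<in> words n" using x by (simp add: dual_hyperoval_code_def systematic_code_def)
  have "card ?S \<le> 3" using neg hyperoval_n by (simp add: hamming_weight_def)
  moreover have "3 \<le> card {..<n}" using hyperoval_n by simp
  moreover have "?S \<subseteq> {..<n}" by auto
  \<comment> \<open>The support is enlarged to exactly three positions, the number that
    interpolation prescribes.\<close>
  ultimately obtain T where T: "?S \<subseteq> T" "T \<subseteq> {..<n}" "card T = 3"
    using exists_subset_between[of ?S 3 "{..<n}"] by blast
  obtain i0 where i0: "i0 < n" "x i0 \<noteq> \<zero>" using words_eq_zeroI[OF xW] x(2) by blast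
  have c: "x i0 \<in> carrier R" by (rule words_coord[OF xW i0(1)])
  have bij: "bij_betw (\<lambda>y. restrict y T) (hyperoval_code n t) (T \<rightarrow>\<^sub>E carrier R)"
    by (rule code_interpolation[OF hyperoval_linear hyperoval_weight T(2,3) linear_code_words[OF hyperoval_linear] fin hyperoval_card])
  let ?d = "\<lambda>i\<in>T. if i = i0 then \<one> else \<zero>"
  have "?d \<in> T \<rightarrow>\<^sub>E carrier R" by simp
  then have "?d \<in> (\<lambda>y. restrict y T) ` hyperoval_code n t" by (simp only: bij_betw_imp_surj_on[OF bij])
  then obtain y where y: "?d = restrict y T" "y \<in> hyperoval_code n t" by (rule imageE)
  have yW: "y \<in> words n" using y by (simp add: hyperoval_code_def systematic_code_def)
  have yT: "y i = (if i = i0 then \<one> else \<zero>)" if "i \<in> T" for i using fun_cong[OF y(1), of i] that by simp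
  have y0: "y i0 = \<one>" using yT[of i0] T(1) i0 by auto
  have "(\<Oplus>i\<in>{..<n}. x i \<otimes> y i) = x i0 \<otimes> y i0"
  proof (rule finsum_delta)
    fix i assume i: "i \<in> {..<n}" "i \<noteq> i0"
    show "x i \<otimes> y i = \<zero>"
    proof (cases "i \<in> T")
      case True
      then show ?thesis using yT[of i] i words_coord[OF xW, of i] by simp
    next
      case False
      then have "x i = \<zero>" using T(1) i by auto
      then show ?thesis using i words_coord[OF yW, of i] by simp
    qed
  qed (use i0 c y0 in auto)
  then show False using hyperoval_orthogonal[OF x(1) y(2)] y0 c i0 by simp
qed

end

lemma hyperoval_parametrization:
  assumes "finite (carrier R)" "n = card (carrier R) + 2"
  obtains t where "bij_betw t {3..<n} (carrier R - {\<zero>})"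
proof -
  have "card {3..<n} = card (carrier R - {\<zero>})"
    using assms by simp
  then show thesis using that assms finite_same_card_bij[of "{3..<n}" "carrier R - {\<zero>}"] by auto
qed

end

section \<open>Existence and restriction of the parameters\<close>

context chain_ring_generator begin

text \<open>The lifted code is its own socle part, so its rank is read off from its size, and the
  MDS property suffices for MHD.\<close>

lemma mhd_code_from_field_code:
  assumes E: "linear_code F n E" and card: "card E = q ^ k"
    and wt: "\<And>v. v \<in> E \<Longrightarrow> v \<noteq> ring.vzero F n \<Longrightarrow> n < k + hamming_weight F n v"
  shows "\<exists>D. linear_code R n D \<and> code_rank R n D = k \<and> mhd_code R g n D"
proof (intro exI conjI)
  interpret F: field F by (rule residue_field_field)
  let ?D = "socle_lift n ` E"
  have EW: "E \<subseteq> F.words n" by (rule F.linear_code_words[OF E])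
  show D: "linear_code R n ?D" by (rule linear_code_lift[OF E])
  have DS: "?D \<subseteq> socle_words R g n" using EW bij_betwE[OF socle_lift_bij[of n]] by blast
  have "inj_on (socle_lift n) E"
    using bij_betw_imp_inj_on[OF socle_lift_bij[of n]] EW by (rule inj_on_subset)
  then have cardD: "card ?D = q ^ k" using card by (simp add: card_image)
  moreover have "?D \<inter> socle_words R g n = ?D" using DS by blast
  ultimately have "q ^ code_rank R n ?D = q ^ k" using card_socle_code[OF D] by simp
  then show "code_rank R n ?D = k" using q_ge_2 by (simp add: power_inject_exp)
  have "n < k + hamming_weight R n x" if x: "x \<in> ?D" "x \<noteq> vzero n" for x
  proof -
    obtain v where v: "x = socle_lift n v" "v \<in> E" using x(1) by (rule imageE)
    have "v \<noteq> F.vzero n" using x(2) v socle_lift_zero[of n] by blast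
    then show ?thesis using wt[OF v(2)] socle_lift_weight[of v n] v EW by auto
  qed
  then have "socle_mds_code R g n ?D" unfolding socle_mds_code_iff[OF D DS] using cardD by blast
  then show "mhd_code R g n ?D" by (rule socle_mds_imp_mhd[OF D DS])
qed

lemma exists_mhd_parity:
  assumes "2 \<le> n"
  shows "\<exists>D. linear_code R n D \<and> code_rank R n D = n - 1 \<and> mhd_code R g n D"
proof -
  interpret F: field F by (rule residue_field_field)
  obtain E where E: "linear_code F n E" "card E = card (carrier F) ^ (n - 1)"
    "\<And>x. x \<in> E \<Longrightarrow> x \<noteq> F.vzero n \<Longrightarrow> n < n - 1 + hamming_weight F n x"
    using F.parity_code[OF finite_F assms] by blast
  show ?thesis by (rule mhd_code_from_field_code[OF E(1) _ E(3)]) (use E(2) in \<open>simp_all add: card_F\<close>)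
qed

lemma exists_mhd_hyperoval:
  assumes ev: "even q" and n: "n = q + 2" and K: "K \<in> {3, n - 3}"
  shows "\<exists>D. linear_code R n D \<and> code_rank R n D = K \<and> mhd_code R g n D"
proof -
  interpret F: field F by (rule residue_field_field)
  have ev': "even (card (carrier F))" and n': "n = card (carrier F) + 2" using ev n by (simp_all add: card_F)
  obtain t where t: "bij_betw t {3..<n} (carrier F - {\<zero>\<^bsub>F\<^esub>})"
    using F.hyperoval_parametrization[OF finite_F n'] by blast
  note H = finite_F ev' n' t
  from K consider "K = 3" | "K = n - 3" by blast
  then show ?thesis
  proof cases
    case 1
    show ?thesis unfolding 1
      by (rule mhd_code_from_field_code[OF F.hyperoval_linear[OF H] _ F.hyperoval_weight[OF H]])
        (simp_all add: F.hyperoval_card[OF H] card_F)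
  next
    case 2
    show ?thesis unfolding 2
      by (rule mhd_code_from_field_code[OF F.dual_hyperoval_linear[OF H] _ F.dual_hyperoval_weight[OF H]])
        (simp_all add: F.dual_hyperoval_card[OF H] card_F)
  qed
qed

lemma mds_conjecture_socle_bound:
  assumes conj: "mds_conjecture" and n: "n \<ge> 1" and C: "linear_code R n C"
    and mds: "socle_mds_code R g n (C \<inter> socle_words R g n)"
    and K: "code_rank R n C \<notin> {0, 1, n - 1, n}"
  shows "if even q \<and> (code_rank R n C = 3 \<or> code_rank R n C = q - 1) then n \<le> q + 2 else n \<le> q + 1"
proof -
  interpret F: field F by (rule residue_field_field)
  let ?D = "C \<inter> socle_words R g n"
  let ?E = "residue_code R g n ?D"
  have D: "linear_code R n ?D" by (rule linear_code_socle_part[OF C])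
  have E: "linear_code F n ?E" by (rule linear_code_residue[OF D])
  have "card ?E = card ?D" using bij_betw_same_card[OF residue_code_bij[OF Int_lower2]] .
  then have "card ?E = card (carrier F) ^ code_rank R n C" using card_socle_code[OF C] by (simp add: card_F)
  then have dim: "code_dim F n ?E = code_rank R n C" using F.code_dim_iff[OF finite_F E] by simp
  have "mds_code F n ?E" using mds by (simp add: socle_mds_code_def)
  from F.mds_conjecture_bound[OF conj finite_F n E this dim K] show ?thesis by (simp only: card_F)
qed

end

theorem theorem21:
  fixes R :: "('a, 'b) ring_scheme" and \<gamma> :: 'a and q n K :: nat
  assumes "mds_conjecture"
    and "finite_chain_ring R"
    and "generates_maximal_ideal R \<gamma>"
    and "q = residue_size R \<gamma>"
    and "n \<ge> 1"
  shows "(\<forall>C. linear_code R n C \<and> code_rank R n C = K \<longrightarrow>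
      (K \<in> {0, n} \<longrightarrow> mhd_code R \<gamma> n C) \<and>
      (n > q + 1 \<and> K = 1 \<longrightarrow>
        (mhd_code R \<gamma> n C \<longleftrightarrow> C \<subseteq> socle_words R \<gamma> n \<and> socle_mds_code R \<gamma> n C)) \<and>
      (n > q + 1 \<and> q > 2 \<and> K = n - 1 \<longrightarrow>
        (mhd_code R \<gamma> n C \<longleftrightarrow> socle_mds_code R \<gamma> n (C \<inter> socle_words R \<gamma> n))) \<and>
      (n = q + 1 \<and> K \<in> {1, 2} \<longrightarrow>
        (mhd_code R \<gamma> n C \<longleftrightarrow> C \<subseteq> socle_words R \<gamma> n \<and> socle_mds_code R \<gamma> n C)) \<and>
      (n = q \<and> K = 1 \<longrightarrow>
        (mhd_code R \<gamma> n C \<longleftrightarrow> C \<subseteq> socle_words R \<gamma> n \<and> socle_mds_code R \<gamma> n C)) \<and>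
      (n \<le> q + 1 \<and> int K > int n - int q + 1 \<longrightarrow>
        (mhd_code R \<gamma> n C \<longleftrightarrow> socle_mds_code R \<gamma> n (C \<inter> socle_words R \<gamma> n))) \<and>
      (n > q + 1 \<and> q = 2 \<and> K = n - 1 \<longrightarrow>
        (mhd_code R \<gamma> n C \<longrightarrow> socle_mds_code R \<gamma> n (C \<inter> socle_words R \<gamma> n))) \<and>
      (even q \<and> n = q + 2 \<and> K \<in> {3, n - 3} \<longrightarrow>
        (mhd_code R \<gamma> n C \<longrightarrow> socle_mds_code R \<gamma> n (C \<inter> socle_words R \<gamma> n))) \<and>
      (\<not> (K \<in> {0, n} \<or>
          n > q + 1 \<and> K = 1 \<or>
          n > q + 1 \<and> q > 2 \<and> K = n - 1 \<or>
          n = q + 1 \<and> K \<in> {1, 2} \<or>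
          n = q \<and> K = 1 \<or>
          n \<le> q + 1 \<and> int K > int n - int q + 1 \<or>
          n > q + 1 \<and> q = 2 \<and> K = n - 1 \<or>
          even q \<and> n = q + 2 \<and> K \<in> {3, n - 3}) \<longrightarrow>
        \<not> mhd_code R \<gamma> n C)) \<and>
    (n > q + 1 \<and> q = 2 \<and> K = n - 1 \<longrightarrow>
      (\<exists>D. linear_code R n D \<and> code_rank R n D = K \<and> mhd_code R \<gamma> n D)) \<and>
    (even q \<and> n = q + 2 \<and> K \<in> {3, n - 3} \<longrightarrow>
      (\<exists>D. linear_code R n D \<and> code_rank R n D = K \<and> mhd_code R \<gamma> n D))"
proof -
  interpret chain_ring_generator R \<gamma>
    using assms(2,3) by (intro chain_ring_generator.intro chain_ring_generator_axioms.intro)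
  have qdef: "residue_size R \<gamma> = q" using assms(4) by simp
  have q2: "2 \<le> q" using q_ge_2 by (simp add: qdef)
  have ex7: "n > q + 1 \<and> q = 2 \<and> K = n - 1 \<longrightarrow>
      (\<exists>D. linear_code R n D \<and> code_rank R n D = K \<and> mhd_code R \<gamma> n D)"
    using exists_mhd_parity[of n] by simp
  have ex8: "even q \<and> n = q + 2 \<and> K \<in> {3, n - 3} \<longrightarrow>
      (\<exists>D. linear_code R n D \<and> code_rank R n D = K \<and> mhd_code R \<gamma> n D)"
    using exists_mhd_hyperoval[of n K] unfolding qdef by blast
  {
    fix C assume C: "linear_code R n C" and K: "code_rank R n C = K"
    let ?mhd = "mhd_code R \<gamma> n C"
    let ?mds = "socle_mds_code R \<gamma> n (C \<inter> socle_words R \<gamma> n)"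
    let ?in = "C \<subseteq> socle_words R \<gamma> n \<and> socle_mds_code R \<gamma> n C"
    have c1: "K \<in> {0, n} \<Longrightarrow> ?mhd" using mhd_extremal_rank[OF C] K by simp
    have nec: "?mhd \<Longrightarrow> ?mds" by (rule mhd_imp_socle_mds[OF C])
    have suf: "?mds \<Longrightarrow> int K > int n - int q + 1 \<Longrightarrow> ?mhd"
      using socle_mds_high_rank_imp_mhd[OF C] unfolding K qdef by blast
    have suf': "?in \<Longrightarrow> ?mhd" using socle_mds_imp_mhd[OF C] by blast
    have nec': "?in" if "?mhd" "C \<subseteq> socle_words R \<gamma> n"
    proof -
      have "C \<inter> socle_words R \<gamma> n = C" using that(2) by blast
      then show ?thesis using nec[OF that(1)] that(2) by simp
    qed
    have one: "?mhd \<longleftrightarrow> ?in" if "K = 1" "q \<le> n"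
      using suf' nec' mhd_rank_one_in_socle[OF C] that unfolding K qdef by blast
    have two: "?mhd \<longleftrightarrow> ?in" if "K = 2" "n = q + 1"
      using suf' nec' mhd_rank_two_in_socle[OF C] that unfolding K qdef by blast
    have high: "?mhd \<longleftrightarrow> ?mds" if "int K > int n - int q + 1"
      using nec suf[OF _ that] by blast
    have c4: "?mhd \<longleftrightarrow> ?in" if "n = q + 1" "K \<in> {1, 2}"
      using that one two by auto
    \<comment> \<open>Here \<open>n - K = 1\<close>, and \<open>q > 2\<close> is exactly the
      condition of the high-rank criterion.\<close>
    have c3: "?mhd \<longleftrightarrow> ?mds" if "n > q + 1" "q > 2" "K = n - 1"
      by (rule high) (use that in linarith)
    have rest: "n > q + 1 \<and> K = 1 \<or> n > q + 1 \<and> q > 2 \<and> K = n - 1 \<or>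
        n = q + 1 \<and> K \<in> {1, 2} \<or> n = q \<and> K = 1 \<or> n \<le> q + 1 \<and> int K > int n - int q + 1 \<or>
        n > q + 1 \<and> q = 2 \<and> K = n - 1 \<or> even q \<and> n = q + 2 \<and> K \<in> {3, n - 3}"
      if mhd: "?mhd" and K0: "K \<notin> {0, n}"
    proof (cases "n \<le> q + 1")
      case True
      show ?thesis
      proof (cases "int K > int n - int q + 1")
        case False
        have "K \<noteq> 0" using K0 by simp
        \<comment> \<open>From \<open>1 \<le> K \<le> n - q + 1 \<le> 2\<close> only these pairs
          remain.\<close>
        then have "n = q + 1 \<and> (K = 1 \<or> K = 2) \<or> n = q \<and> K = 1" using True False by linarith
        then show ?thesis by blast
      qed (use True in blast)
    next
      case False
      show ?thesis
      proof (cases "K \<in> {1, n - 1}")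
        case True
        have "q = 2 \<or> q > 2" using q2 by linarith
        then show ?thesis using True False by auto
      next
        case ntriv: False
        have "if even q \<and> (K = 3 \<or> K = q - 1) then n \<le> q + 2 else n \<le> q + 1"
          using mds_conjecture_socle_bound[OF assms(1,5) C nec[OF mhd]] K0 ntriv unfolding K qdef by blast
        then have "even q \<and> (K = 3 \<or> K = q - 1) \<and> n \<le> q + 2" using False by (auto split: if_splits)
        \<comment> \<open>The bounds \<open>q + 1 < n \<le> q + 2\<close> fix \<open>n\<close>, and
          then \<open>q - 1\<close> is \<open>n - 3\<close>.\<close>
        then have "even q \<and> n = q + 2 \<and> (K = 3 \<or> K = n - 3)" using False by auto
        then show ?thesis by blast
      qed
    qed
    \<comment> \<open>The order fixes the numbering in \<open>facts\<close>. The equivalence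
      \<open>one\<close> serves cases (2) and (5), and \<open>nec\<close> serves (7) and
      (8).\<close>
    note c1 one c3 c4 high nec rest
  }
  note facts = this
  show ?thesis
  proof (intro conjI allI impI, goal_cases)
    case (1 C)
    then show ?case using facts(1)[of C] by blast
  next
    case (2 C)
    then show ?case using facts(2)[of C] by simp
  next
    case (3 C)
    then show ?case using facts(3)[of C] by blast
  next
    case (4 C)
    then show ?case using facts(4)[of C] by blast
  next
    case (5 C)
    then show ?case using facts(2)[of C] by simp
  next
    case (6 C)
    then show ?case using facts(5)[of C] by blast
  next
    case (7 C)
    then show ?case using facts(6)[of C] by blast
  next
    case (8 C)
    then show ?case using facts(6)[of C] by blast
  next
    case (9 C)
    then show ?case using facts(7)[of C] by blast
  next
    case 10
    then show ?case using ex7 by blast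
  next
    case 11
    then show ?case using ex8 by blast
  qed
qed

end
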